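(* Let $n\ge 2$ and let $A$ be a maximal abelian subalgebra of the Cuntz algebra $\mathcal{O}_n$ such that $\omega_t(A)\subset A$ for all $t\in\mathbb{T}$, $\sigma(A)\subset A$ and $\tilde{\sigma}(A)\subset A$. Then there is a unitary $u\in M_n(\mathbb{C})$ such that the automorphism $\alpha_U$ of $\mathcal{O}_n$ satisfies $\alpha_U(A)=\mathcal{D}$. Furthermore, $\alpha_U$ commutes with $\omega_t$ (for every $t\in\mathbb{T}$), with $\sigma$ and with $\tilde{\sigma}$.
   Context: $\mathcal{O}_n=C^*(s_1,\dots,s_n)$ is the Cuntz algebra, generated by isometries $s_1,\dots,s_n$ with $\sum_{i=1}^n s_is_i^*=1$. For a finite word $\mu=i_1\cdots i_k$ in $\{1,\dots,n\}$ write $s_\mu=s_{i_1}\cdots s_{i_k}$ (with $s_\emptyset=1$). The standard circle action is the action $\omega:\mathbb{T}\to\mathrm{Aut}(\mathcal{O}_n)$ determined by $\omega_t(s_i)=ts_i$. The canonical endomorphism is $\sigma(x)=\sum_{i=1}^n s_ixs_i^*$. The "second shift" is the endomorphism $\tilde{\sigma}(x)=\sum_{i,j,k=1}^n s_is_ks_i^*\,x\,s_js_k^*s_j^*$. $\mathcal{D}=C^*\{s_\mu s_\mu^*:\mu \text{ a finite word}\}$. For a unitary $u=[u_{ij}]\in M_n(\mathbb{C})$, put $U=\sum_{i,j}u_{ij}s_is_j^*$ (a unitary in $\mathcal{O}_n$); $\alpha_U$ denotes the automorphism of $\mathcal{O}_n$ determined by $\alpha_U(s_i)=Us_i$, $i=1,\dots,n$.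 *)

theory Defs
  imports "HOL-Analysis.Analysis"
begin

class cstar_algebra = real_normed_algebra_1 + banach +
  fixes cscale :: "complex \<Rightarrow> 'a \<Rightarrow> 'a"
    and cstar :: "'a \<Rightarrow> 'a"
  assumes cscale_of_real: "cscale (of_real r) x = r *\<^sub>R x"
    and cscale_add_right: "cscale a (x + y) = cscale a x + cscale a y"
    and cscale_add_left: "cscale (a + b) x = cscale a x + cscale b x"
    and cscale_cscale: "cscale a (cscale b x) = cscale (a * b) x"
    and cscale_left_mult: "cscale a x * y = cscale a (x * y)"
    and cscale_right_mult: "x * cscale a y = cscale a (x * y)"
    and norm_cscale: "norm (cscale a x) = norm a * norm x"
    and cstar_cstar: "cstar (cstar x) = x"
    and cstar_add: "cstar (x + y) = cstar x + cstar y"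
    and cstar_mult: "cstar (x * y) = cstar y * cstar x"
    and cstar_cscale: "cstar (cscale a x) = cscale (cnj a) (cstar x)"
    and cstar_identity: "norm (cstar x * x) = (norm x)\<^sup>2"

definition cstar_subalgebra :: "'a::cstar_algebra set \<Rightarrow> bool" where
  "cstar_subalgebra B \<longleftrightarrow> 0 \<in> B \<and> closed B \<and>
     (\<forall>x\<in>B. \<forall>y\<in>B. x + y \<in> B \<and> x * y \<in> B) \<and>
     (\<forall>x\<in>B. \<forall>a. cscale a x \<in> B) \<and> (\<forall>x\<in>B. cstar x \<in> B)"

definition cstar_generated :: "'a::cstar_algebra set \<Rightarrow> 'a set" where
  "cstar_generated S = \<Inter>{B. cstar_subalgebra B \<and> S \<subseteq> B}"

definition abelian_set :: "'a::cstar_algebra set \<Rightarrow> bool" where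
  "abelian_set B \<longleftrightarrow> (\<forall>x\<in>B. \<forall>y\<in>B. x * y = y * x)"

definition maximal_abelian :: "'a::cstar_algebra set \<Rightarrow> bool" where
  "maximal_abelian A \<longleftrightarrow> cstar_subalgebra A \<and> abelian_set A \<and>
     (\<forall>B. cstar_subalgebra B \<and> abelian_set B \<and> A \<subseteq> B \<longrightarrow> B = A)"

definition cstar_automorphism :: "('a::cstar_algebra \<Rightarrow> 'a) \<Rightarrow> bool" where
  "cstar_automorphism f \<longleftrightarrow> bij f \<and> continuous_on UNIV f \<and>
     (\<forall>x y. f (x + y) = f x + f y \<and> f (x * y) = f x * f y) \<and>
     (\<forall>a x. f (cscale a x) = cscale a (f x)) \<and> f 1 = 1 \<and>
     (\<forall>x. f (cstar x) = cstar (f x))"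

text \<open>Cuntz isometries s_1..s_n generating the algebra (by simplicity of O_n, any such
  algebra is canonically O_n).\<close>
definition cuntz_generators :: "nat \<Rightarrow> (nat \<Rightarrow> 'a::cstar_algebra) \<Rightarrow> bool" where
  "cuntz_generators n s \<longleftrightarrow>
     (\<forall>i\<in>{1..n}. cstar (s i) * s i = 1) \<and>
     (\<Sum>i=1..n. s i * cstar (s i)) = 1 \<and>
     cstar_generated (s ` {1..n}) = UNIV"

definition word_op :: "(nat \<Rightarrow> 'a::cstar_algebra) \<Rightarrow> nat list \<Rightarrow> 'a" where
  "word_op s mu = foldr (\<lambda>i x. s i * x) mu 1"

definition diag_alg :: "nat \<Rightarrow> (nat \<Rightarrow> 'a::cstar_algebra) \<Rightarrow> 'a set" where
  "diag_alg n s = cstar_generated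
     {word_op s mu * cstar (word_op s mu) | mu. mu \<in> lists {1..n}}"

definition canon_endo :: "nat \<Rightarrow> (nat \<Rightarrow> 'a::cstar_algebra) \<Rightarrow> 'a \<Rightarrow> 'a" where
  "canon_endo n s x = (\<Sum>i=1..n. s i * x * cstar (s i))"

definition second_shift :: "nat \<Rightarrow> (nat \<Rightarrow> 'a::cstar_algebra) \<Rightarrow> 'a \<Rightarrow> 'a" where
  "second_shift n s x = (\<Sum>i=1..n. \<Sum>j=1..n. \<Sum>k=1..n.
      s i * s k * cstar (s i) * x * s j * cstar (s k) * cstar (s j))"

definition unitary_mat :: "nat \<Rightarrow> (nat \<Rightarrow> nat \<Rightarrow> complex) \<Rightarrow> bool" where
  "unitary_mat n u \<longleftrightarrow>
     (\<forall>i\<in>{1..n}. \<forall>j\<in>{1..n}. (\<Sum>k=1..n. u i k * cnj (u j k)) = (if i = j then 1 else 0)) \<and>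
     (\<forall>i\<in>{1..n}. \<forall>j\<in>{1..n}. (\<Sum>k=1..n. cnj (u k i) * u k j) = (if i = j then 1 else 0))"

definition mat_unitary_elem :: "nat \<Rightarrow> (nat \<Rightarrow> 'a::cstar_algebra) \<Rightarrow> (nat \<Rightarrow> nat \<Rightarrow> complex) \<Rightarrow> 'a" where
  "mat_unitary_elem n s u = (\<Sum>i=1..n. \<Sum>j=1..n. cscale (u i j) (s i * cstar (s j)))"

end

(*
  Let H k be the span of the words s_mu of length k, a Hilbert space with inner product xi^* eta.
  A maximal abelian A equals its commutant. Since sigma^k(a) eta = eta a for eta in H k, and A is
  sigma-invariant, all compressions xi^* b eta of b in A lie in A again; invariance under the second
  shift gives the same for sigma(xi)^* b sigma(eta).

  A lies in the core: the homogeneous part of degree k > 0 of an element of A has compressions that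
  are close to H k and normal. But h in H k satisfies h^* h = |h|^2, while h h^* is a multiple of a
  proper projection, so these compressions vanish. Fejer means reduce to homogeneous parts.

  The elements of A of the form sum c_ij s_i s_j^* act on H 1 as commuting operators, so H 1 has an
  orthonormal basis t_1, ..., t_n of common eigenvectors. Compressing b in A by sigma(xi s_1^r) and
  sigma(eta s_1^r) converges, as r grows, to such an element. Hence all slices of b are diagonal in
  the basis t, so t_i^* b t_j = 0 for distinct i, j. Iterating, A is contained in the diagonal
  algebra of t, and equals it by maximality. The unitary U = sum s_i t_i^* maps t_i to s_i.

  No functional calculus or positivity is used: estimates of C*-norms are obtained up to polynomial
  factors and sharpened by passing to powers of x^* x. In particular alpha_U is isometric on
  polynomials because it is so on each of their boundedly many homogeneous parts, where it is a
  two-sided multiplication by unitaries.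
*)
theory Submission
  imports Defs
begin

subsection \<open>C*-algebras\<close>

text \<open>In tensor terms, the core is an infinite tensor product of n x n matrices, with
  \<open>E 1 1\<close> as first factor. Compression by \<open>H m\<close> strips the leading m
  factors, so it can never isolate the first one. The second shift is the canonical endomorphism of
  the Cuntz family \<open>\<sigma> (s k)\<close>, which begins at the second factor; compression by
  \<open>\<sigma> \<xi>\<close> keeps the first factor and strips the m factors after it. This is
  why both shifts are needed to bring everything down to level one. Two facts usually taken for
  granted have to be earned. The hypotheses give isometries whose range projections sum to 1, but
  not their orthogonality; without order theory this comes from the extremality of 1 in the unit
  ball. And O_n is given by generators, not by a universal property, so the existence of alpha_U
  rests on norm estimates for polynomials, with the gauge action supplying the grading.\<close>

lemma cscale_one [simp]: "cscale 1 x = (x::'a::cstar_algebra)"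
  using cscale_of_real[of 1 x] by simp

lemma cscale_zero_left [simp]: "cscale 0 x = (0::'a::cstar_algebra)"
  using cscale_of_real[of 0 x] by simp

lemma cscale_zero_right [simp]: "cscale a (0::'a::cstar_algebra) = 0"
  using cscale_add_right[of a 0 0] by simp

lemma cscale_minus_right: "cscale a (- x) = - cscale a (x::'a::cstar_algebra)"
  using cscale_add_right[of a x "- x"] by (simp add: eq_neg_iff_add_eq_0 add.commute)

lemma cscale_minus_left: "cscale (- a) x = - cscale a (x::'a::cstar_algebra)"
  using cscale_add_left[of a "- a" x] by (simp add: eq_neg_iff_add_eq_0 add.commute)

lemma cscale_diff_right: "cscale a (x - y) = cscale a x - cscale a (y::'a::cstar_algebra)"
  using cscale_add_right[of a x "- y"] by (simp add: cscale_minus_right)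

lemma cscale_diff_left: "cscale (a - b) x = cscale a x - cscale b (x::'a::cstar_algebra)"
  using cscale_add_left[of a "- b" x] by (simp add: cscale_minus_left)

lemma cscale_sum_right: "cscale a (sum f I) = (\<Sum>i\<in>I. cscale a (f i :: 'a::cstar_algebra))"
  by (induction I rule: infinite_finite_induct) (auto simp: cscale_add_right)

lemma cscale_sum_left: "cscale (sum f I) x = (\<Sum>i\<in>I. cscale (f i) (x :: 'a::cstar_algebra))"
  by (induction I rule: infinite_finite_induct) (auto simp: cscale_add_left)

lemma cstar_zero [simp]: "cstar (0::'a::cstar_algebra) = 0"
  using cstar_add[of 0 0] by simp

lemma cstar_minus: "cstar (- x) = - cstar (x::'a::cstar_algebra)"
  using cstar_add[of x "- x"] by (simp add: eq_neg_iff_add_eq_0 add.commute)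

lemma cstar_diff: "cstar (x - y) = cstar x - cstar (y::'a::cstar_algebra)"
  using cstar_add[of x "- y"] by (simp add: cstar_minus)

lemma cstar_one [simp]: "cstar (1::'a::cstar_algebra) = 1"
  by (metis cstar_cstar cstar_mult mult.right_neutral mult.left_neutral)

lemma cstar_sum: "cstar (sum f I) = (\<Sum>i\<in>I. cstar (f i :: 'a::cstar_algebra))"
  by (induction I rule: infinite_finite_induct) (auto simp: cstar_add)

lemma cstar_scaleR: "cstar (r *\<^sub>R x) = r *\<^sub>R cstar (x::'a::cstar_algebra)"
  by (metis cscale_of_real cstar_cscale complex_cnj_complex_of_real)

lemma cstar_power: "cstar (x ^ k) = cstar (x::'a::cstar_algebra) ^ k"
  by (induction k) (auto simp: cstar_mult power_commutes)

lemma norm_cstar [simp]: "norm (cstar x) = norm (x::'a::cstar_algebra)"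
proof -
  have *: "norm y \<le> norm (cstar y)" for y :: 'a
  proof (cases "y = 0")
    case False
    have "norm y * norm y \<le> norm (cstar y) * norm y"
      using cstar_identity[of y] norm_mult_ineq[of "cstar y" y] by (simp add: power2_eq_square)
    then show ?thesis using False by simp
  qed auto
  show ?thesis using *[of x] *[of "cstar x"] by (simp add: cstar_cstar)
qed

lemma norm_mult_le: "norm x \<le> a \<Longrightarrow> norm y \<le> b \<Longrightarrow> norm (x * y) \<le> a * b"
  for x y :: "'a::real_normed_algebra"
  by (rule order_trans[OF norm_mult_ineq]) (auto intro!: mult_mono intro: order_trans[OF norm_ge_zero])

lemma norm_contract2: "norm x \<le> 1 \<Longrightarrow> norm z \<le> 1 \<Longrightarrow> norm (x * y * z) \<le> norm y"
  for x y z :: "'a::real_normed_algebra"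
  using norm_mult_le[OF norm_mult_le[of x 1 y "norm y"], of z 1] by simp

lemma bounded_linear_cstar: "bounded_linear (cstar :: 'a::cstar_algebra \<Rightarrow> 'a)"
  by (rule bounded_linear_intro[where K=1]) (auto simp: cstar_add cstar_scaleR)

lemma bounded_linear_cscale: "bounded_linear (cscale a :: 'a::cstar_algebra \<Rightarrow> 'a)"
proof (rule bounded_linear_intro[where K="norm a"])
  show "cscale a (r *\<^sub>R x) = r *\<^sub>R cscale a x" for r and x :: 'a
    by (metis cscale_cscale cscale_of_real mult.commute)
qed (auto simp: cscale_add_right norm_cscale)

lemmas tendsto_cstar = bounded_linear.tendsto[OF bounded_linear_cstar]
lemmas continuous_on_cstar [continuous_intros] = bounded_linear.continuous_on[OF bounded_linear_cstar]
lemmas tendsto_cscale = bounded_linear.tendsto[OF bounded_linear_cscale]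
lemmas continuous_on_cscale [continuous_intros] = bounded_linear.continuous_on[OF bounded_linear_cscale]

lemma isometry_norm: "cstar x * x = (1::'a::cstar_algebra) \<Longrightarrow> norm x = 1"
  using cstar_identity[of x] by (simp add: power2_eq_1_iff) (metis norm_ge_zero not_one_le_zero neg_0_le_iff_le)

text \<open>The exponents are powers of two because each squaring is one application of the
  C*-identity.\<close>

lemma selfadj_norm_power2:
  assumes "cstar y = (y::'a::cstar_algebra)"
  shows "norm (y ^ (2 ^ r)) = norm y ^ (2 ^ r)"
proof (induction r)
  case (Suc r)
  have "norm (y ^ (2 ^ Suc r)) = norm (cstar (y ^ (2 ^ r)) * y ^ (2 ^ r))"
    by (simp add: cstar_power assms mult_2 power_add)
  also have "\<dots> = norm y ^ (2 ^ Suc r)"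
    by (simp add: cstar_identity Suc flip: power_mult) (simp add: mult.commute)
  finally show ?case .
qed auto

text \<open>If b < a, then K (m + 1) (b/a)^m tends to 0, whereas the hypothesis keeps it at least 1
  along m = 2^r. The linear factor leaves room for the number of homogeneous parts of an m-th power,
  which grows linearly in m.\<close>

lemma power_growth_bound:
  fixes a b K :: real
  assumes "b \<ge> 0" and le: "\<And>r::nat. a ^ (2 ^ r) \<le> K * (2 ^ r + 1) * b ^ (2 ^ r)"
  shows "a \<le> b"
proof (rule ccontr)
  assume "\<not> a \<le> b"
  then have ab: "b < a" "a > 0" using assms by auto
  define x where "x = b / a"
  have x: "0 \<le> x" "x < 1" using ab assms by (auto simp: x_def)
  have "(\<lambda>m. real m * x ^ m) \<longlonglongrightarrow> 0"
    by (rule powser_times_n_limit_0) (use x in auto)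
  moreover have "(\<lambda>m. x ^ m) \<longlonglongrightarrow> 0" by (rule LIMSEQ_power_zero) (use x in auto)
  ultimately have "(\<lambda>m. K * (real m * x ^ m + x ^ m)) \<longlonglongrightarrow> K * (0 + 0)"
    by (intro tendsto_mult tendsto_add tendsto_const)
  then have "((\<lambda>m. K * (real m * x ^ m + x ^ m)) \<circ> (\<lambda>r. 2 ^ r)) \<longlonglongrightarrow> 0"
    by (intro LIMSEQ_subseq_LIMSEQ) (auto simp: strict_mono_def)
  moreover have "((\<lambda>m. K * (real m * x ^ m + x ^ m)) \<circ> (\<lambda>r. 2 ^ r)) r \<ge> 1" for r
    using le[of r] ab by (simp add: x_def power_divide field_simps)
  ultimately have "(1::real) \<le> 0" by (intro LIMSEQ_le_const) auto
  then show False by simp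
qed

text \<open>The norm of a C*-algebra is a spectral radius, so estimates of polynomial quality for
  the powers of \<open>x\<^sup>* x\<close> already bound \<open>x\<close> itself.\<close>
lemma norm_le_by_powers:
  fixes x :: "'a::cstar_algebra"
  assumes "c \<ge> 0" and "\<And>r. norm ((cstar x * x) ^ (2 ^ r)) \<le> K * (2 ^ r + 1) * (c\<^sup>2) ^ (2 ^ r)"
  shows "norm x \<le> c"
proof -
  have sa: "cstar (cstar x * x) = cstar x * x" by (simp add: cstar_mult cstar_cstar)
  have "norm (cstar x * x) \<le> c\<^sup>2"
  proof (rule power_growth_bound)
    show "norm (cstar x * x) ^ 2 ^ r \<le> K * (2 ^ r + 1) * (c\<^sup>2) ^ 2 ^ r" for r
      using assms(2)[of r] unfolding selfadj_norm_power2[OF sa] .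
  qed simp
  then show ?thesis using assms(1) by (simp add: cstar_identity)
qed

lemma bounded_linear_if_continuous:
  fixes f :: "'a::real_normed_vector \<Rightarrow> 'b::real_normed_vector"
  assumes "linear f" "continuous_on UNIV f"
  shows "bounded_linear f"
proof -
  have "isCont f 0" using assms(2) by (simp add: continuous_on_eq_continuous_at)
  then obtain d where d: "d > 0" "\<And>x. norm x < d \<Longrightarrow> norm (f x) < 1"
    using linear_0[OF assms(1)] unfolding continuous_at_eps_delta
    by (metis dist_0_norm dist_commute zero_less_one)
  have "norm (f x) \<le> norm x * (2 / d)" for x
  proof (cases "x = 0")
    case False
    define k where "k = d / (2 * norm x)"
    have k: "k > 0" using d False by (simp add: k_def)
    have "norm (k *\<^sub>R x) < d" using d False by (simp add: k_def)
    then have "norm (f (k *\<^sub>R x)) < 1" by (rule d)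
    then have "k * norm (f x) < 1" using k linear_scale[OF assms(1), of k x] by simp
    then show ?thesis using d False by (simp add: k_def field_simps)
  qed (use linear_0[OF assms(1)] in simp)
  then show ?thesis
    using assms(1) unfolding bounded_linear_def bounded_linear_axioms_def by blast
qed

section \<open>Contractive unital star homomorphisms\<close>

definition star_hom :: "('a::cstar_algebra \<Rightarrow> 'a) \<Rightarrow> bool" where
  "star_hom f \<longleftrightarrow> (\<forall>x y. f (x + y) = f x + f y \<and> f (x * y) = f x * f y) \<and>
     (\<forall>a x. f (cscale a x) = cscale a (f x)) \<and> f 1 = 1 \<and>
     (\<forall>x. f (cstar x) = cstar (f x)) \<and> (\<forall>x. norm (f x) \<le> norm x)"

lemma
  assumes "star_hom f"
  shows star_hom_add: "f (x + y) = f x + f y" and star_hom_mult: "f (x * y) = f x * f y"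
    and star_hom_cscale: "f (cscale a x) = cscale a (f x)" and star_hom_one: "f 1 = 1"
    and star_hom_cstar: "f (cstar x) = cstar (f x)" and star_hom_norm: "norm (f x) \<le> norm x"
  using assms by (auto simp: star_hom_def)

lemma star_hom_linear: "star_hom f \<Longrightarrow> linear f"
  by (rule linearI) (auto simp: star_hom_add star_hom_cscale simp flip: cscale_of_real)

lemma star_hom_bounded_linear: "star_hom f \<Longrightarrow> bounded_linear f"
  using star_hom_linear[of f] star_hom_norm[of f]
  by (auto simp: bounded_linear_def bounded_linear_axioms_def intro!: exI[of _ 1])

lemmas star_hom_continuous_on = bounded_linear.continuous_on[OF star_hom_bounded_linear]

lemma star_hom_sum: "star_hom f \<Longrightarrow> f (sum g I) = (\<Sum>i\<in>I. f (g i))"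
  using linear_sum[OF star_hom_linear] by blast

lemmas star_hom_simps = star_hom_add star_hom_mult star_hom_cscale star_hom_one star_hom_cstar star_hom_sum

text \<open>Powers of x^* x go to powers of f(x)^* f(x), so K is only a constant factor, which
  \<open>norm_le_by_powers\<close> absorbs. Contractivity thus follows from boundedness.\<close>

lemma star_homI_bounded:
  assumes "\<And>x y. f (x + y) = f x + f y" "\<And>x y. f (x * y) = f x * f y"
    and "\<And>a x. f (cscale a x) = cscale a (f x)" "f 1 = 1" "\<And>x. f (cstar x) = cstar (f x)"
    and K: "\<And>x. norm (f x) \<le> norm x * K" "K \<ge> 0"
  shows "star_hom f"
proof -
  have pw: "f (x ^ k) = f x ^ k" for x k by (induction k) (use assms in auto)
  have "norm (f x) \<le> norm x" for x
  proof (rule norm_le_by_powers[where K=K])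
    fix r :: nat
    have "norm ((cstar (f x) * f x) ^ (2 ^ r)) = norm (f ((cstar x * x) ^ (2 ^ r)))"
      using assms by (simp add: pw)
    also have "\<dots> \<le> norm ((cstar x * x) ^ (2 ^ r)) * K" by (rule K)
    also have "\<dots> \<le> norm (cstar x * x) ^ (2 ^ r) * K"
      using K by (intro mult_right_mono norm_power_ineq)
    also have "\<dots> \<le> K * (2 ^ r + 1) * ((norm x)\<^sup>2) ^ (2 ^ r)"
      using K by (simp add: cstar_identity algebra_simps)
    finally show "norm ((cstar (f x) * f x) ^ (2 ^ r)) \<le> K * (2 ^ r + 1) * ((norm x)\<^sup>2) ^ (2 ^ r)" .
  qed simp
  then show ?thesis using assms by (simp add: star_hom_def)
qed

lemma cstar_automorphism_imp_star_hom:
  assumes f: "cstar_automorphism f"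
  shows "star_hom f"
proof -
  note fs = f[unfolded cstar_automorphism_def]
  have lin: "linear f" by (rule linearI) (use fs in \<open>auto simp flip: cscale_of_real\<close>)
  obtain K where "\<And>x. norm (f x) \<le> norm x * K" "K \<ge> 0"
    using bounded_linear.nonneg_bounded[OF bounded_linear_if_continuous[OF lin]] fs by blast
  then show ?thesis using fs by (intro star_homI_bounded[where K=K]) auto
qed

lemma star_hom_compose: "star_hom f \<Longrightarrow> star_hom g \<Longrightarrow> star_hom (f \<circ> g)"
  unfolding star_hom_def by (auto intro: order_trans)

lemma star_hom_id: "star_hom id"
  by (simp add: star_hom_def)

lemma star_hom_funpow: "star_hom f \<Longrightarrow> star_hom (f ^^ k)"
  by (induction k) (auto intro: star_hom_compose simp: star_hom_id)

lemma star_homs_imp_cstar_automorphism: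
  assumes "star_hom f" "star_hom g" "\<And>x. f (g x) = x" "\<And>x. g (f x) = x"
  shows "cstar_automorphism f"
proof -
  have "bij f" by (rule bij_betw_byWitness[where f'=g]) (use assms in auto)
  then show ?thesis using assms(1) star_hom_continuous_on[OF assms(1), of UNIV "\<lambda>x. x"]
    by (simp add: cstar_automorphism_def star_hom_simps)
qed

section \<open>Generated C*-subalgebras and commutants\<close>

lemma cstar_generated_superset: "S \<subseteq> cstar_generated S"
  by (auto simp: cstar_generated_def)

lemma cstar_generated_minimal: "cstar_subalgebra B \<Longrightarrow> S \<subseteq> B \<Longrightarrow> cstar_generated S \<subseteq> B"
  by (auto simp: cstar_generated_def)

lemma cstar_subalgebra_generated: "cstar_subalgebra (cstar_generated S)"
  unfolding cstar_generated_def cstar_subalgebra_def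
  by (auto intro!: closed_Inter)

lemma cstar_subalgebra_sum:
  "cstar_subalgebra B \<Longrightarrow> (\<And>i. i \<in> I \<Longrightarrow> f i \<in> B) \<Longrightarrow> sum f I \<in> B"
  by (induction I rule: infinite_finite_induct) (auto simp: cstar_subalgebra_def)

lemma star_homs_eq_on_generators:
  assumes f: "star_hom f" and g: "star_hom g"
    and gen: "cstar_generated S = UNIV" and eq: "\<And>x. x \<in> S \<Longrightarrow> f x = g x"
  shows "f = g"
proof -
  have "closed {x. f x = g x}"
    using star_hom_continuous_on[OF f, of UNIV "\<lambda>x. x"] star_hom_continuous_on[OF g, of UNIV "\<lambda>x. x"]
    by (intro closed_Collect_eq) auto
  then have "cstar_subalgebra {x. f x = g x}"
    using linear_0[OF star_hom_linear[OF f]] linear_0[OF star_hom_linear[OF g]]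
    by (auto simp: cstar_subalgebra_def star_hom_simps f g)
  then have "cstar_generated S \<subseteq> {x. f x = g x}"
    by (rule cstar_generated_minimal) (use eq in auto)
  then show ?thesis using gen by auto
qed

lemma cstar_subalgebra_vimage:
  assumes f: "star_hom f" and B: "cstar_subalgebra B"
  shows "cstar_subalgebra (f -` B)"
proof -
  have "closed (f -` B)"
    using star_hom_continuous_on[OF f, of UNIV "\<lambda>x. x"] B
    by (intro continuous_closed_vimage) (auto simp: cstar_subalgebra_def continuous_on_eq_continuous_at)
  then show ?thesis
    using B linear_0[OF star_hom_linear[OF f]] by (auto simp: cstar_subalgebra_def star_hom_simps f)
qed

lemma star_hom_image_generated:
  assumes "star_hom f"
  shows "f ` cstar_generated S \<subseteq> cstar_generated (f ` S)"
  using cstar_generated_minimal[OF cstar_subalgebra_vimage[OF assms cstar_subalgebra_generated], of S "f ` S"]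
    cstar_generated_superset[of "f ` S"] by auto

definition commutant :: "'a::cstar_algebra set \<Rightarrow> 'a set" where
  "commutant S = {x. \<forall>y\<in>S. x * y = y * x}"

lemma cstar_subalgebra_commutant:
  assumes "cstar ` S \<subseteq> S"
  shows "cstar_subalgebra (commutant S)"
proof -
  have "commutant S = (\<Inter>y\<in>S. {x. x * y = y * x})" by (auto simp: commutant_def)
  moreover have "closed {x. x * y = y * x}" for y :: 'a
    by (intro closed_Collect_eq continuous_intros)
  ultimately have "closed (commutant S)" by auto
  moreover have "cstar x \<in> commutant S" if "x \<in> commutant S" for x
    using that assms unfolding commutant_def
    by (auto simp: image_subset_iff) (metis cstar_cstar cstar_mult)
  moreover have "x * y \<in> commutant S" if "x \<in> commutant S" "y \<in> commutant S" for x y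
    using that unfolding commutant_def mem_Collect_eq by (metis mult.assoc)
  ultimately show ?thesis
    unfolding cstar_subalgebra_def
    by (auto simp: commutant_def cscale_left_mult cscale_right_mult distrib_left distrib_right)
qed

text \<open>The commutant argument runs twice: S commutes with itself, so the generated algebra
  commutes with S; hence S lies in the commutant of the generated algebra, and so does everything it
  generates.\<close>

lemma abelian_generated:
  assumes "cstar ` S \<subseteq> S" "abelian_set S"
  shows "abelian_set (cstar_generated S)"
proof -
  have 1: "cstar_generated S \<subseteq> commutant S"
    using assms by (intro cstar_generated_minimal cstar_subalgebra_commutant)
      (auto simp: abelian_set_def commutant_def)
  have "cstar ` cstar_generated S \<subseteq> cstar_generated S"
    using cstar_subalgebra_generated[of S] by (auto simp: cstar_subalgebra_def)
  then have "cstar_generated S \<subseteq> commutant (cstar_generated S)"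
    using 1 by (intro cstar_generated_minimal cstar_subalgebra_commutant) (auto simp: commutant_def)
  then show ?thesis by (auto simp: abelian_set_def commutant_def)
qed

text \<open>Adjoining x to A yields an abelian algebra only if x commutes with its adjoint.
  Self-adjoint elements are therefore treated first, and a general x is recombined from x + x^* and
  i (x - x^* ).\<close>

lemma maximal_abelian_commutant:
  assumes A: "maximal_abelian A"
  shows "commutant A \<subseteq> A"
proof
  have Asub: "cstar_subalgebra A" and Aab: "abelian_set A"
    using A by (auto simp: maximal_abelian_def)
  have star: "cstar ` A \<subseteq> A" using Asub by (auto simp: cstar_subalgebra_def)
  have sa: "x \<in> A" if "cstar x = x" "x \<in> commutant A" for x
  proof -
    have "abelian_set (cstar_generated (insert x A))"
      using that star Aab by (intro abelian_generated) (auto simp: abelian_set_def commutant_def)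
    then have "cstar_generated (insert x A) = A"
      using A cstar_subalgebra_generated[of "insert x A"] cstar_generated_superset[of "insert x A"]
      by (auto simp: maximal_abelian_def)
    then show ?thesis using cstar_generated_superset[of "insert x A"] by auto
  qed
  fix x assume x: "x \<in> commutant A"
  note C = cstar_subalgebra_commutant[OF star]
  have xs: "cstar x \<in> commutant A" using x C by (auto simp: cstar_subalgebra_def)
  have 1: "x + cstar x \<in> A"
    using x xs C by (intro sa) (auto simp: cstar_subalgebra_def cstar_add cstar_cstar)
  have "x + cscale (-1) (cstar x) \<in> commutant A"
    using x xs C unfolding cstar_subalgebra_def by blast
  then have "cscale \<i> (x + cscale (-1) (cstar x)) \<in> commutant A"
    using C unfolding cstar_subalgebra_def by blast
  then have 2: "cscale \<i> (x + cscale (-1) (cstar x)) \<in> A"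
    by (rule sa[rotated]) (simp add: cstar_cscale cstar_add cstar_diff cstar_cstar
      cscale_minus_left cscale_diff_right)
  \<comment> \<open>The factor -i undoes the i that made x - x^* self-adjoint, so the inner sum is 2
    x.\<close>
  have "cscale (1/2) ((x + cstar x) + cscale (-\<i>) (cscale \<i> (x + cscale (-1) (cstar x)))) \<in> A"
    using 1 2 Asub by (auto simp: cstar_subalgebra_def)
  also have "cscale (1/2) ((x + cstar x) + cscale (-\<i>) (cscale \<i> (x + cscale (-1) (cstar x))))
      = cscale (1/2) (cscale 1 x + cscale 1 x)"
    by (simp add: cscale_cscale cscale_minus_left)
  also have "\<dots> = x" by (simp only: cscale_add_left[symmetric] cscale_cscale) simp
  finally show "x \<in> A" .
qed

subsection \<open>Averaging over roots of unity\<close>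

definition ang :: "nat \<Rightarrow> nat \<Rightarrow> real" where
  "ang L r = 2 * pi * real r / real L"

text \<open>The bound on i excludes aliasing: a nonzero multiple of L would give the sum L as
  well.\<close>

lemma sum_cis_roots:
  fixes i :: int
  assumes "\<bar>i\<bar> < int L"
  shows "(\<Sum>r<L. cis (of_int i * ang L r)) = (if i = 0 then of_nat L else 0)"
proof (cases "i = 0")
  case False
  define w where "w = cis (of_int i * (2 * pi / real L))"
  have L: "L > 0" using assms by auto
  have "w \<noteq> 1"
  proof
    assume "w = 1"
    then have "cos (of_int i * (2 * pi / real L)) = 1" by (simp add: w_def complex_eq_iff)
    then obtain k :: int where "of_int i * (2 * pi / real L) = of_int k * 2 * pi"
      by (auto simp: cos_one_2pi_int)
    then have "real_of_int i = real_of_int (k * int L)" using L by (simp add: field_simps)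
    then have "i = k * int L" by (simp only: of_int_eq_iff)
    then have "int L dvd i" by simp
    then show False using assms False zdvd_imp_le[of "int L" "\<bar>i\<bar>"] by auto
  qed
  have "w ^ L = cis (real L * (of_int i * (2 * pi / real L)))"
    unfolding w_def by (simp only: Complex.DeMoivre)
  also have "\<dots> = cis (2 * pi * of_int i)"
    by (rule arg_cong[where f=cis]) (use L in \<open>simp add: field_simps\<close>)
  finally have "w ^ L = cis (2 * pi * of_int i)" .
  then have "w ^ L = 1" by simp
  moreover have "cis (of_int i * ang L r) = w ^ r" for r
    unfolding w_def Complex.DeMoivre by (simp add: ang_def field_simps)
  ultimately show ?thesis using False \<open>w \<noteq> 1\<close> by (simp add: geometric_sum)
qed simp

text \<open>For z on the circle, the product of 1 + z a with its adjoint is 1 + 2 x a + a^2 with x =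
  cos \<theta>. This is affine in x, hence a convex combination of its values (1 + a)^2 and (1 -
  a)^2 at x = 1 and x = -1.\<close>

lemma selfadj_extreme_cis:
  fixes a :: "'a::cstar_algebra"
  assumes sa: "cstar a = a" and "norm (1 + a) \<le> 1" "norm (1 - a) \<le> 1"
  shows "norm (1 + cscale (cis \<theta>) a) \<le> 1"
proof -
  define x where "x = cos \<theta>"
  have x: "\<bar>x\<bar> \<le> 1" by (simp add: x_def)
  have zz: "cis \<theta> * cnj (cis \<theta>) = 1" by (simp add: cis_cnj cis_mult)
  have "cscale (cis \<theta>) a + cscale (cnj (cis \<theta>)) a = (2 * x) *\<^sub>R a"
    by (simp add: x_def complex_eq_iff flip: cscale_add_left cscale_of_real)
      (rule arg_cong[where f="\<lambda>c. cscale c a"], simp add: complex_eq_iff)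
  moreover have "cstar (1 + cscale (cis \<theta>) a) * (1 + cscale (cis \<theta>) a) =
      1 + (cscale (cis \<theta>) a + cscale (cnj (cis \<theta>)) a) + a * a"
    by (simp add: cstar_add cstar_cscale sa algebra_simps cscale_left_mult cscale_right_mult cscale_cscale
        cscale_add_right zz)
  ultimately have "cstar (1 + cscale (cis \<theta>) a) * (1 + cscale (cis \<theta>) a) = 1 + (2 * x) *\<^sub>R a + a * a"
    by simp
  also have "\<dots> = ((1 + x) / 2) *\<^sub>R ((1 + a) * (1 + a)) + ((1 - x) / 2) *\<^sub>R ((1 - a) * (1 - a))"
  proof -
    have "((1 + x) / 2) *\<^sub>R ((1 + a) * (1 + a)) + ((1 - x) / 2) *\<^sub>R ((1 - a) * (1 - a)) =
       ((1 + x) / 2 + (1 - x) / 2) *\<^sub>R (1 + a * a) + ((1 + x) / 2 - (1 - x) / 2) *\<^sub>R (a + a)"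
      unfolding scaleR_add_left scaleR_diff_left by (simp add: algebra_simps)
    also have "(1 + x) / 2 + (1 - x) / 2 = 1" by (simp add: field_simps)
    also have "(1 + x) / 2 - (1 - x) / 2 = x" by (simp add: field_simps)
    finally show ?thesis by (simp add: algebra_simps scaleR_2 flip: scaleR_scaleR)
  qed
  also have "norm \<dots> \<le> (1 + x) / 2 * (1 * 1) + (1 - x) / 2 * (1 * 1)"
    using x norm_mult_le[OF assms(2) assms(2)] norm_mult_le[OF assms(3) assms(3)]
    by (intro norm_triangle_le add_mono) (simp_all add: mult_left_le)
  finally have "(norm (1 + cscale (cis \<theta>) a))\<^sup>2 \<le> 1"
    unfolding cstar_identity by (simp add: field_simps)
  then show ?thesis by (simp add: power_le_one_iff)
qed

text \<open>The unit is an extreme point of the unit ball: the first Fourier coefficient of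
  \<open>z \<mapsto> (1 + z a)\<^sup>k\<close> is \<open>k a\<close>, while the function is bounded by one on the circle.\<close>
lemma selfadj_extreme_zero:
  fixes a :: "'a::cstar_algebra"
  assumes sa: "cstar a = a" and n: "norm (1 + a) \<le> 1" "norm (1 - a) \<le> 1"
  shows "a = 0"
proof -
  \<comment> \<open>L times the j-th coefficient of (1 + z a)^k, read off from samples at the L-th
    roots of unity. The recursion \<open>rec\<close> is Pascal's rule.\<close>
  define f where "f L k (j::int) = (\<Sum>r<L. cscale (cis (of_int (- j) * ang L r))
      ((1 + cscale (cis (ang L r)) a) ^ k))" for L k j
  have rec: "f L (Suc k) j = f L k j + f L k (j - 1) * a" for L k j
  proof -
    have *: "cscale (cis (of_int (- j) * ang L r)) (y * (1 + cscale (cis (ang L r)) a)) =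
        cscale (cis (of_int (- j) * ang L r)) y + cscale (cis (of_int (- (j - 1)) * ang L r)) y * a" for r y
      by (simp add: distrib_left cscale_add_right cscale_left_mult cscale_right_mult cscale_cscale cis_mult)
        (simp add: algebra_simps)
    show ?thesis
      unfolding f_def power_Suc2 * by (simp add: sum.distrib sum_distrib_right)
  qed
  have base: "f L 0 j = (if j = 0 then of_nat L else 0)" if "\<bar>j\<bar> < int L" for L j
  proof -
    have "f L 0 j = cscale (\<Sum>r<L. cis (of_int (- j) * ang L r)) 1"
      by (simp add: f_def cscale_sum_left)
    also have "(\<Sum>r<L. cis (of_int (- j) * ang L r)) = (if j = 0 then of_nat L else 0)"
      using sum_cis_roots[of "- j" L] that by simp
    finally show ?thesis
      using cscale_of_real[of "real L" "1::'a"] by (auto simp: scaleR_conv_of_real)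
  qed
  \<comment> \<open>The recursion reaches down to degree j - k, which has to stay above -L because L
    samples cannot tell degree -L from degree 0.\<close>
  have neg: "f L k j = 0" if "int k - int L < j" "j < 0" for L k j
    using that
  proof (induction k arbitrary: j)
    case (Suc k)
    then show ?case using rec[of L k j] by simp
  qed (use base in auto)
  have zero: "f L k 0 = of_nat L" if "k < L" for L k
    using that
  proof (induction k)
    case (Suc k)
    then show ?case using rec[of L k 0] neg[of k L "-1"] by simp
  qed (use base in auto)
  have one: "f L k 1 = of_nat L * of_nat k * a" if "k < L" "L > 1" for L k
    using that
  proof (induction k)
    case (Suc k)
    then show ?case using rec[of L k 1] zero[of k L] by (simp add: algebra_simps)
  qed (use base in auto)
  have le: "norm (f L k j) \<le> real L" for L k j
  proof -
    have "norm (f L k j) \<le> (\<Sum>r<L. 1)"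
      unfolding f_def
      by (intro sum_norm_le) (auto simp: norm_cscale intro!: order_trans[OF norm_power_ineq]
        power_le_one selfadj_extreme_cis[OF sa n])
    then show ?thesis by simp
  qed
  \<comment> \<open>With L = k + 1 samples the coefficient is exactly k a, and the bound L on the
    sum cancels the factor L.\<close>
  have "real k * norm a \<le> 1" if "k > 0" for k
  proof -
    have "of_nat (Suc k) * of_nat k * a = (real (Suc k) * real k) *\<^sub>R a"
      by (simp add: scaleR_conv_of_real)
    then have "(real (Suc k) * real k) * norm a \<le> real (Suc k)"
      using le[of "Suc k" k 1] one[of k "Suc k"] that by simp
    then have "real (Suc k) * (real k * norm a) \<le> real (Suc k) * 1" by (simp only: mult.assoc mult_1_right)
    then show ?thesis by (subst (asm) mult_le_cancel_left_pos) auto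
  qed
  then have "real k * norm a \<le> 1" for k by (cases "k = 0") auto
  then show ?thesis using reals_Archimedean3[of "norm a"] by (metis linorder_not_le norm_le_zero_iff)
qed

subsection \<open>Complex linear spans\<close>

definition csubspace :: "'a::cstar_algebra set \<Rightarrow> bool" where
  "csubspace T \<longleftrightarrow> 0 \<in> T \<and> (\<forall>x\<in>T. \<forall>y\<in>T. x + y \<in> T) \<and> (\<forall>x\<in>T. \<forall>a. cscale a x \<in> T)"

text \<open>The \<open>span\<close> of the underlying vector space is real; here the scalars act
  through \<open>cscale\<close>.\<close>

inductive_set cspan :: "'a::cstar_algebra set \<Rightarrow> 'a set" for X where
  cspan_base: "x \<in> X \<Longrightarrow> x \<in> cspan X"
| cspan_zero: "0 \<in> cspan X"
| cspan_add: "x \<in> cspan X \<Longrightarrow> y \<in> cspan X \<Longrightarrow> x + y \<in> cspan X"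
| cspan_cscale: "x \<in> cspan X \<Longrightarrow> cscale a x \<in> cspan X"

lemma csubspace_cspan [simp]: "csubspace (cspan X)"
  by (auto simp: csubspace_def intro: cspan.intros)

lemma cspan_minimal: "csubspace T \<Longrightarrow> X \<subseteq> T \<Longrightarrow> cspan X \<subseteq> T"
proof
  fix x assume T: "csubspace T" "X \<subseteq> T" and "x \<in> cspan X"
  from this(3) show "x \<in> T" by induction (use T in \<open>auto simp: csubspace_def\<close>)
qed

lemma csubspace_add: "csubspace T \<Longrightarrow> x \<in> T \<Longrightarrow> y \<in> T \<Longrightarrow> x + y \<in> T"
  and csubspace_cscale: "csubspace T \<Longrightarrow> x \<in> T \<Longrightarrow> cscale a x \<in> T"
  and csubspace_0: "csubspace T \<Longrightarrow> 0 \<in> T"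
  by (auto simp: csubspace_def)

lemma csubspace_diff: "csubspace T \<Longrightarrow> x \<in> T \<Longrightarrow> y \<in> T \<Longrightarrow> x - y \<in> T"
  using csubspace_add[of T x "cscale (-1) y"] csubspace_cscale[of T y "-1"]
  by (simp add: cscale_minus_left)

lemma csubspace_sum: "csubspace T \<Longrightarrow> (\<And>i. i \<in> I \<Longrightarrow> f i \<in> T) \<Longrightarrow> sum f I \<in> T"
  by (induction I rule: infinite_finite_induct) (auto simp: csubspace_def)

lemma cstar_subalgebra_imp_csubspace: "cstar_subalgebra B \<Longrightarrow> csubspace B"
  by (auto simp: csubspace_def cstar_subalgebra_def)

lemma csubspace_vimage_mult_right: "csubspace T \<Longrightarrow> csubspace {x. x * y \<in> T}"
  by (auto simp: csubspace_def distrib_right cscale_left_mult)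

lemma csubspace_vimage_mult_left: "csubspace T \<Longrightarrow> csubspace {x. y * x \<in> T}"
  by (auto simp: csubspace_def distrib_left cscale_right_mult)

lemma csubspace_vimage_cstar: "csubspace T \<Longrightarrow> csubspace {x. cstar x \<in> T}"
  by (auto simp: csubspace_def cstar_add cstar_cscale)

lemma cspan_mult:
  assumes "csubspace T" "\<And>x y. x \<in> X \<Longrightarrow> y \<in> Y \<Longrightarrow> x * y \<in> T" "x \<in> cspan X" "y \<in> cspan Y"
  shows "x * y \<in> T"
proof -
  have "cspan X \<subseteq> {x. x * y \<in> T}"
  proof (rule cspan_minimal[OF csubspace_vimage_mult_right[OF assms(1)]], safe)
    fix x assume x: "x \<in> X"
    have "cspan Y \<subseteq> {y. x * y \<in> T}"
      by (rule cspan_minimal[OF csubspace_vimage_mult_left[OF assms(1)]]) (use assms(2) x in auto)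
    then show "x * y \<in> T" using assms(4) by auto
  qed
  then show ?thesis using assms(3) by auto
qed

lemma cspan_cstar:
  assumes "csubspace T" "\<And>x. x \<in> X \<Longrightarrow> cstar x \<in> T" "x \<in> cspan X"
  shows "cstar x \<in> T"
  using cspan_minimal[OF csubspace_vimage_cstar[OF assms(1)], of X] assms(2,3) by auto

subsection \<open>Cuntz families\<close>

text \<open>Generation of the whole algebra is left out so that the locale also covers
  \<open>\<sigma> (s k)\<close>, which generate only the range of \<open>\<sigma>\<close>.\<close>

locale cuntz_family =
  fixes n :: nat and s :: "nat \<Rightarrow> 'a::cstar_algebra"
  assumes isometry: "i \<in> {1..n} \<Longrightarrow> cstar (s i) * s i = 1"
    and range_sum: "(\<Sum>i=1..n. s i * cstar (s i)) = 1"
begin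

text \<open>With positivity this is immediate: the compressions q_k = s_j^* s_k s_k^* s_j sum to 1
  and q_j = 1, so the others vanish. The substitute is that 1 - 2 p is a self-adjoint unitary for
  every projection p, so each 1 - 2 q_k is a contraction. Together with the sum this places 1 at the
  midpoint of a segment in direction q_i inside the unit ball, and extremality of 1 gives q_i =
  0.\<close>

lemma orthonormal:
  assumes "i \<in> {1..n}" "j \<in> {1..n}"
  shows "cstar (s i) * s j = (if i = j then 1 else 0)"
proof (cases "i = j")
  case False
  define q where "q k = cstar (s j) * (s k * cstar (s k)) * s j" for k
  define J where "J = {1..n} - {j} - {i}"
  define m where "m = card J"
  have wq: "norm (1 - 2 * q k) \<le> 1" if "k \<in> {1..n}" for k
  proof -
    define p where "p = s k * cstar (s k)"
    have pp: "p * p = p"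
      unfolding p_def by (metis isometry that mult.assoc mult.right_neutral)
    have ps: "cstar p = p" by (simp add: p_def cstar_mult cstar_cstar)
    have "norm (1 - (p + p)) = 1"
      by (rule isometry_norm) (simp add: cstar_diff cstar_add ps algebra_simps pp)
    moreover have "1 - 2 * q k = cstar (s j) * (1 - (p + p)) * s j"
      using isometry[OF assms(2)] by (simp add: q_def p_def mult_2 algebra_simps)
    ultimately show ?thesis
      using norm_contract2[of "cstar (s j)" "s j" "1 - (p + p)"] isometry_norm[OF isometry[OF assms(2)]] by simp
  qed
  have "(\<Sum>k\<in>{1..n}. q k) = cstar (s j) * (\<Sum>k=1..n. s k * cstar (s k)) * s j"
    by (simp add: q_def sum_distrib_left sum_distrib_right)
  also have "\<dots> = 1" using isometry[OF assms(2)] by (simp only: range_sum mult_1_right)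
  finally have "(\<Sum>k\<in>{1..n}. q k) = 1" .
  moreover have "(\<Sum>k\<in>{1..n}. q k) = q j + (q i + (\<Sum>k\<in>J. q k))"
    using assms False by (simp add: J_def sum.remove[of _ j] sum.remove[of _ i])
  moreover have "q j = 1"
    using isometry[OF assms(2)] unfolding q_def by (metis mult.assoc mult.right_neutral)
  ultimately have rest: "(\<Sum>k\<in>J. q k) = - q i" by (simp add: eq_neg_iff_add_eq_0 add.commute)
  have "norm (of_nat m + 2 * q i) \<le> real m"
  proof -
    have "of_nat m + 2 * q i = (\<Sum>k\<in>J. 1 - 2 * q k)"
      by (simp add: sum_subtractf m_def flip: sum_distrib_left) (simp add: rest)
    also have "norm \<dots> \<le> (\<Sum>k\<in>J. 1)" by (rule sum_norm_le) (auto intro: wq simp: J_def)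
    finally show ?thesis by (simp add: m_def)
  qed
  \<comment> \<open>The scale at which both directions fit: m + 2 q_i has norm at most m and lacks
    1, while 1 - 2 q_i has norm at most 1 and lacks m; completed, both have norm at most m +
    1.\<close>
  define c where "c = 1 / (real m + 1)"
  have c: "c > 0" "c * (real m + 1) = 1" by (auto simp: c_def)
  have one: "c *\<^sub>R (of_nat m + 1) = (1::'a)"
  proof -
    have "(of_nat m + 1 :: 'a) = (real m + 1) *\<^sub>R 1" by (simp add: scaleR_add_left scaleR_conv_of_real)
    then show ?thesis by (simp only: scaleR_scaleR c scaleR_one)
  qed
  have "norm (1 + c *\<^sub>R (2 * q i)) \<le> 1"
  proof -
    have "1 + c *\<^sub>R (2 * q i) = c *\<^sub>R ((of_nat m + 2 * q i) + 1)"
      by (subst one[symmetric]) (simp add: scaleR_add_right)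
    also have "norm \<dots> \<le> c * (real m + 1)"
      unfolding norm_scaleR using c \<open>norm (of_nat m + 2 * q i) \<le> real m\<close>
        norm_triangle_ineq[of "of_nat m + 2 * q i" 1] by (intro mult_mono) auto
    finally show ?thesis using c by simp
  qed
  moreover have "norm (1 - c *\<^sub>R (2 * q i)) \<le> 1"
  proof -
    have "1 - c *\<^sub>R (2 * q i) = c *\<^sub>R ((1 - 2 * q i) + of_nat m)"
      by (subst one[symmetric]) (simp add: scaleR_add_right scaleR_diff_right)
    also have "norm \<dots> \<le> c * (real m + 1)"
      unfolding norm_scaleR using c wq[OF assms(1)]
        norm_triangle_ineq[of "1 - 2 * q i" "of_nat m"] by (intro mult_mono) auto
    finally show ?thesis using c by simp
  qed
  moreover have qs: "q i = cstar (cstar (s i) * s j) * (cstar (s i) * s j)"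
    by (simp add: q_def cstar_mult cstar_cstar mult.assoc)
  moreover have "cstar (2 * q i) = 2 * q i"
    unfolding qs by (simp add: mult_2 cstar_add cstar_mult cstar_cstar mult.assoc)
  ultimately have "c *\<^sub>R (2 * q i) = 0"
    by (intro selfadj_extreme_zero) (auto simp: cstar_scaleR)
  then have "q i = 0" using c by (simp add: mult_2 flip: scaleR_2)
  then have "norm (cstar (s i) * s j) = 0" using cstar_identity[of "cstar (s i) * s j"] by (simp add: qs)
  then show ?thesis using False by simp
qed (use isometry assms in auto)

end

section \<open>Words and the spaces spanned by their isometries\<close>

definition words :: "nat \<Rightarrow> nat \<Rightarrow> nat list set" where
  "words n m = {\<mu> \<in> lists {1..n}. length \<mu> = m}"

lemma words_0 [simp]: "words n 0 = {[]}"
  by (auto simp: words_def)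

lemma words_Suc: "words n (Suc m) = (\<lambda>(i, \<mu>). i # \<mu>) ` ({1..n} \<times> words n m)"
  by (auto simp: words_def length_Suc_conv image_iff)

lemma finite_words [simp]: "finite (words n m)"
  by (induction m) (auto simp: words_Suc)

lemma card_words: "card (words n m) = n ^ m"
proof -
  have "words n m = {xs. set xs \<subseteq> {1..n} \<and> length xs = m}" by (auto simp: words_def)
  then show ?thesis by (simp add: card_lists_length_eq)
qed

lemma words_append: "\<mu> \<in> words n p \<Longrightarrow> \<nu> \<in> words n q \<Longrightarrow> \<mu> @ \<nu> \<in> words n (p + q)"
  by (auto simp: words_def)

lemma words_singleton: "i \<in> {1..n} \<Longrightarrow> [i] \<in> words n 1"
  by (auto simp: words_def)

lemma words_split:
  assumes "\<mu> \<in> words n (p + q)"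
  obtains \<nu> \<kappa> where "\<nu> \<in> words n p" "\<kappa> \<in> words n q" "\<mu> = \<nu> @ \<kappa>"
proof
  show "take p \<mu> \<in> words n p" "drop p \<mu> \<in> words n q"
    using assms set_take_subset[of p \<mu>] set_drop_subset[of p \<mu>] by (auto simp: words_def)
qed simp

lemma sum_words_Suc: "(\<Sum>\<mu>\<in>words n (Suc m). f \<mu>) = (\<Sum>i=1..n. \<Sum>\<mu>\<in>words n m. f (i # \<mu>))"
proof -
  have "inj_on (\<lambda>(i, \<mu>). i # \<mu>) ({1..n} \<times> words n m)" by (auto simp: inj_on_def)
  then show ?thesis
    unfolding words_Suc by (simp add: sum.reindex sum.cartesian_product case_prod_unfold)
qed

lemma word_op_Nil [simp]: "word_op s [] = 1"
  and word_op_Cons: "word_op s (i # \<mu>) = s i * word_op s \<mu>"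
  by (simp_all add: word_op_def)

lemma word_op_append: "word_op s (\<mu> @ \<nu>) = word_op s \<mu> * word_op s \<nu>"
  by (induction \<mu>) (simp_all add: word_op_Cons mult.assoc)

context cuntz_family
begin

abbreviation "S \<equiv> word_op s"

definition H :: "nat \<Rightarrow> 'a set" where "H m = cspan (S ` words n m)"

text \<open>Left multiplication makes \<open>E p q\<close> the linear maps from \<open>H q\<close>
  to \<open>H p\<close>; \<open>E m m\<close> is a copy of the matrices of size n^m.\<close>

definition E :: "nat \<Rightarrow> nat \<Rightarrow> 'a set" where
  "E p q = cspan ((\<lambda>(\<mu>, \<nu>). S \<mu> * cstar (S \<nu>)) ` (words n p \<times> words n q))"

lemma csubspace_H [simp]: "csubspace (H m)" and csubspace_E [simp]: "csubspace (E p q)"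
  by (simp_all add: H_def E_def)

lemma S_in_H: "\<mu> \<in> words n m \<Longrightarrow> S \<mu> \<in> H m"
  by (auto simp: H_def intro: cspan_base)

lemma s_in_H: "i \<in> {1..n} \<Longrightarrow> s i \<in> H 1"
  using S_in_H[OF words_singleton, of i] by (simp add: word_op_Cons)

lemma word_orthonormal:
  "\<mu> \<in> words n m \<Longrightarrow> \<nu> \<in> words n m \<Longrightarrow> cstar (S \<mu>) * S \<nu> = (if \<mu> = \<nu> then 1 else 0)"
proof (induction m arbitrary: \<mu> \<nu>)
  case (Suc m)
  then obtain i \<mu>' j \<nu>' where *: "\<mu> = i # \<mu>'" "\<nu> = j # \<nu>'" "i \<in> {1..n}" "j \<in> {1..n}"
    "\<mu>' \<in> words n m" "\<nu>' \<in> words n m" by (auto simp: words_Suc)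
  have "cstar (S \<mu>) * S \<nu> = cstar (S \<mu>') * (cstar (s i) * s j) * S \<nu>'"
    by (simp add: * word_op_Cons cstar_mult mult.assoc)
  then show ?case using Suc.IH[OF *(5,6)] * orthonormal[OF *(3,4)] by auto
qed auto

lemma S_isometry: "\<mu> \<in> words n m \<Longrightarrow> cstar (S \<mu>) * S \<mu> = 1"
  using word_orthonormal[of \<mu> m \<mu>] by simp

lemma norm_S: "\<mu> \<in> words n m \<Longrightarrow> norm (S \<mu>) = 1"
  by (rule isometry_norm[OF S_isometry])

lemma word_range_sum: "(\<Sum>\<mu>\<in>words n m. S \<mu> * cstar (S \<mu>)) = 1"
proof (induction m)
  case (Suc m)
  have "(\<Sum>\<mu>\<in>words n (Suc m). S \<mu> * cstar (S \<mu>)) =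
      (\<Sum>i=1..n. s i * (\<Sum>\<mu>\<in>words n m. S \<mu> * cstar (S \<mu>)) * cstar (s i))"
    by (simp add: sum_words_Suc word_op_Cons cstar_mult sum_distrib_left sum_distrib_right mult.assoc)
  then show ?case using range_sum by (simp only: Suc mult_1_right)
qed auto

lemma expand_left: "x = (\<Sum>\<mu>\<in>words n m. S \<mu> * (cstar (S \<mu>) * x))"
  by (metis (no_types, lifting) mult.assoc mult_1 sum.cong sum_distrib_right word_range_sum)

lemma expand_right: "x = (\<Sum>\<mu>\<in>words n m. x * S \<mu> * cstar (S \<mu>))"
  by (metis (no_types, lifting) mult.assoc mult_1_right sum.cong sum_distrib_left word_range_sum)

lemma H_0: "x \<in> H 0 \<longleftrightarrow> (\<exists>c. x = cscale c 1)"
proof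
  assume x: "x \<in> H 0"
  have "csubspace {x :: 'a. \<exists>c. x = cscale c 1}"
    by (auto simp: csubspace_def cscale_cscale simp flip: cscale_add_left intro: exI[of _ 0])
  then have "H 0 \<subseteq> {x :: 'a. \<exists>c. x = cscale c 1}"
    unfolding H_def by (rule cspan_minimal) (auto intro: exI[of _ 1])
  then show "\<exists>c. x = cscale c 1" using x by auto
qed (use S_in_H[of "[]" 0] csubspace_cscale[OF csubspace_H, of 1 0] in auto)

lemma H_mult:
  assumes "\<xi> \<in> H p" "\<eta> \<in> H q"
  shows "\<xi> * \<eta> \<in> H (p + q)"
proof (rule cspan_mult[OF csubspace_H _ assms[unfolded H_def]])
  fix x y assume "x \<in> S ` words n p" "y \<in> S ` words n q"
  then show "x * y \<in> H (p + q)"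
    by (auto intro!: S_in_H words_append simp flip: word_op_append)
qed

lemma cstar_H_mult: 
  assumes "\<xi> \<in> H m" "\<zeta> \<in> H (m + k)"
  shows "cstar \<xi> * \<zeta> \<in> H k"
proof -
  have words: "cstar (S \<mu>) * S \<nu> \<in> H k" if "\<mu> \<in> words n m" "\<nu> \<in> words n (m + k)" for \<mu> \<nu>
  proof -
    obtain \<nu>1 \<nu>2 where \<nu>: "\<nu>1 \<in> words n m" "\<nu>2 \<in> words n k" "\<nu> = \<nu>1 @ \<nu>2"
      using words_split[OF \<open>\<nu> \<in> words n (m + k)\<close>] .
    have "cstar (S \<mu>) * S \<nu> = (if \<mu> = \<nu>1 then S \<nu>2 else 0)"
      using word_orthonormal[OF that(1) \<nu>(1)] by (simp add: \<nu> word_op_append flip: mult.assoc)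
    then show ?thesis using S_in_H[OF \<nu>(2)] csubspace_0[OF csubspace_H] by auto
  qed
  have "\<xi>' * \<zeta> \<in> H k" if "\<xi>' \<in> cspan (cstar ` S ` words n m)" for \<xi>'
    by (rule cspan_mult[OF csubspace_H _ that assms(2)[unfolded H_def]]) (use words in auto)
  moreover have "cstar \<xi> \<in> cspan (cstar ` S ` words n m)"
    by (rule cspan_cstar[OF csubspace_cspan _ assms(1)[unfolded H_def]]) (auto intro: cspan_base)
  ultimately show ?thesis by blast
qed

lemma H_inner: 
  assumes "\<xi> \<in> H m" "\<eta> \<in> H m"
  obtains c where "cstar \<xi> * \<eta> = cscale c 1"
  using cstar_H_mult[of \<xi> m \<eta> 0] assms by (auto simp: H_0)

lemma H_cstar_H:
  assumes "\<xi> \<in> H p" "\<eta> \<in> H q"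
  shows "\<xi> * cstar \<eta> \<in> E p q"
proof -
  have "cstar \<eta> \<in> cspan (cstar ` S ` words n q)"
    by (rule cspan_cstar[OF csubspace_cspan _ assms(2)[unfolded H_def]]) (auto intro: cspan_base)
  then show ?thesis
    by (intro cspan_mult[OF csubspace_E _ assms(1)[unfolded H_def]]) (auto simp: E_def intro!: cspan_base)
qed

lemma E_cases:
  assumes "csubspace T" "\<And>\<mu> \<nu>. \<mu> \<in> words n p \<Longrightarrow> \<nu> \<in> words n q \<Longrightarrow> S \<mu> * cstar (S \<nu>) \<in> T"
  shows "E p q \<subseteq> T"
  unfolding E_def by (rule cspan_minimal) (use assms in auto)

lemma E_H:
  assumes "x \<in> E p q" "\<eta> \<in> H (q + k)"
  shows "x * \<eta> \<in> H (p + k)"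
proof -
  have "E p q \<subseteq> {x. x * \<eta> \<in> H (p + k)}"
    using H_mult[OF S_in_H cstar_H_mult[OF S_in_H assms(2)]]
    by (intro E_cases) (auto simp: csubspace_vimage_mult_right mult.assoc)
  then show ?thesis using assms(1) by auto
qed

lemma E_H0: "x \<in> E p q \<Longrightarrow> \<eta> \<in> H q \<Longrightarrow> x * \<eta> \<in> H p"
  using E_H[of x p q \<eta> 0] by simp

lemma E_mult:
  assumes "x \<in> E p q" "y \<in> E q r"
  shows "x * y \<in> E p r"
proof -
  have "E q r \<subseteq> {y. x * y \<in> E p r}"
    using H_cstar_H[OF E_H0[OF assms(1) S_in_H] S_in_H]
    by (intro E_cases) (auto simp: csubspace_vimage_mult_left simp flip: mult.assoc)
  then show ?thesis using assms(2) by auto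
qed

lemma E_cstar:
  assumes "x \<in> E p q"
  shows "cstar x \<in> E q p"
proof -
  have "E p q \<subseteq> {x. cstar x \<in> E q p}"
    by (intro E_cases) (auto simp: csubspace_vimage_cstar cstar_mult cstar_cstar intro: H_cstar_H S_in_H)
  then show ?thesis using assms by auto
qed

text \<open>Inserting 1 as the sum of the s_i s_i^* between a word and an adjoint word lengthens
  both by one letter. In matrix terms this is the embedding of x as x tensor 1.\<close>

lemma E_Suc: "E p q \<subseteq> E (Suc p) (Suc q)"
proof (rule E_cases)
  fix \<mu> \<nu> assume *: "\<mu> \<in> words n p" "\<nu> \<in> words n q"
  have "S \<mu> * cstar (S \<nu>) = S \<mu> * (\<Sum>i=1..n. s i * cstar (s i)) * cstar (S \<nu>)"
    by (simp only: range_sum mult_1_right)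
  also have "\<dots> = (\<Sum>i=1..n. (S \<mu> * s i) * cstar (S \<nu> * s i))"
    by (simp add: sum_distrib_left sum_distrib_right cstar_mult mult.assoc)
  also have "\<dots> \<in> E (Suc p) (Suc q)"
    using H_mult[OF S_in_H[OF *(1)] s_in_H] H_mult[OF S_in_H[OF *(2)] s_in_H]
    by (intro csubspace_sum H_cstar_H) auto
  finally show "S \<mu> * cstar (S \<nu>) \<in> E (Suc p) (Suc q)" .
qed simp

lemma E_mono: "E p q \<subseteq> E (p + j) (q + j)"
  by (induction j) (use E_Suc in auto)

lemma one_in_E: "1 \<in> E p p"
  using H_cstar_H[OF S_in_H S_in_H, of "[]" 0 "[]" 0] E_mono[of 0 0 p] by auto

lemma inner_E_H:
  assumes "\<xi> \<in> H m" "x \<in> E (m + k) m" "\<eta> \<in> H m"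
  shows "cstar \<xi> * x * \<eta> \<in> H k"
  using cstar_H_mult[OF assms(1) E_H0[OF assms(2,3)]] by (simp add: mult.assoc)

lemma H_coordinates:
  assumes "\<xi> \<in> H m"
  obtains c where "\<And>\<mu>. \<mu> \<in> words n m \<Longrightarrow> cstar (S \<mu>) * \<xi> = cscale (c \<mu>) 1"
    and "\<xi> = (\<Sum>\<mu>\<in>words n m. cscale (c \<mu>) (S \<mu>))"
    and "cstar \<xi> * \<xi> = cscale (of_real (\<Sum>\<mu>\<in>words n m. (norm (c \<mu>))\<^sup>2)) 1"
proof -
  have "\<forall>\<mu>\<in>words n m. \<exists>c. cstar (S \<mu>) * \<xi> = cscale c 1"
    using H_inner[OF S_in_H assms] by metis
  then obtain c where c: "\<And>\<mu>. \<mu> \<in> words n m \<Longrightarrow> cstar (S \<mu>) * \<xi> = cscale (c \<mu>) 1"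
    by metis
  have \<xi>: "\<xi> = (\<Sum>\<mu>\<in>words n m. cscale (c \<mu>) (S \<mu>))"
    by (subst expand_left[of \<xi> m]) (simp add: c cscale_right_mult)
  have "cstar \<xi> * \<xi> = (\<Sum>\<mu>\<in>words n m. cstar (cstar (S \<mu>) * \<xi>) * (cstar (S \<mu>) * \<xi>))"
    by (subst (2) expand_left[of \<xi> m]) (simp add: sum_distrib_left cstar_mult cstar_cstar mult.assoc)
  also have "\<dots> = (\<Sum>\<mu>\<in>words n m. cscale (of_real ((norm (c \<mu>))\<^sup>2)) 1)"
  proof (rule sum.cong)
    fix \<mu> assume "\<mu> \<in> words n m"
    then show "cstar (cstar (S \<mu>) * \<xi>) * (cstar (S \<mu>) * \<xi>) = cscale (of_real ((norm (c \<mu>))\<^sup>2)) 1"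
      by (simp only: c cstar_cscale cstar_one cscale_left_mult mult_1 cscale_cscale complex_norm_square mult.commute)
  qed simp
  finally show ?thesis using that[OF c \<xi>] by (simp add: cscale_sum_left)
qed

lemma H_norm: "\<xi> \<in> H m \<Longrightarrow> cstar \<xi> * \<xi> = cscale (of_real ((norm \<xi>)\<^sup>2)) 1"
proof -
  assume "\<xi> \<in> H m"
  then obtain c :: "nat list \<Rightarrow> complex" where c: "cstar \<xi> * \<xi> = cscale (of_real (\<Sum>\<mu>\<in>words n m. (norm (c \<mu>))\<^sup>2)) 1"
    by (rule H_coordinates)
  then have "(norm \<xi>)\<^sup>2 = (\<Sum>\<mu>\<in>words n m. (norm (c \<mu>))\<^sup>2)"
    unfolding cstar_identity[symmetric] c norm_cscale norm_of_real by (simp add: sum_nonneg)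
  then show ?thesis using c by simp
qed

text \<open>Two words suffice for the use made of it: one of them carries at most half of the
  squared norm.\<close>

lemma H_bessel:
  assumes "\<xi> \<in> H m" "\<mu> \<in> words n m" "\<nu> \<in> words n m" "\<mu> \<noteq> \<nu>"
  shows "(norm (cstar (S \<mu>) * \<xi>))\<^sup>2 + (norm (cstar (S \<nu>) * \<xi>))\<^sup>2 \<le> (norm \<xi>)\<^sup>2"
proof -
  obtain c where c: "\<And>\<mu>. \<mu> \<in> words n m \<Longrightarrow> cstar (S \<mu>) * \<xi> = cscale (c \<mu>) 1"
    "cstar \<xi> * \<xi> = cscale (of_real (\<Sum>\<mu>\<in>words n m. (norm (c \<mu>))\<^sup>2)) 1"
    using H_coordinates[OF assms(1)] by metis
  have "(\<Sum>\<kappa>\<in>{\<mu>, \<nu>}. (norm (c \<kappa>))\<^sup>2) \<le> (\<Sum>\<mu>\<in>words n m. (norm (c \<mu>))\<^sup>2)"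
    by (rule sum_mono2) (use assms in auto)
  also have "\<dots> = (norm \<xi>)\<^sup>2"
    unfolding cstar_identity[symmetric] c norm_cscale norm_of_real by (simp add: sum_nonneg)
  finally show ?thesis using assms c(1) by (simp add: norm_cscale)
qed

subsection \<open>The canonical endomorphism and the second shift\<close>

abbreviation \<sigma> where "\<sigma> \<equiv> canon_endo n s"
abbreviation \<tau> where "\<tau> \<equiv> second_shift n s"

lemma \<sigma>_s: "i \<in> {1..n} \<Longrightarrow> \<sigma> x * s i = s i * x"
proof -
  assume i: "i \<in> {1..n}"
  have "\<sigma> x * s i = (\<Sum>j=1..n. s j * x * (cstar (s j) * s i))"
    by (simp add: canon_endo_def sum_distrib_right mult.assoc)
  also have "\<dots> = (\<Sum>j=1..n. if i = j then s i * x else 0)"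
    by (rule sum.cong) (use i orthonormal in auto)
  also have "\<dots> = s i * x" using i by simp
  finally show ?thesis .
qed

lemma sum_s_ext: "(\<And>i. i \<in> {1..n} \<Longrightarrow> x * s i = y * s i) \<Longrightarrow> x = y"
proof -
  assume *: "\<And>i. i \<in> {1..n} \<Longrightarrow> x * s i = y * s i"
  have "x * (\<Sum>i=1..n. s i * cstar (s i)) = y * (\<Sum>i=1..n. s i * cstar (s i))"
    unfolding sum_distrib_left using * by (intro sum.cong) (auto simp flip: mult.assoc)
  then show "x = y" by (simp only: range_sum mult_1_right)
qed

lemma norm_s: "i \<in> {1..n} \<Longrightarrow> norm (s i) = 1"
  using isometry isometry_norm by blast

lemma star_hom_\<sigma>: "star_hom \<sigma>"
\<comment> \<open>The bound n merely counts the summands; \<open>star_homI_bounded\<close> sharpens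
  it to 1.\<close>
proof (rule star_homI_bounded[where K="real n"])
  show "\<sigma> (x * y) = \<sigma> x * \<sigma> y" for x y
    by (rule sum_s_ext) (metis \<sigma>_s mult.assoc)
  show "\<sigma> 1 = 1" using range_sum by (simp add: canon_endo_def)
  show "\<sigma> (cstar x) = cstar (\<sigma> x)" for x
    by (simp add: canon_endo_def cstar_sum cstar_mult cstar_cstar mult.assoc)
  show "norm (\<sigma> x) \<le> norm x * real n" for x
  proof -
    have "norm (\<sigma> x) \<le> (\<Sum>i=1..n. norm x)"
      unfolding canon_endo_def by (intro sum_norm_le norm_contract2) (auto simp: norm_s)
    then show ?thesis by (simp add: mult.commute)
  qed
qed (auto simp: canon_endo_def sum.distrib distrib_left distrib_right cscale_left_mult
      cscale_right_mult cscale_sum_right)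

lemma \<sigma>_unit: "i \<in> {1..n} \<Longrightarrow> j \<in> {1..n} \<Longrightarrow> \<sigma> x * (s i * cstar (s j)) = s i * cstar (s j) * \<sigma> x"
proof -
  assume ij: "i \<in> {1..n}" "j \<in> {1..n}"
  have "cstar (s j) * \<sigma> x = x * cstar (s j)"
    using \<sigma>_s[OF ij(2), of "cstar x"] star_hom_cstar[OF star_hom_\<sigma>, of x]
    by (metis cstar_cstar cstar_mult)
  then show ?thesis using \<sigma>_s[OF ij(1), of x] by (metis mult.assoc)
qed

text \<open>The range of \<open>\<sigma>\<close> sits behind the first tensor factor, which is
  \<open>E 1 1\<close>.\<close>

lemma \<sigma>_E_commute: "y \<in> E 1 1 \<Longrightarrow> \<sigma> x * y = y * \<sigma> x"
proof -
  assume y: "y \<in> E 1 1"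
  have "E 1 1 \<subseteq> {y. \<sigma> x * y = y * \<sigma> x}"
    by (rule E_cases) (use \<sigma>_unit in \<open>auto simp: csubspace_def distrib_left distrib_right cscale_left_mult
        cscale_right_mult words_Suc word_op_Cons\<close>)
  then show ?thesis using y by auto
qed

text \<open>Regrouping the triple sum reveals the second shift as the canonical endomorphism of the
  family \<open>\<sigma> (s k)\<close>. Properties of \<open>\<sigma>\<close> are thereby inherited
  through the locale.\<close>

lemma \<tau>_eq: "\<tau> x = (\<Sum>k=1..n. \<sigma> (s k) * x * cstar (\<sigma> (s k)))"
proof -
  have "\<tau> x = (\<Sum>i=1..n. \<Sum>k=1..n. \<Sum>j=1..n. s i * s k * cstar (s i) * x * s j * cstar (s k) * cstar (s j))"
    unfolding second_shift_def by (intro sum.cong refl sum.swap)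
  also have "\<dots> = (\<Sum>k=1..n. \<Sum>i=1..n. \<Sum>j=1..n. s i * s k * cstar (s i) * x * s j * cstar (s k) * cstar (s j))"
    by (rule sum.swap)
  finally show ?thesis
    by (simp add: canon_endo_def cstar_sum cstar_mult cstar_cstar sum_distrib_left sum_distrib_right mult.assoc)
       (intro sum.cong refl sum.swap)
qed

lemma \<sigma>_s_family: "cuntz_family n (\<lambda>k. \<sigma> (s k))"
proof
  show "cstar (\<sigma> (s i)) * \<sigma> (s i) = 1" if "i \<in> {1..n}" for i
    using isometry[OF that] star_hom_\<sigma> by (metis star_hom_cstar star_hom_mult star_hom_one)
  have "(\<Sum>i=1..n. \<sigma> (s i) * cstar (\<sigma> (s i))) = \<sigma> (\<Sum>i=1..n. s i * cstar (s i))"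
    by (simp only: star_hom_simps[OF star_hom_\<sigma>])
  also have "\<dots> = 1" by (simp only: range_sum star_hom_one[OF star_hom_\<sigma>])
  finally show "(\<Sum>i=1..n. \<sigma> (s i) * cstar (\<sigma> (s i))) = 1" .
qed

lemma \<tau>_canon: "\<tau> x = canon_endo n (\<lambda>k. \<sigma> (s k)) x"
  by (simp add: \<tau>_eq canon_endo_def)

lemma star_hom_\<tau>: "star_hom \<tau>"
  using cuntz_family.star_hom_\<sigma>[OF \<sigma>_s_family] by (simp add: \<tau>_canon[abs_def])

lemma \<tau>_\<sigma>s: "i \<in> {1..n} \<Longrightarrow> \<tau> x * \<sigma> (s i) = \<sigma> (s i) * x"
  using cuntz_family.\<sigma>_s[OF \<sigma>_s_family] by (simp add: \<tau>_canon)

lemma \<tau>_\<sigma>E_commute: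
  assumes y: "y \<in> E 1 1"
  shows "\<tau> x * \<sigma> y = \<sigma> y * \<tau> x"
proof -
  have "\<tau> x * \<sigma> (s i * cstar (s j)) = \<sigma> (s i * cstar (s j)) * \<tau> x" if "i \<in> {1..n}" "j \<in> {1..n}" for i j
    using cuntz_family.\<sigma>_unit[OF \<sigma>_s_family that] star_hom_\<sigma>
    by (simp add: \<tau>_canon star_hom_simps)
  then have "E 1 1 \<subseteq> {y. \<tau> x * \<sigma> y = \<sigma> y * \<tau> x}"
    by (intro E_cases) (auto simp: csubspace_def distrib_left distrib_right cscale_left_mult
        cscale_right_mult words_Suc word_op_Cons star_hom_simps[OF star_hom_\<sigma>] linear_0[OF star_hom_linear[OF star_hom_\<sigma>]])
  then show ?thesis using y by auto
qed

lemma \<sigma>_pow_H: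
  assumes "\<xi> \<in> H m"
  shows "(\<sigma> ^^ m) x * \<xi> = \<xi> * x"
proof -
  have *: "(\<sigma> ^^ m) x * S \<mu> = S \<mu> * x" if "\<mu> \<in> words n m" for \<mu>
    using that
  proof (induction m arbitrary: \<mu>)
    case (Suc m)
    then obtain i \<nu> where "\<mu> = i # \<nu>" "i \<in> {1..n}" "\<nu> \<in> words n m" by (auto simp: words_Suc)
    then show ?case using Suc.IH[of \<nu>] \<sigma>_s[of i "(\<sigma> ^^ m) x"]
      by (simp add: word_op_Cons) (metis mult.assoc)
  qed auto
  have "H m \<subseteq> {\<xi>. (\<sigma> ^^ m) x * \<xi> = \<xi> * x}"
    unfolding H_def by (rule cspan_minimal) (use * in \<open>auto simp: csubspace_def distrib_left distrib_right
      cscale_left_mult cscale_right_mult\<close>)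
  then show ?thesis using assms by auto
qed

lemma \<tau>_pow_\<sigma>H:
  assumes "\<xi> \<in> H m"
  shows "(\<tau> ^^ m) x * \<sigma> \<xi> = \<sigma> \<xi> * x"
proof -
  have *: "(\<tau> ^^ m) x * \<sigma> (S \<mu>) = \<sigma> (S \<mu>) * x" if "\<mu> \<in> words n m" for \<mu>
    using that
  proof (induction m arbitrary: \<mu>)
    case 0
    then show ?case using star_hom_one[OF star_hom_\<sigma>] by simp
  next
    case (Suc m)
    then obtain i \<nu> where "\<mu> = i # \<nu>" "i \<in> {1..n}" "\<nu> \<in> words n m" by (auto simp: words_Suc)
    then show ?case using Suc.IH[of \<nu>] \<tau>_\<sigma>s[of i "(\<tau> ^^ m) x"] star_hom_mult[OF star_hom_\<sigma>]
      by (simp add: word_op_Cons) (metis mult.assoc)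
  qed
  have "H m \<subseteq> {\<xi>. (\<tau> ^^ m) x * \<sigma> \<xi> = \<sigma> \<xi> * x}"
    unfolding H_def by (rule cspan_minimal) (use * in \<open>auto simp: csubspace_def distrib_left distrib_right
      cscale_left_mult cscale_right_mult star_hom_simps[OF star_hom_\<sigma>] linear_0[OF star_hom_linear[OF star_hom_\<sigma>]]\<close>)
  then show ?thesis using assms by auto
qed

end

section \<open>Norm estimates from compressions to H m\<close>

context cuntz_family
begin

text \<open>C bounds the sesquilinear form of x on the Hilbert space \<open>H m\<close>. Testing
  with \<xi> = x \<eta>, and likewise for the adjoint, bounds x and x^* on \<open>H m\<close> by C,
  hence the k-th power of x^* x by C^(2k). Passing from vectors to the algebra norm by
  \<open>expand_right\<close> costs a factor n^m, which \<open>norm_le_by_powers\<close>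
  removes.\<close>

lemma norm_E_le:
  assumes x: "x \<in> E m m" and "C \<ge> 0"
    and le: "\<And>\<xi> \<eta>. \<xi> \<in> H m \<Longrightarrow> \<eta> \<in> H m \<Longrightarrow> norm \<xi> = 1 \<Longrightarrow> norm \<eta> = 1 \<Longrightarrow> norm (cstar \<xi> * x * \<eta>) \<le> C"
  shows "norm x \<le> C"
proof -
  have le': "norm (cstar \<xi> * x * \<eta>) \<le> C * norm \<xi> * norm \<eta>" if "\<xi> \<in> H m" "\<eta> \<in> H m" for \<xi> \<eta>
  proof (cases "\<xi> = 0 \<or> \<eta> = 0")
    case False
    define a b where "a = complex_of_real (1 / norm \<xi>)" and "b = complex_of_real (1 / norm \<eta>)"
    have ab: "norm a * norm \<xi> = 1" "norm b * norm \<eta> = 1"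
      using False by (auto simp: a_def b_def norm_divide)
    have "norm (cstar (cscale a \<xi>) * x * cscale b \<eta>) \<le> C"
      using that ab by (intro le csubspace_cscale[OF csubspace_H]) (auto simp: norm_cscale)
    then have "norm a * norm b * norm (cstar \<xi> * x * \<eta>) \<le> C"
      by (simp add: cstar_cscale cscale_left_mult cscale_right_mult norm_cscale mult.assoc mult.left_commute)
    then have "norm \<xi> * norm \<eta> * (norm a * norm b * norm (cstar \<xi> * x * \<eta>)) \<le> norm \<xi> * norm \<eta> * C"
      by (intro mult_left_mono) auto
    moreover have "norm \<xi> * norm \<eta> * (norm a * norm b * norm (cstar \<xi> * x * \<eta>))
        = (norm a * norm \<xi>) * (norm b * norm \<eta>) * norm (cstar \<xi> * x * \<eta>)" by simp
    ultimately show ?thesis by (simp only: ab) (simp add: mult_ac)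
  qed (use \<open>C \<ge> 0\<close> in auto)
  have sq: "a \<le> b" if "a * a \<le> b * a" "a \<ge> 0" "b \<ge> 0" for a b :: real
    using that by (cases "a = 0") auto
  have right: "norm (x * \<eta>) \<le> C * norm \<eta>" if "\<eta> \<in> H m" for \<eta>
  proof (rule sq)
    have "norm (x * \<eta>) * norm (x * \<eta>) = norm (cstar (x * \<eta>) * x * \<eta>)"
      using cstar_identity[of "x * \<eta>"] by (simp add: power2_eq_square mult.assoc)
    also have "\<dots> \<le> C * norm (x * \<eta>) * norm \<eta>"
      by (rule le'[OF E_H0[OF x that] that])
    finally show "norm (x * \<eta>) * norm (x * \<eta>) \<le> C * norm \<eta> * norm (x * \<eta>)" by (simp add: mult_ac)
  qed (use \<open>C \<ge> 0\<close> in auto)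
  have left: "norm (cstar x * \<eta>) \<le> C * norm \<eta>" if "\<eta> \<in> H m" for \<eta>
  proof (rule sq)
    have "norm (cstar x * \<eta>) * norm (cstar x * \<eta>) = norm (cstar \<eta> * x * (cstar x * \<eta>))"
      using cstar_identity[of "cstar x * \<eta>"] by (simp add: power2_eq_square mult.assoc cstar_mult cstar_cstar)
    also have "\<dots> \<le> C * norm \<eta> * norm (cstar x * \<eta>)"
      by (rule le'[OF that E_H0[OF E_cstar[OF x] that]])
    finally show "norm (cstar x * \<eta>) * norm (cstar x * \<eta>) \<le> C * norm \<eta> * norm (cstar x * \<eta>)" .
  qed (use \<open>C \<ge> 0\<close> in auto)
  have pow: "(cstar x * x) ^ k * \<eta> \<in> H m \<and> norm ((cstar x * x) ^ k * \<eta>) \<le> (C\<^sup>2) ^ k * norm \<eta>"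
    if "\<eta> \<in> H m" for \<eta> k
  proof (induction k)
    case (Suc k)
    define \<zeta> where "\<zeta> = (cstar x * x) ^ k * \<eta>"
    have \<zeta>: "\<zeta> \<in> H m" "norm \<zeta> \<le> (C\<^sup>2) ^ k * norm \<eta>" using Suc by (auto simp: \<zeta>_def)
    have x\<zeta>: "x * \<zeta> \<in> H m" by (rule E_H0[OF x \<zeta>(1)])
    have "norm (cstar x * (x * \<zeta>)) \<le> C * (C * norm \<zeta>)"
      using left[OF x\<zeta>] right[OF \<zeta>(1)] \<open>C \<ge> 0\<close> by (meson mult_left_mono order_trans)
    also have "\<dots> \<le> C * (C * ((C\<^sup>2) ^ k * norm \<eta>))"
      using \<zeta>(2) \<open>C \<ge> 0\<close> by (intro mult_left_mono) auto
    finally have "norm (cstar x * (x * \<zeta>)) \<le> (C\<^sup>2) ^ Suc k * norm \<eta>"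
      by (simp add: power2_eq_square mult_ac)
    moreover have "(cstar x * x) ^ Suc k * \<eta> = cstar x * (x * \<zeta>)"
      by (simp add: \<zeta>_def mult.assoc)
    ultimately show ?case using E_H0[OF E_cstar[OF x] x\<zeta>] by simp
  qed (use that in auto)
  show ?thesis
  proof (rule norm_le_by_powers[where K="real (n ^ m)"])
    fix r :: nat
    let ?y = "(cstar x * x) ^ (2 ^ r)"
    have "norm ?y = norm (\<Sum>\<mu>\<in>words n m. ?y * S \<mu> * cstar (S \<mu>))"
      using expand_right[of ?y m] by simp
    also have "\<dots> \<le> (\<Sum>\<mu>\<in>words n m. (C\<^sup>2) ^ (2 ^ r) * 1)"
    proof (rule sum_norm_le)
      fix \<mu> assume \<mu>: "\<mu> \<in> words n m"
      show "norm (?y * S \<mu> * cstar (S \<mu>)) \<le> (C\<^sup>2) ^ (2 ^ r) * 1"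
        using pow[OF S_in_H[OF \<mu>], of "2 ^ r"] norm_S[OF \<mu>]
        by (intro norm_mult_le) auto
    qed
    also have "\<dots> = real (n ^ m) * (C\<^sup>2) ^ (2 ^ r)" by (simp add: card_words)
    also have "\<dots> \<le> real (n ^ m) * (2 ^ r + 1) * (C\<^sup>2) ^ (2 ^ r)"
      by (intro mult_right_mono) (auto simp: mult_le_cancel_left1)
    finally show "norm ?y \<le> real (n ^ m) * (2 ^ r + 1) * (C\<^sup>2) ^ (2 ^ r)" .
  qed fact
qed

lemma \<sigma>_pow_cstar_H: "\<xi> \<in> H m \<Longrightarrow> cstar \<xi> * (\<sigma> ^^ m) x = x * cstar \<xi>"
  using \<sigma>_pow_H[of \<xi> m "cstar x"] star_hom_cstar[OF star_hom_funpow[OF star_hom_\<sigma>, of m], of x]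
  by (metis cstar_cstar cstar_mult)

text \<open>x is a rectangular matrix. Multiplying by the adjoints of
  \<open>(\<sigma> ^^ m) (S \<rho>)\<close>, for the n^k words \<rho> of length k, cuts it into
  square blocks in \<open>E m m\<close>, whose compressions are those of x multiplied by the adjoint
  of \<open>S \<rho>\<close>. The factor n^k is harmless because k is a fixed degree in the
  applications.\<close>

lemma norm_E_shift_le:
  assumes x: "x \<in> E (m + k) m" and "C \<ge> 0"
    and le: "\<And>\<xi> \<eta>. \<xi> \<in> H m \<Longrightarrow> \<eta> \<in> H m \<Longrightarrow> norm \<xi> = 1 \<Longrightarrow> norm \<eta> = 1 \<Longrightarrow> norm (cstar \<xi> * x * \<eta>) \<le> C"
  shows "norm x \<le> real (n ^ k) * C"
proof -
  note hom = star_hom_funpow[OF star_hom_\<sigma>, of m]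
  have norm1: "norm ((\<sigma> ^^ m) (S \<rho>)) \<le> 1" if "\<rho> \<in> words n k" for \<rho>
    using star_hom_norm[OF hom, of "S \<rho>"] norm_S[OF that] by simp
  have "x = (\<sigma> ^^ m) (\<Sum>\<rho>\<in>words n k. S \<rho> * cstar (S \<rho>)) * x"
    by (simp add: word_range_sum star_hom_one[OF hom])
  also have "\<dots> = (\<Sum>\<rho>\<in>words n k. (\<sigma> ^^ m) (S \<rho>) * ((\<sigma> ^^ m) (cstar (S \<rho>)) * x))"
    by (simp add: star_hom_sum[OF hom] star_hom_mult[OF hom] sum_distrib_right mult.assoc)
  also have "norm \<dots> \<le> (\<Sum>\<rho>\<in>words n k. 1 * C)"
  proof (rule sum_norm_le, rule norm_mult_le)
    fix \<rho> assume \<rho>: "\<rho> \<in> words n k"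
    show "norm ((\<sigma> ^^ m) (S \<rho>)) \<le> 1" by (rule norm1[OF \<rho>])
    have "E (m + k) m \<subseteq> {x. (\<sigma> ^^ m) (cstar (S \<rho>)) * x \<in> E m m}"
    proof (rule E_cases, goal_cases)
      case (2 \<mu> \<nu>)
      obtain \<mu>1 \<mu>2 where \<mu>: "\<mu>1 \<in> words n m" "\<mu>2 \<in> words n k" "\<mu> = \<mu>1 @ \<mu>2"
        using words_split[OF 2(1)] .
      have "(\<sigma> ^^ m) (cstar (S \<rho>)) * (S \<mu> * cstar (S \<nu>)) =
          ((\<sigma> ^^ m) (cstar (S \<rho>)) * S \<mu>1) * S \<mu>2 * cstar (S \<nu>)"
        by (simp add: \<mu> word_op_append mult.assoc)
      also have "\<dots> = S \<mu>1 * (cstar (S \<rho>) * S \<mu>2) * cstar (S \<nu>)"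
        by (simp add: \<sigma>_pow_H[OF S_in_H[OF \<mu>(1)]] mult.assoc)
      also have "\<dots> = (if \<rho> = \<mu>2 then S \<mu>1 * cstar (S \<nu>) else 0)"
        by (simp add: word_orthonormal[OF \<rho> \<mu>(2)])
      also have "\<dots> \<in> E m m"
        using H_cstar_H[OF S_in_H[OF \<mu>(1)] S_in_H[OF 2(2)]] csubspace_0[OF csubspace_E] by auto
      finally show ?case by simp
    qed (simp add: csubspace_vimage_mult_left)
    then have "(\<sigma> ^^ m) (cstar (S \<rho>)) * x \<in> E m m" using x by auto
    then show "norm ((\<sigma> ^^ m) (cstar (S \<rho>)) * x) \<le> C"
    proof (rule norm_E_le[OF _ \<open>C \<ge> 0\<close>])
      fix \<xi> \<eta> assume *: "\<xi> \<in> H m" "\<eta> \<in> H m" "norm \<xi> = 1" "norm \<eta> = 1"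
      have "cstar \<xi> * ((\<sigma> ^^ m) (cstar (S \<rho>)) * x) * \<eta> = cstar (S \<rho>) * (cstar \<xi> * x * \<eta>)"
        using \<sigma>_pow_cstar_H[OF *(1)] by (simp flip: mult.assoc)
      then show "norm (cstar \<xi> * ((\<sigma> ^^ m) (cstar (S \<rho>)) * x) * \<eta>) \<le> C"
        using norm_mult_le[of "cstar (S \<rho>)" 1 "cstar \<xi> * x * \<eta>" C] le[OF *] norm_S[OF \<rho>] by simp
    qed
  qed
  also have "\<dots> = real (n ^ k) * C" by (simp add: card_words)
  finally show ?thesis .
qed

end

subsection \<open>The gauge action\<close>

locale gauge_cuntz_family = cuntz_family n s for n and s :: "nat \<Rightarrow> 'a::cstar_algebra" +
  fixes omega :: "complex \<Rightarrow> 'a \<Rightarrow> 'a"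
  assumes star_hom_omega: "norm t = 1 \<Longrightarrow> star_hom (omega t)"
    and omega_s: "norm t = 1 \<Longrightarrow> i \<in> {1..n} \<Longrightarrow> omega t (s i) = cscale t (s i)"
begin

definition homogeneous :: "int \<Rightarrow> 'a \<Rightarrow> bool" where
  "homogeneous d x \<longleftrightarrow> (\<forall>\<theta>. omega (cis \<theta>) x = cscale (cis (of_int d * \<theta>)) x)"

lemma star_hom_omega_cis: "star_hom (omega (cis \<theta>))"
  by (simp add: star_hom_omega)

lemma homogeneous_S: "\<mu> \<in> words n m \<Longrightarrow> homogeneous (int m) (S \<mu>)"
proof (induction m arbitrary: \<mu>)
  case 0
  then show ?case by (simp add: homogeneous_def star_hom_one[OF star_hom_omega_cis])
next
  case (Suc m)
  then obtain i \<nu> where "\<mu> = i # \<nu>" "i \<in> {1..n}" "\<nu> \<in> words n m" by (auto simp: words_Suc)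
  then show ?case using Suc.IH[of \<nu>]
    by (simp add: homogeneous_def word_op_Cons star_hom_mult[OF star_hom_omega_cis] omega_s
        cscale_left_mult cscale_right_mult cscale_cscale cis_mult algebra_simps)
qed

lemma homogeneous_E: "x \<in> E p q \<Longrightarrow> homogeneous (int p - int q) x"
proof -
  assume x: "x \<in> E p q"
  have "csubspace {x. homogeneous d x}" for d
    by (auto simp: csubspace_def homogeneous_def star_hom_simps[OF star_hom_omega_cis] cscale_add_right
      cscale_cscale mult.commute linear_0[OF star_hom_linear[OF star_hom_omega_cis]])
  moreover have "homogeneous (int p - int q) (S \<mu> * cstar (S \<nu>))"
    if "\<mu> \<in> words n p" "\<nu> \<in> words n q" for \<mu> \<nu>
    using homogeneous_S[OF that(1)] homogeneous_S[OF that(2)]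
    by (simp add: homogeneous_def star_hom_simps[OF star_hom_omega_cis] cstar_cscale cis_cnj
        cscale_left_mult cscale_right_mult cscale_cscale cis_mult algebra_simps)
  ultimately have "E p q \<subseteq> {x. homogeneous (int p - int q) x}"
    by (intro E_cases) auto
  then show ?thesis using x by auto
qed

text \<open>A finite average in place of the integral over the circle, so that no continuity in the
  group parameter has to be established. The price is aliasing: L must exceed the distance from l to
  every degree that occurs.\<close>

definition fourier :: "nat \<Rightarrow> int \<Rightarrow> 'a \<Rightarrow> 'a" where
  "fourier L l y = (1 / real L) *\<^sub>R (\<Sum>r<L. cscale (cis (- of_int l * ang L r)) (omega (cis (ang L r)) y))"

lemma fourier_add: "fourier L l (x + y) = fourier L l x + fourier L l y"
  by (simp add: fourier_def star_hom_add[OF star_hom_omega_cis] cscale_add_right sum.distrib scaleR_add_right)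

lemma fourier_0 [simp]: "fourier L l 0 = 0"
  by (simp add: fourier_def linear_0[OF star_hom_linear[OF star_hom_omega_cis]])

lemma fourier_sum: "fourier L l (sum f I) = (\<Sum>i\<in>I. fourier L l (f i))"
  by (induction I rule: infinite_finite_induct) (auto simp: fourier_add)

lemma fourier_diff: "fourier L l (x - y) = fourier L l x - fourier L l y"
  using fourier_add[of L l "x - y" y] by simp

lemma norm_fourier: "norm (fourier L l y) \<le> norm y"
proof (cases "L = 0")
  case False
  have "norm (\<Sum>r<L. cscale (cis (- of_int l * ang L r)) (omega (cis (ang L r)) y)) \<le> (\<Sum>r<L. norm y)"
    by (intro sum_norm_le) (auto simp: norm_cscale star_hom_norm[OF star_hom_omega_cis])
  then show ?thesis using False by (simp add: fourier_def field_simps)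
qed (simp add: fourier_def)

lemma fourier_homogeneous:
  assumes "homogeneous d x" "\<bar>d - l\<bar> < int L"
  shows "fourier L l x = (if d = l then x else 0)"
proof -
  have "(\<Sum>r<L. cscale (cis (- of_int l * ang L r)) (omega (cis (ang L r)) x)) =
      cscale (\<Sum>r<L. cis (of_int (d - l) * ang L r)) x"
    using assms(1) by (simp add: homogeneous_def cscale_sum_left cscale_cscale cis_mult algebra_simps)
  also have "(\<Sum>r<L. cis (of_int (d - l) * ang L r)) = (if d = l then of_nat L else 0)"
    using sum_cis_roots[OF assms(2)] by simp
  finally show ?thesis
    using assms(2) cscale_of_real[of "real L" x] by (auto simp: fourier_def)
qed

lemma fourier_decomposition:
  assumes "x = (\<Sum>d\<in>{- int D..int D}. g d)" "\<And>d. homogeneous d (g d)" "\<bar>l\<bar> + int D < int L"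
  shows "fourier L l x = (if \<bar>l\<bar> \<le> int D then g l else 0)"
proof -
  have "fourier L l x = (\<Sum>d\<in>{- int D..int D}. if d = l then g l else 0)"
    unfolding assms(1) fourier_sum
    by (intro sum.cong refl, subst fourier_homogeneous[OF assms(2)]) (use assms(3) in auto)
  then show ?thesis by auto
qed

subsection \<open>Quasi-free automorphisms\<close>

text \<open>The product u \<sigma>(u) ... \<sigma>^(p-1)(u): a homomorphism with s_i \<mapsto> u s_i
  has to send a word \<open>S \<mu>\<close> of length p to
  \<open>cocycle u p * S \<mu>\<close>.\<close>

primrec cocycle :: "'a \<Rightarrow> nat \<Rightarrow> 'a" where
  "cocycle u 0 = 1"
| "cocycle u (Suc p) = cocycle u p * (\<sigma> ^^ p) u"

text \<open>The graph of the homomorphism \<open>s\<^sub>i \<mapsto> u s\<^sub>i\<close> on elements of degree \<open>d\<close>.\<close>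
definition hom_graph :: "'a \<Rightarrow> int \<Rightarrow> ('a \<times> 'a) set" where
  "hom_graph u d = {(x, cocycle u p * x * cstar (cocycle u q)) | x p q. x \<in> E p q \<and> int p - int q = d}"

text \<open>The degree bound D is recorded because the number of homogeneous parts enters the first,
  crude norm estimate.\<close>

inductive_set poly_graph :: "'a \<Rightarrow> nat \<Rightarrow> ('a \<times> 'a) set" for u D where
  poly_graph_base: "\<bar>d\<bar> \<le> int D \<Longrightarrow> (x, y) \<in> hom_graph u d \<Longrightarrow> (x, y) \<in> poly_graph u D"
| poly_graph_add: "(x, y) \<in> poly_graph u D \<Longrightarrow> (x', y') \<in> poly_graph u D \<Longrightarrow> (x + x', y + y') \<in> poly_graph u D"

lemma cocycle_unitary:
  assumes "cstar u * u = 1" "u * cstar u = 1"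
  shows "cstar (cocycle u p) * cocycle u p = 1" "cocycle u p * cstar (cocycle u p) = 1"
proof (induction p)
  case (Suc p)
  note hom = star_hom_funpow[OF star_hom_\<sigma>, of p]
  have 1: "cstar ((\<sigma> ^^ p) u) * (\<sigma> ^^ p) u = 1" "(\<sigma> ^^ p) u * cstar ((\<sigma> ^^ p) u) = 1"
    using assms by (simp_all flip: star_hom_cstar[OF hom] star_hom_mult[OF hom] add: star_hom_one[OF hom])
  {
    case 1
    have "cstar (cocycle u (Suc p)) * cocycle u (Suc p) =
        cstar ((\<sigma> ^^ p) u) * (cstar (cocycle u p) * cocycle u p) * (\<sigma> ^^ p) u"
      by (simp add: cstar_mult mult.assoc)
    then show ?case by (simp only: Suc 1 \<open>cstar ((\<sigma> ^^ p) u) * (\<sigma> ^^ p) u = 1\<close> mult_1_right)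
  next
    case 2
    have "cocycle u (Suc p) * cstar (cocycle u (Suc p)) =
        cocycle u p * ((\<sigma> ^^ p) u * cstar ((\<sigma> ^^ p) u)) * cstar (cocycle u p)"
      by (simp add: cstar_mult mult.assoc)
    then show ?case by (simp only: Suc 1 mult_1_right)
  }
qed auto

context
  fixes u :: 'a
  assumes uu: "cstar u * u = 1" "u * cstar u = 1"
begin

text \<open>The prescription respects the inclusion of \<open>E p q\<close> into the next level: the
  extra factors move past the words by \<open>\<sigma>_pow_H\<close> and meet in the middle as u u^*
  = 1.\<close>

lemma cocycle_Suc_conj:
  assumes "x \<in> E p q"
  shows "cocycle u (Suc p) * x * cstar (cocycle u (Suc q)) = cocycle u p * x * cstar (cocycle u q)"
proof -
  have "E p q \<subseteq> {x. (\<sigma> ^^ p) u * x * cstar ((\<sigma> ^^ q) u) = x}"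
  proof (rule E_cases, goal_cases)
    case (2 \<mu> \<nu>)
    have "(\<sigma> ^^ p) u * (S \<mu> * cstar (S \<nu>)) * cstar ((\<sigma> ^^ q) u) = (\<sigma> ^^ p) u * S \<mu> * cstar ((\<sigma> ^^ q) u * S \<nu>)"
      by (simp add: cstar_mult mult.assoc)
    also have "\<dots> = S \<mu> * (u * cstar u) * cstar (S \<nu>)"
      unfolding \<sigma>_pow_H[OF S_in_H[OF 2(1)]] \<sigma>_pow_H[OF S_in_H[OF 2(2)]] by (simp add: cstar_mult mult.assoc)
    finally show ?case by (simp add: uu)
  qed (auto simp: csubspace_def distrib_left distrib_right cscale_left_mult cscale_right_mult)
  then have "(\<sigma> ^^ p) u * x * cstar ((\<sigma> ^^ q) u) = x" using assms by auto
  then show ?thesis by (simp add: cstar_mult) (metis mult.assoc)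
qed

lemma cocycle_add_conj:
  assumes "x \<in> E p q"
  shows "cocycle u (p + j) * x * cstar (cocycle u (q + j)) = cocycle u p * x * cstar (cocycle u q)"
proof (induction j)
  case (Suc j)
  have "x \<in> E (p + j) (q + j)" using assms E_mono by blast
  then show ?case using Suc cocycle_Suc_conj by simp
qed simp

lemma hom_graphI:
  "x \<in> E p q \<Longrightarrow> int p - int q = d \<Longrightarrow> y = cocycle u p * x * cstar (cocycle u q) \<Longrightarrow> (x, y) \<in> hom_graph u d"
  by (auto simp: hom_graph_def)

lemma hom_graph_add:
  assumes "(x, y) \<in> hom_graph u d" "(x', y') \<in> hom_graph u d"
  shows "(x + x', y + y') \<in> hom_graph u d"
proof -
  obtain p q where 1: "x \<in> E p q" "int p - int q = d" "y = cocycle u p * x * cstar (cocycle u q)"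
    using assms(1) by (auto simp: hom_graph_def)
  obtain p' q' where 2: "x' \<in> E p' q'" "int p' - int q' = d" "y' = cocycle u p' * x' * cstar (cocycle u q')"
    using assms(2) by (auto simp: hom_graph_def)
  \<comment> \<open>Equal degrees mean p - q = p' - q', so raising one term by p' levels and the
    other by p lands both in the same space.\<close>
  have eq: "p' + p = p + p'" "q' + p = q + p'" using 1(2) 2(2) by auto
  have "y + y' = cocycle u (p + p') * (x + x') * cstar (cocycle u (q + p'))"
    using cocycle_add_conj[OF 1(1), of p'] cocycle_add_conj[OF 2(1), of p]
    by (simp add: 1(3) 2(3) eq distrib_left distrib_right)
  moreover have "x + x' \<in> E (p + p') (q + p')"
    using 1(1) 2(1) E_mono[of p q p'] E_mono[of p' q' p] unfolding eq
    by (intro csubspace_add[OF csubspace_E]) auto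
  ultimately show ?thesis using 1(2) by (intro hom_graphI) auto
qed

lemma hom_graph_mult:
  assumes "(x, y) \<in> hom_graph u d" "(x', y') \<in> hom_graph u d'"
  shows "(x * x', y * y') \<in> hom_graph u (d + d')"
proof -
  obtain p q where 1: "x \<in> E p q" "int p - int q = d" "y = cocycle u p * x * cstar (cocycle u q)"
    using assms(1) by (auto simp: hom_graph_def)
  obtain p' q' where 2: "x' \<in> E p' q'" "int p' - int q' = d'" "y' = cocycle u p' * x' * cstar (cocycle u q')"
    using assms(2) by (auto simp: hom_graph_def)
  \<comment> \<open>Both factors are raised until their inner level is q + p', where the two inner
    cocycles cancel.\<close>
  have y: "y = cocycle u (p + p') * x * cstar (cocycle u (q + p'))"
    and y': "y' = cocycle u (q + p') * x' * cstar (cocycle u (q' + q))"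
    using cocycle_add_conj[OF 1(1), of p'] cocycle_add_conj[OF 2(1), of q]
    by (simp_all add: 1(3) 2(3) add.commute)
  have "y * y' = cocycle u (p + p') * x * (cstar (cocycle u (q + p')) * cocycle u (q + p')) * x' * cstar (cocycle u (q' + q))"
    unfolding y y' by (simp only: mult.assoc)
  then have "y * y' = cocycle u (p + p') * (x * x') * cstar (cocycle u (q' + q))"
    by (simp add: cocycle_unitary[OF uu] mult.assoc)
  moreover have "x * x' \<in> E (p + p') (q' + q)"
    using 1(1) 2(1) E_mono[of p q p'] E_mono[of p' q' q]
    by (intro E_mult[of _ _ "q + p'"]) (auto simp: add.commute)
  ultimately show ?thesis using 1(2) 2(2) by (intro hom_graphI) auto
qed

lemma hom_graph_cscale: "(x, y) \<in> hom_graph u d \<Longrightarrow> (cscale a x, cscale a y) \<in> hom_graph u d"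
  unfolding hom_graph_def
  by (fastforce simp: cscale_left_mult cscale_right_mult intro: csubspace_cscale[OF csubspace_E])

lemma hom_graph_cstar: "(x, y) \<in> hom_graph u d \<Longrightarrow> (cstar x, cstar y) \<in> hom_graph u (- d)"
  unfolding hom_graph_def
  by (fastforce simp: cstar_mult cstar_cstar mult.assoc intro: E_cstar)

lemma hom_graph_zero: "(0, 0) \<in> hom_graph u d"
  by (rule hom_graphI[of _ "nat d" "nat (- d)"]) (auto intro: csubspace_0[OF csubspace_E])

lemma hom_graph_homogeneous: "(x, y) \<in> hom_graph u d \<Longrightarrow> homogeneous d x"
  by (auto simp: hom_graph_def homogeneous_E)

lemma hom_graph_norm:
  assumes "(x, y) \<in> hom_graph u d"
  shows "norm y \<le> norm x"
proof -
  have "norm (cocycle u p) = 1" for p by (rule isometry_norm[OF cocycle_unitary(1)[OF uu]])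
  then show ?thesis using assms by (auto simp: hom_graph_def intro!: norm_contract2)
qed

lemma poly_graph_mult_hom:
  assumes "(x', y') \<in> hom_graph u d" "\<bar>d\<bar> \<le> int D'" "(x, y) \<in> poly_graph u D"
  shows "(x * x', y * y') \<in> poly_graph u (D + D')"
  using assms(3)
proof induction
  case (poly_graph_base e x y)
  then show ?case using hom_graph_mult[OF poly_graph_base(2) assms(1)] assms(2)
    by (intro poly_graph.poly_graph_base[of "e + d"]) auto
qed (auto simp: distrib_right intro: poly_graph_add)

lemma poly_graph_mult:
  assumes "(x', y') \<in> poly_graph u D'" "(x, y) \<in> poly_graph u D"
  shows "(x * x', y * y') \<in> poly_graph u (D + D')"
  using assms(1)
proof induction
  case (poly_graph_base e x' y')
  then show ?case using assms(2) by (intro poly_graph_mult_hom)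
qed (auto simp: distrib_left intro: poly_graph_add)

lemma poly_graph_cscale: "(x, y) \<in> poly_graph u D \<Longrightarrow> (cscale a x, cscale a y) \<in> poly_graph u D"
  by (induction rule: poly_graph.induct)
    (auto simp: cscale_add_right intro: poly_graph.intros hom_graph_cscale)

lemma poly_graph_cstar: "(x, y) \<in> poly_graph u D \<Longrightarrow> (cstar x, cstar y) \<in> poly_graph u D"
  by (induction rule: poly_graph.induct)
    (auto simp: cstar_add intro: poly_graph_add poly_graph_base[OF _ hom_graph_cstar])

lemma poly_graph_mono: "(x, y) \<in> poly_graph u D \<Longrightarrow> D \<le> D' \<Longrightarrow> (x, y) \<in> poly_graph u D'"
  by (induction rule: poly_graph.induct) (auto intro: poly_graph_base[rotated] poly_graph_add)

lemma one_poly_graph: "(1, 1) \<in> poly_graph u D"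
  by (rule poly_graph_base[of 0]) (auto intro!: hom_graphI[of _ 0 0] one_in_E)

lemma poly_graph_power: "(x, y) \<in> poly_graph u D \<Longrightarrow> (x ^ k, y ^ k) \<in> poly_graph u (k * D)"
proof (induction k)
  case (Suc k)
  then have "(x * x ^ k, y * y ^ k) \<in> poly_graph u (D + k * D)"
    by (intro poly_graph_mult) auto
  then show ?case by simp
qed (simp add: one_poly_graph)

lemma poly_graph_decompose:
  assumes "(x, y) \<in> poly_graph u D"
  obtains g h where "\<And>d. (g d, h d) \<in> hom_graph u d"
    "x = (\<Sum>d\<in>{- int D..int D}. g d)" "y = (\<Sum>d\<in>{- int D..int D}. h d)"
proof -
  have "\<exists>g h. (\<forall>d. (g d, h d) \<in> hom_graph u d) \<and>
    x = (\<Sum>d\<in>{- int D..int D}. g d) \<and> y = (\<Sum>d\<in>{- int D..int D}. h d)"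
    using assms
  proof induction
    case (poly_graph_base e x y)
    then show ?case
      by (intro exI[of _ "\<lambda>d. if d = e then x else 0"] exI[of _ "\<lambda>d. if d = e then y else 0"])
        (auto intro: hom_graph_zero)
  next
    case (poly_graph_add x y x' y')
    then obtain g h g' h' where "\<forall>d. (g d, h d) \<in> hom_graph u d" "\<forall>d. (g' d, h' d) \<in> hom_graph u d"
      "x = (\<Sum>d\<in>{- int D..int D}. g d)" "y = (\<Sum>d\<in>{- int D..int D}. h d)"
      "x' = (\<Sum>d\<in>{- int D..int D}. g' d)" "y' = (\<Sum>d\<in>{- int D..int D}. h' d)"
      by blast
    then show ?case
      by (intro exI[of _ "\<lambda>d. g d + g' d"] exI[of _ "\<lambda>d. h d + h' d"])
        (auto intro: hom_graph_add simp: sum.distrib)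
  qed
  then show ?thesis using that by blast
qed

lemma poly_graph_bound:
  assumes "(x, y) \<in> poly_graph u D"
  shows "norm y \<le> real (2 * D + 1) * norm x"
proof -
  obtain g h where gh: "\<And>d. (g d, h d) \<in> hom_graph u d"
    "x = (\<Sum>d\<in>{- int D..int D}. g d)" "y = (\<Sum>d\<in>{- int D..int D}. h d)"
    using poly_graph_decompose[OF assms] by metis
  have "norm y \<le> (\<Sum>d\<in>{- int D..int D}. norm x)"
    unfolding gh(3)
  proof (rule sum_norm_le)
    fix d assume d: "d \<in> {- int D..int D}"
    \<comment> \<open>2 D + 1 is the least number of samples separating the degrees from -D to
      D.\<close>
    have "fourier (2 * D + 1) d x = g d"
      using fourier_decomposition[OF gh(2) hom_graph_homogeneous[OF gh(1)], of d "2 * D + 1"] d by auto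
    then have "norm (g d) \<le> norm x" using norm_fourier[of "2 * D + 1" d x] by simp
    then show "norm (h d) \<le> norm x" using hom_graph_norm[OF gh(1)[of d]] by simp
  qed
  also have "\<dots> = real (2 * D + 1) * norm x" by (simp add: nat_add_distrib)
  finally show ?thesis .
qed

lemma poly_graph_norm:
  assumes "(x, y) \<in> poly_graph u D"
  shows "norm y \<le> norm x"
\<comment> \<open>x^* x has degree at most 2 D, so its power with exponent 2^r has at most 4 D 2^r +
  1 homogeneous parts; this is at most (4 D + 1) (2^r + 1).\<close>
proof (rule norm_le_by_powers[where K="real (4 * D + 1)"])
  fix r :: nat
  have "(cstar x * x, cstar y * y) \<in> poly_graph u (D + D)"
    by (intro poly_graph_mult poly_graph_cstar assms)
  from poly_graph_bound[OF poly_graph_power[OF this, of "2 ^ r"]]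
  have "norm ((cstar y * y) ^ 2 ^ r) \<le> real (2 * (2 ^ r * (D + D)) + 1) * norm ((cstar x * x) ^ 2 ^ r)" by simp
  also have "\<dots> \<le> (real (4 * D + 1) * (2 ^ r + 1)) * ((norm x)\<^sup>2) ^ 2 ^ r"
    using norm_power_ineq[of "cstar x * x" "2 ^ r"]
    by (intro mult_mono) (auto simp: cstar_identity algebra_simps)
  finally show "norm ((cstar y * y) ^ 2 ^ r) \<le> real (4 * D + 1) * (2 ^ r + 1) * (norm x)\<^sup>2 ^ 2 ^ r" .
qed simp

lemma s_poly_graph: "i \<in> {1..n} \<Longrightarrow> (s i, u * s i) \<in> poly_graph u 1"
  using H_cstar_H[OF s_in_H S_in_H, of i "[]" 0]
  by (intro poly_graph_base[of 1]) (auto intro!: hom_graphI[of _ 1 0])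

end

end

text \<open>Working with graphs avoids checking that prescriptions on polynomials in the generators are
  well defined: contractivity makes even the closure single-valued.\<close>
definition star_graph :: "('a::cstar_algebra \<times> 'a) set \<Rightarrow> bool" where
  "star_graph R \<longleftrightarrow> (1, 1) \<in> R \<and>
     (\<forall>x y x' y'. (x, y) \<in> R \<and> (x', y') \<in> R \<longrightarrow> (x + x', y + y') \<in> R \<and> (x * x', y * y') \<in> R) \<and>
     (\<forall>x y. (x, y) \<in> R \<longrightarrow> (\<forall>a. (cscale a x, cscale a y) \<in> R) \<and> (cstar x, cstar y) \<in> R \<and> norm y \<le> norm x)"

lemma star_graph_diff:
  assumes "star_graph R" "(x, y) \<in> R" "(x', y') \<in> R"
  shows "(x - x', y - y') \<in> R"
proof -
  have "(x + cscale (-1) x', y + cscale (-1) y') \<in> R"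
    using assms unfolding star_graph_def by blast
  then show ?thesis by (simp add: cscale_minus_left)
qed

lemma star_graph_closure:
  assumes R: "star_graph R"
  shows "star_graph (closure R)"
proof -
  have seq: "\<exists>f g. (\<forall>k. (f k, g k) \<in> R) \<and> f \<longlonglongrightarrow> x \<and> g \<longlonglongrightarrow> y" if "(x, y) \<in> closure R" for x y
  proof -
    obtain h where "\<forall>k. h k \<in> R" "h \<longlonglongrightarrow> (x, y)" using \<open>(x, y) \<in> closure R\<close> by (auto simp: closure_sequential)
    then show ?thesis
      by (intro exI[of _ "\<lambda>k. fst (h k)"] exI[of _ "\<lambda>k. snd (h k)"]) (auto dest: tendsto_fst tendsto_snd)
  qed
  have lim: "(x, y) \<in> closure R" if "\<And>k. (f k, g k) \<in> R" "f \<longlonglongrightarrow> x" "g \<longlonglongrightarrow> y" for f g x y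
    unfolding closure_sequential
    by (intro exI[of _ "\<lambda>k. (f k, g k)"] conjI allI that(1) tendsto_Pair that(2,3))
  have 1: "(x + x', y + y') \<in> closure R \<and> (x * x', y * y') \<in> closure R"
    if xy: "(x, y) \<in> closure R" "(x', y') \<in> closure R" for x y x' y'
  proof -
    obtain f g f' g' where "\<And>k. (f k, g k) \<in> R" "f \<longlonglongrightarrow> x" "g \<longlonglongrightarrow> y"
      "\<And>k. (f' k, g' k) \<in> R" "f' \<longlonglongrightarrow> x'" "g' \<longlonglongrightarrow> y'"
      using seq[OF xy(1)] seq[OF xy(2)] by auto
    then show ?thesis
      using R unfolding star_graph_def
      by (intro conjI lim[of "\<lambda>k. f k + f' k" "\<lambda>k. g k + g' k"] lim[of "\<lambda>k. f k * f' k" "\<lambda>k. g k * g' k"]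
          tendsto_add tendsto_mult) auto
  qed
  have 2: "(cscale a x, cscale a y) \<in> closure R \<and> (cstar x, cstar y) \<in> closure R \<and> norm y \<le> norm x"
    if xy: "(x, y) \<in> closure R" for x y a
  proof -
    obtain f g where fg: "\<And>k. (f k, g k) \<in> R" "f \<longlonglongrightarrow> x" "g \<longlonglongrightarrow> y" using seq[OF xy] by auto
    then have "\<And>k. norm (g k) \<le> norm (f k)" using R unfolding star_graph_def by blast
    then have "norm y \<le> norm x"
      by (intro LIMSEQ_le[OF tendsto_norm[OF fg(3)] tendsto_norm[OF fg(2)]]) auto
    then show ?thesis
      using R fg unfolding star_graph_def
      by (intro conjI lim[of "\<lambda>k. cscale a (f k)" "\<lambda>k. cscale a (g k)"]
          lim[of "\<lambda>k. cstar (f k)" "\<lambda>k. cstar (g k)"] tendsto_cscale tendsto_cstar) auto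
  qed
  have "(1, 1) \<in> closure R" using R closure_subset[of R] by (auto simp: star_graph_def)
  then show ?thesis using 1 2 unfolding star_graph_def by blast
qed

text \<open>Contractivity turns convergent arguments into Cauchy values, so the domain of the
  closure is itself closed. It is then a C*-subalgebra containing the generators.\<close>

lemma star_graph_total:
  assumes R: "star_graph R" and S: "S \<subseteq> fst ` R" and gen: "cstar_generated S = UNIV"
  shows "\<exists>y. (x, y) \<in> closure R"
proof -
  note cl = star_graph_closure[OF R, unfolded star_graph_def]
  let ?D = "fst ` closure R"
  have "x \<in> ?D" if x: "\<And>k. f k \<in> ?D" "f \<longlonglongrightarrow> x" for f x
  proof -
    have "\<exists>y. (f k, y) \<in> closure R" for k using x(1)[of k] by auto
    then obtain g where g: "\<And>k. (f k, g k) \<in> closure R" by metis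
    have "dist (g i) (g j) \<le> dist (f i) (f j)" for i j
      using star_graph_diff[OF star_graph_closure[OF R] g[of i] g[of j]] cl unfolding dist_norm by blast
    then have "Cauchy g" using LIMSEQ_imp_Cauchy[OF x(2)] unfolding Cauchy_def
      by (meson order_le_less_trans)
    then obtain y where "g \<longlonglongrightarrow> y" using Cauchy_convergent_iff convergent_def by blast
    then have "(x, y) \<in> closure (closure R)"
      unfolding closure_sequential[of _ "closure R"]
      by (intro exI[of _ "\<lambda>k. (f k, g k)"] conjI allI g tendsto_Pair x)
    then show ?thesis by force
  qed
  then have "closed ?D" by (meson closed_sequential_limits)
  moreover have "0 \<in> ?D"
  proof -
    have "(cscale 0 1, cscale 0 1) \<in> closure R" using cl by blast
    then show ?thesis by force
  qed
  moreover have "x + x' \<in> ?D \<and> x * x' \<in> ?D" if x: "x \<in> ?D" "x' \<in> ?D" for x x'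
  proof -
    obtain y y' where "(x, y) \<in> closure R" "(x', y') \<in> closure R" using x by auto
    then have "(x + x', y + y') \<in> closure R" "(x * x', y * y') \<in> closure R" using cl by blast+
    then show ?thesis by force
  qed
  moreover have "cscale a x \<in> ?D \<and> cstar x \<in> ?D" if x: "x \<in> ?D" for x a
  proof -
    obtain y where y: "(x, y) \<in> closure R" using x by auto
    have "(cscale a x, cscale a y) \<in> closure R" "(cstar x, cstar y) \<in> closure R"
      using cl y by (simp_all only: simp_thms)
    then show ?thesis by (metis fst_conv image_eqI)
  qed
  ultimately have "cstar_subalgebra ?D"
    unfolding cstar_subalgebra_def by blast
  moreover have "S \<subseteq> ?D" using S closure_subset[of R] by force
  ultimately have "cstar_generated S \<subseteq> ?D" by (rule cstar_generated_minimal)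
  then show ?thesis using gen by force
qed

text \<open>Applied to the graphs for u = 1, this is the density of polynomials, each of which comes
  with its homogeneous parts.\<close>

lemma star_graph_dense:
  assumes "star_graph R" "S \<subseteq> fst ` R" "cstar_generated S = UNIV" "e > 0"
  obtains x' y' where "(x', y') \<in> R" "norm (x - x') < e"
proof -
  obtain y where "(x, y) \<in> closure R" using star_graph_total[OF assms(1-3)] by blast
  then obtain z where "z \<in> R" "dist z (x, y) < e" using assms(4) by (meson closure_approachable)
  then show ?thesis using that[of "fst z" "snd z"] dist_fst_le[of z "(x, y)"]
    by (auto simp: dist_norm norm_minus_commute)
qed

lemma star_graph_extend:
  assumes R: "star_graph R" "S \<subseteq> fst ` R" "cstar_generated S = UNIV"
  obtains f where "star_hom f" "\<And>x y. (x, y) \<in> R \<Longrightarrow> f x = y"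
proof -
  note cl = star_graph_closure[OF R(1)]
  obtain f where f: "\<And>x. (x, f x) \<in> closure R" using star_graph_total[OF R] by metis
  have uniq: "f x = y" if "(x, y) \<in> closure R" for x y
  proof -
    have "norm (f x - y) \<le> norm (x - x)"
      using star_graph_diff[OF cl f that] cl unfolding star_graph_def by blast
    then show ?thesis by simp
  qed
  have "star_hom f"
    unfolding star_hom_def using f cl
    by (intro conjI allI uniq) (auto simp: star_graph_def)
  then show ?thesis using that uniq closure_subset by blast
qed

section \<open>Existence of quasi-free automorphisms\<close>

context gauge_cuntz_family
begin

lemma star_graph_poly:
  assumes u: "cstar u * u = 1" "u * cstar u = 1"
  shows "star_graph (\<Union>D. poly_graph u D)"
  unfolding star_graph_def
proof (intro conjI allI impI)
  fix x y x' y'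
  assume "(x, y) \<in> (\<Union>D. poly_graph u D) \<and> (x', y') \<in> (\<Union>D. poly_graph u D)"
  then obtain D D' where *: "(x, y) \<in> poly_graph u D" "(x', y') \<in> poly_graph u D'" by auto
  show "(x * x', y * y') \<in> (\<Union>D. poly_graph u D)" using poly_graph_mult[OF u *(2) *(1)] by blast
  have "(x, y) \<in> poly_graph u (max D D')" "(x', y') \<in> poly_graph u (max D D')"
    using * by (auto intro: poly_graph_mono[OF u])
  then show "(x + x', y + y') \<in> (\<Union>D. poly_graph u D)" by (auto intro: poly_graph_add)
qed (auto intro: poly_graph_cscale[OF u] poly_graph_cstar[OF u] poly_graph_norm[OF u] one_poly_graph[OF u])

lemma generators_poly_graph:
  "cstar u * u = 1 \<Longrightarrow> u * cstar u = 1 \<Longrightarrow> s ` {1..n} \<subseteq> fst ` (\<Union>D. poly_graph u D)"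
  using s_poly_graph[of u] by force

text \<open>A substitute for the universal property of O_n, for families u s_i:
  \<open>poly_graph_norm\<close> makes the prescription on polynomials contractive and hence
  extendable.\<close>

lemma quasi_free_hom_exists:
  assumes gen: "cstar_generated (s ` {1..n}) = UNIV"
    and u: "cstar u * u = 1" "u * cstar u = 1"
  obtains \<alpha> where "star_hom \<alpha>" "\<And>i. i \<in> {1..n} \<Longrightarrow> \<alpha> (s i) = u * s i"
  using star_graph_extend[OF star_graph_poly[OF u] generators_poly_graph[OF u] gen] s_poly_graph[OF u]
  by (metis UN_I UNIV_I)

lemma quasi_free_E:
  assumes "star_hom \<alpha>" "\<And>i. i \<in> {1..n} \<Longrightarrow> \<alpha> (s i) = u * s i" "x \<in> E 1 1"
  shows "\<alpha> x = u * x * cstar u"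
proof -
  have "E 1 1 \<subseteq> {x. \<alpha> x = u * x * cstar u}"
    by (rule E_cases) (auto simp: csubspace_def star_hom_simps[OF assms(1)] distrib_left distrib_right
      cscale_left_mult cscale_right_mult words_Suc word_op_Cons assms(2) cstar_mult mult.assoc
      linear_0[OF star_hom_linear[OF assms(1)]])
  then show ?thesis using assms(3) by auto
qed

text \<open>For u in \<open>E 1 1\<close> the homomorphism of u acts on \<open>E 1 1\<close> as
  conjugation by u and therefore fixes u^*; that of u^* fixes u in the same way. Hence the two undo
  each other on the generators.\<close>

lemma quasi_free_automorphism:
  assumes gen: "cstar_generated (s ` {1..n}) = UNIV"
    and u: "cstar u * u = 1" "u * cstar u = 1" "u \<in> E 1 1"
  obtains \<alpha> \<beta> where "star_hom \<alpha>" "star_hom \<beta>" "\<And>x. \<alpha> (\<beta> x) = x" "\<And>x. \<beta> (\<alpha> x) = x"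
    "\<And>i. i \<in> {1..n} \<Longrightarrow> \<alpha> (s i) = u * s i"
proof -
  obtain \<alpha> where \<alpha>: "star_hom \<alpha>" "\<And>i. i \<in> {1..n} \<Longrightarrow> \<alpha> (s i) = u * s i"
    using quasi_free_hom_exists[OF gen u(1,2)] by blast
  obtain \<beta> where \<beta>: "star_hom \<beta>" "\<And>i. i \<in> {1..n} \<Longrightarrow> \<beta> (s i) = cstar u * s i"
    using quasi_free_hom_exists[OF gen, of "cstar u"] u(1,2) by (auto simp: cstar_cstar)
  have \<alpha>u: "\<alpha> (cstar u) = cstar u"
    using quasi_free_E[OF \<alpha> E_cstar[OF u(3)]] u(2) by (simp add: mult.assoc)
  have \<beta>u: "\<beta> u = u"
    using quasi_free_E[OF \<beta> u(3)] u(1) by (simp add: cstar_cstar)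
  have "\<alpha> \<circ> \<beta> = id"
    by (rule star_homs_eq_on_generators[OF star_hom_compose[OF \<alpha>(1) \<beta>(1)] star_hom_id gen])
      (auto simp: \<beta> star_hom_mult[OF \<alpha>(1)] \<alpha>u \<alpha>(2) u(1) simp flip: mult.assoc)
  moreover have "\<beta> \<circ> \<alpha> = id"
    by (rule star_homs_eq_on_generators[OF star_hom_compose[OF \<beta>(1) \<alpha>(1)] star_hom_id gen])
      (auto simp: \<alpha> star_hom_mult[OF \<beta>(1)] \<beta>u \<beta>(2) u(2) simp flip: mult.assoc)
  ultimately show ?thesis using that[OF \<alpha>(1) \<beta>(1)] \<alpha>(2) by (metis comp_apply id_apply)
qed

subsection \<open>Fejer means\<close>

text \<open>The difference l = q - p occurs N + 1 - |l| times, which produces the Fejer weights 1 -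
  |l| / (N + 1). The double sum displays the kernel as a squared modulus.\<close>

definition fejer :: "nat \<Rightarrow> nat \<Rightarrow> 'a \<Rightarrow> 'a" where
  "fejer N L y = (1 / (real N + 1)) *\<^sub>R (\<Sum>p\<le>N. \<Sum>q\<le>N. fourier L (int q - int p) y)"

lemma fejer_add: "fejer N L (x + y) = fejer N L x + fejer N L y"
  by (simp add: fejer_def fourier_add sum.distrib scaleR_add_right)

lemma fejer_0 [simp]: "fejer N L 0 = 0"
  by (simp add: fejer_def)

lemma fejer_sum: "fejer N L (sum f I) = (\<Sum>i\<in>I. fejer N L (f i))"
  by (induction I rule: infinite_finite_induct) (auto simp: fejer_add)

lemma fejer_diff: "fejer N L (x - y) = fejer N L x - fejer N L y"
  using fejer_add[of N L "x - y" y] by simp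

text \<open>The kernel is the squared modulus of the sum of z^p over p \<le> N, divided by N + 1. It
  is nonnegative and has mean 1 over the L-th roots of unity, as N < L leaves only the terms p = q
  in the mean.\<close>

lemma norm_fejer:
  assumes "N < L"
  shows "norm (fejer N L y) \<le> norm y"
proof -
  define w where "w r = (norm (\<Sum>p\<le>N. cis (real p * ang L r)))\<^sup>2" for r
  have "w r \<ge> 0" for r by (simp add: w_def)
  have w: "(\<Sum>p\<le>N. \<Sum>q\<le>N. cis (of_int (int p - int q) * ang L r)) = of_real (w r)" for r
  proof -
    have "of_real (w r) = (\<Sum>p\<le>N. cis (real p * ang L r)) * cnj (\<Sum>q\<le>N. cis (real q * ang L r))"
      unfolding w_def by (simp only: complex_norm_square)
    also have "\<dots> = (\<Sum>p\<le>N. \<Sum>q\<le>N. cis (of_int (int p - int q) * ang L r))"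
      by (simp add: sum_product cis_cnj cis_mult algebra_simps)
    finally show ?thesis by simp
  qed
  have "complex_of_real (\<Sum>r<L. w r) = (\<Sum>r<L. \<Sum>p\<le>N. \<Sum>q\<le>N. cis (of_int (int p - int q) * ang L r))"
    by (simp only: w of_real_sum)
  also have "\<dots> = (\<Sum>p\<le>N. \<Sum>q\<le>N. \<Sum>r<L. cis (of_int (int p - int q) * ang L r))"
    by (simp add: sum.swap[of _ "{..N}" "{..<L}"])
  also have "\<dots> = (\<Sum>p\<le>N. \<Sum>q\<le>N. if p = q then of_nat L else 0)"
    by (intro sum.cong refl, subst sum_cis_roots) (use assms in auto)
  also have "\<dots> = complex_of_real ((real N + 1) * real L)" by simp
  finally have sumw: "(\<Sum>r<L. w r) = (real N + 1) * real L" by (simp only: of_real_eq_iff)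
  have "(\<Sum>p\<le>N. \<Sum>q\<le>N. fourier L (int q - int p) y) =
     (1 / real L) *\<^sub>R (\<Sum>p\<le>N. \<Sum>q\<le>N. \<Sum>r<L. cscale (cis (of_int (int p - int q) * ang L r)) (omega (cis (ang L r)) y))"
    by (simp add: fourier_def scaleR_sum_right)
  also have "\<dots> = (1 / real L) *\<^sub>R (\<Sum>r<L. \<Sum>p\<le>N. \<Sum>q\<le>N. cscale (cis (of_int (int p - int q) * ang L r)) (omega (cis (ang L r)) y))"
    by (simp add: sum.swap[of _ "{..N}" "{..<L}"])
  also have "\<dots> = (1 / real L) *\<^sub>R (\<Sum>r<L. cscale (of_real (w r)) (omega (cis (ang L r)) y))"
    by (simp add: cscale_sum_left flip: w)
  finally have "norm (\<Sum>p\<le>N. \<Sum>q\<le>N. fourier L (int q - int p) y) =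
      (1 / real L) * norm (\<Sum>r<L. cscale (of_real (w r)) (omega (cis (ang L r)) y))" by simp
  also have "\<dots> \<le> (1 / real L) * (\<Sum>r<L. w r * norm y)"
    using \<open>\<And>r. w r \<ge> 0\<close>
    by (intro mult_left_mono sum_norm_le) (auto simp: norm_cscale intro!: mult_left_mono star_hom_norm[OF star_hom_omega_cis])
  also have "\<dots> = (real N + 1) * norm y"
    using assms by (simp add: sumw flip: sum_distrib_right)
  finally show ?thesis by (simp add: fejer_def field_simps)
qed

lemma fejer_homogeneous:
  assumes y: "homogeneous d y" and "\<bar>d\<bar> + int N < int L"
  shows "norm (y - fejer N L y) \<le> real_of_int \<bar>d\<bar> * norm y / (real N + 1)"
proof -
  define P where "P = {p. p \<le> N \<and> (\<exists>q\<le>N. int q - int p = d)}"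
  have "(\<Sum>q\<le>N. fourier L (int q - int p) y) = (if p \<in> P then y else 0)" if "p \<le> N" for p
  proof -
    have "(\<Sum>q\<le>N. fourier L (int q - int p) y) = (\<Sum>q\<le>N. if q = nat (d + int p) \<and> d + int p \<ge> 0 then y else 0)"
      by (intro sum.cong refl, subst fourier_homogeneous[OF y]) (use assms(2) that in auto)
    also have "\<dots> = (if 0 \<le> d + int p \<and> nat (d + int p) \<le> N then y else 0)"
      by (cases "0 \<le> d + int p") auto
    also have "0 \<le> d + int p \<and> nat (d + int p) \<le> N \<longleftrightarrow> p \<in> P"
      using that by (auto simp: P_def intro!: exI[of _ "nat (d + int p)"])
    finally show ?thesis .
  qed
  then have "fejer N L y = (1 / (real N + 1)) *\<^sub>R (\<Sum>p\<le>N. if p \<in> P then y else 0)"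
    by (simp add: fejer_def)
  also have "(\<Sum>p\<le>N. if p \<in> P then y else 0) = (\<Sum>p\<in>P. y)"
    by (subst sum.inter_filter[symmetric]) (auto simp: P_def intro!: sum.cong)
  also have "\<dots> = real (card P) *\<^sub>R y" by (simp add: scaleR_conv_of_real)
  finally have f: "fejer N L y = (real (card P) / (real N + 1)) *\<^sub>R y" by simp
  have sub: "P \<subseteq> {..N}" by (auto simp: P_def)
  have "card P \<le> N + 1" using card_mono[OF _ sub] by simp
  moreover have "int N + 1 - \<bar>d\<bar> \<le> int (card P)"
  proof -
    \<comment> \<open>The interval of those p for which both p and p + d lie between 0 and
      N.\<close>
    have "card {nat (- d)..<N + 1 - nat d} \<le> card P"
      by (rule card_mono[OF finite_subset[OF sub]]) (auto simp: P_def intro!: exI[of _ "nat (int _ + d)"])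
    then show ?thesis by auto
  qed
  ultimately have "real (card P) \<le> real N + 1" "real N + 1 - real (card P) \<le> real_of_int \<bar>d\<bar>"
    by linarith+
  then have "\<bar>(real N + 1 - real (card P)) / (real N + 1)\<bar> \<le> real_of_int \<bar>d\<bar> / (real N + 1)"
    by (simp add: divide_right_mono)
  then have c: "\<bar>1 - real (card P) / (real N + 1)\<bar> \<le> real_of_int \<bar>d\<bar> / (real N + 1)"
    by (simp add: diff_divide_distrib)
  have "y - fejer N L y = (1 - real (card P) / (real N + 1)) *\<^sub>R y"
    by (simp add: f scaleR_diff_left)
  then show ?thesis using mult_right_mono[OF c norm_ge_zero[of y]] by simp
qed

end

subsection \<open>Shift-invariant maximal abelian subalgebras lie in the core\<close>

lemma almost_normal:
  fixes y h :: "'a::cstar_algebra"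
  assumes "cstar y * y = y * cstar y" "norm (y - h) \<le> e"
  shows "norm (cstar h * h - h * cstar h) \<le> 2 * e * (2 * norm h + e)"
proof -
  have e: "e \<ge> 0" using assms(2) norm_ge_zero order_trans by blast
  have ny: "norm y \<le> norm h + e" using norm_triangle_ineq[of "y - h" h] assms(2) by simp
  have d: "norm (h - y) \<le> e" "norm (cstar h - cstar y) \<le> e" "norm (cstar y - cstar h) \<le> e"
    using assms(2) by (simp_all add: norm_minus_commute flip: cstar_diff)
  have "cstar h * h - h * cstar h =
      ((cstar h - cstar y) * h + cstar y * (h - y)) + ((y - h) * cstar y + h * (cstar y - cstar h))"
    using assms(1) by (simp add: algebra_simps)
  also have "norm \<dots> \<le> (e * norm h + (norm h + e) * e) + (e * (norm h + e) + norm h * e)"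
    using assms(2) d ny by (intro norm_triangle_le add_mono order_trans[OF norm_triangle_ineq] norm_mult_le) auto
  finally show ?thesis by (simp add: algebra_simps)
qed

context cuntz_family
begin

text \<open>Elements of \<open>H k\<close> are multiples of isometries with a range projection of corank at least one.\<close>
lemma H_normality_defect:
  assumes "h \<in> H k" "k \<ge> 1" "n \<ge> 2"
  shows "(norm h)\<^sup>2 \<le> 2 * norm (cstar h * h - h * cstar h)"
proof -
  \<comment> \<open>Two letters exist since n \<ge> 2, and the words differ since k \<ge> 1.\<close>
  define \<mu> \<nu> where "\<mu> = replicate k (1::nat)" and "\<nu> = replicate k (2::nat)"
  have \<mu>\<nu>: "\<mu> \<in> words n k" "\<nu> \<in> words n k" "\<mu> \<noteq> \<nu>"
    using assms by (auto simp: \<mu>_def \<nu>_def words_def in_lists_conv_set replicate_eq_replicate)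
  \<comment> \<open>Compression by \<open>S \<kappa>\<close> turns h^* h into the scalar |h|^2, but
    h h^* into an element of norm at most half of that.\<close>
  have "2 * (norm (cstar (S \<kappa>) * h))\<^sup>2 \<le> (norm h)\<^sup>2 \<Longrightarrow> ?thesis" if \<kappa>: "\<kappa> \<in> words n k" for \<kappa>
  proof -
    assume le: "2 * (norm (cstar (S \<kappa>) * h))\<^sup>2 \<le> (norm h)\<^sup>2"
    let ?c = "cstar (S \<kappa>) * h"
    have "cstar (S \<kappa>) * (cstar h * h - h * cstar h) * S \<kappa>
        = cstar (S \<kappa>) * (cstar h * h) * S \<kappa> - ?c * cstar ?c"
      by (simp add: algebra_simps cstar_mult cstar_cstar)
    also have "cstar (S \<kappa>) * (cstar h * h) * S \<kappa> = cscale (of_real ((norm h)\<^sup>2)) 1"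
      by (simp add: H_norm[OF assms(1)] cscale_left_mult cscale_right_mult S_isometry[OF \<kappa>])
    finally have eq: "cstar (S \<kappa>) * (cstar h * h - h * cstar h) * S \<kappa>
        = cscale (of_real ((norm h)\<^sup>2)) 1 - ?c * cstar ?c" .
    have "(norm h)\<^sup>2 = norm (cscale (of_real ((norm h)\<^sup>2)) (1::'a))" by (simp add: norm_cscale norm_power)
    also have "\<dots> \<le> norm (cscale (of_real ((norm h)\<^sup>2)) 1 - ?c * cstar ?c) + norm (?c * cstar ?c)"
      using norm_triangle_ineq[of "cscale (of_real ((norm h)\<^sup>2)) 1 - ?c * cstar ?c" "?c * cstar ?c"] by simp
    also have "norm (?c * cstar ?c) = (norm ?c)\<^sup>2"
      using cstar_identity[of "cstar ?c"] by (simp add: cstar_cstar)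
    also have "norm (cscale (of_real ((norm h)\<^sup>2)) 1 - ?c * cstar ?c) \<le> norm (cstar h * h - h * cstar h)"
      unfolding eq[symmetric] by (rule norm_contract2) (auto simp: norm_S[OF \<kappa>])
    finally show ?thesis using le by simp
  qed
  moreover have "2 * (norm (cstar (S \<mu>) * h))\<^sup>2 \<le> (norm h)\<^sup>2 \<or> 2 * (norm (cstar (S \<nu>) * h))\<^sup>2 \<le> (norm h)\<^sup>2"
    using H_bessel[OF assms(1) \<mu>\<nu>] by linarith
  ultimately show ?thesis using \<mu>\<nu> by blast
qed

end

locale shift_invariant_masa = gauge_cuntz_family n s omega
  for n and s :: "nat \<Rightarrow> 'a::cstar_algebra" and omega +
  fixes A :: "'a set"
  assumes n2: "n \<ge> 2"
    and generates: "cstar_generated (s ` {1..n}) = UNIV"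
    and masa: "maximal_abelian A"
    and inv_omega: "norm t = 1 \<Longrightarrow> x \<in> A \<Longrightarrow> omega t x \<in> A"
    and inv_\<sigma>: "x \<in> A \<Longrightarrow> \<sigma> x \<in> A"
    and inv_\<tau>: "x \<in> A \<Longrightarrow> \<tau> x \<in> A"
begin

lemma A_subalgebra: "cstar_subalgebra A"
  using masa by (simp add: maximal_abelian_def)

lemma A_closed: "closed A" and A_cstar: "x \<in> A \<Longrightarrow> cstar x \<in> A"
  and A_cscale: "x \<in> A \<Longrightarrow> cscale a x \<in> A"
  using A_subalgebra by (auto simp: cstar_subalgebra_def)

lemma A_commute: "x \<in> A \<Longrightarrow> y \<in> A \<Longrightarrow> x * y = y * x"
  using masa by (auto simp: maximal_abelian_def abelian_set_def)

lemma A_if_commute: "(\<And>a. a \<in> A \<Longrightarrow> x * a = a * x) \<Longrightarrow> x \<in> A"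
  using maximal_abelian_commutant[OF masa] by (auto simp: commutant_def)

lemma inv_\<sigma>_pow: "x \<in> A \<Longrightarrow> (\<sigma> ^^ m) x \<in> A"
  by (induction m) (auto intro: inv_\<sigma>)

lemma inv_\<tau>_pow: "x \<in> A \<Longrightarrow> (\<tau> ^^ m) x \<in> A"
  by (induction m) (auto intro: inv_\<tau>)

text \<open>Shifting an element \<open>a\<close> of \<open>A\<close> past \<open>\<eta>\<close> and \<open>\<xi>\<^sup>*\<close> shows that the compression commutes with \<open>A\<close>.\<close>
lemma compression_in_A:
  assumes "b \<in> A" "\<xi> \<in> H m" "\<eta> \<in> H m"
  shows "cstar \<xi> * b * \<eta> \<in> A"
proof (rule A_if_commute)
  fix a assume a: "a \<in> A"
  have "cstar \<xi> * b * \<eta> * a = cstar \<xi> * (b * (\<sigma> ^^ m) a) * \<eta>"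
    by (simp add: mult.assoc \<sigma>_pow_H[OF assms(3)])
  also have "\<dots> = cstar \<xi> * (\<sigma> ^^ m) a * b * \<eta>"
    by (simp add: A_commute[OF assms(1) inv_\<sigma>_pow[OF a]] mult.assoc)
  finally show "cstar \<xi> * b * \<eta> * a = a * (cstar \<xi> * b * \<eta>)"
    by (simp add: \<sigma>_pow_cstar_H[OF assms(2)] mult.assoc)
qed

text \<open>Here alone invariance under the second shift enters. Unlike
  \<open>compression_in_A\<close>, this strips tensor factors behind the first one and keeps the
  first.\<close>

lemma shifted_compression_in_A:
  assumes "b \<in> A" "\<xi> \<in> H m" "\<eta> \<in> H m"
  shows "cstar (\<sigma> \<xi>) * b * \<sigma> \<eta> \<in> A"
proof (rule A_if_commute)
  fix a assume a: "a \<in> A"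
  have left: "cstar (\<sigma> \<xi>) * (\<tau> ^^ m) a = a * cstar (\<sigma> \<xi>)"
    using \<tau>_pow_\<sigma>H[OF assms(2), of "cstar a"] star_hom_cstar[OF star_hom_funpow[OF star_hom_\<tau>, of m], of a]
    by (metis cstar_cstar cstar_mult)
  have "cstar (\<sigma> \<xi>) * b * \<sigma> \<eta> * a = cstar (\<sigma> \<xi>) * (b * (\<tau> ^^ m) a) * \<sigma> \<eta>"
    by (simp add: mult.assoc \<tau>_pow_\<sigma>H[OF assms(3)])
  also have "\<dots> = cstar (\<sigma> \<xi>) * (\<tau> ^^ m) a * b * \<sigma> \<eta>"
    by (simp add: A_commute[OF assms(1) inv_\<tau>_pow[OF a]] mult.assoc)
  finally show "cstar (\<sigma> \<xi>) * b * \<sigma> \<eta> * a = a * (cstar (\<sigma> \<xi>) * b * \<sigma> \<eta>)"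
    by (simp add: left mult.assoc)
qed

text \<open>Compressions of an element of \<open>A\<close> are normal, which elements of \<open>H k\<close> are far from being.\<close>
lemma near_homogeneous_small:
  assumes "b \<in> A" "x \<in> E (m + k) m" "k \<ge> 1" "norm (b - x) \<le> e"
  shows "norm x \<le> real (n ^ k) * (9 * e)"
proof (rule norm_E_shift_le[OF assms(2)])
  show e: "0 \<le> 9 * e" using order_trans[OF norm_ge_zero assms(4)] by simp
  fix \<xi> \<eta> assume *: "\<xi> \<in> H m" "\<eta> \<in> H m" "norm \<xi> = 1" "norm \<eta> = 1"
  define y h where "y = cstar \<xi> * b * \<eta>" and "h = cstar \<xi> * x * \<eta>"
  have y: "y \<in> A" unfolding y_def by (rule compression_in_A[OF assms(1) *(1,2)])
  have h: "h \<in> H k" unfolding h_def by (rule inner_E_H[OF *(1) assms(2) *(2)])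
  have "y - h = cstar \<xi> * (b - x) * \<eta>" by (simp add: y_def h_def algebra_simps)
  then have "norm (y - h) \<le> e"
    using norm_contract2[of "cstar \<xi>" \<eta> "b - x"] * assms(4) by simp
  from almost_normal[OF A_commute[OF A_cstar[OF y] y] this] H_normality_defect[OF h assms(3) n2]
  have le: "norm h * norm h \<le> 4 * e * (2 * norm h + e)" by (simp add: power2_eq_square)
  \<comment> \<open>The inequality \<open>le\<close> bounds the ratio of norm h to e by 4 + sqrt 20
    < 9. With 9 the contradiction reads 76/81 < 1.\<close>
  have "norm h \<le> 9 * e"
  proof (rule ccontr)
    assume "\<not> norm h \<le> 9 * e"
    then have "9 * e \<le> norm h" "norm h > 0" using e by auto
    then have "4 * e * (2 * norm h + e) \<le> 4 * (norm h / 9) * (2 * norm h + norm h / 9)"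
      using e by (intro mult_mono) auto
    then have "norm h * norm h \<le> (76 / 81) * (norm h * norm h)" using le by (simp add: field_simps)
    moreover have "norm h * norm h > 0" using \<open>norm h > 0\<close> by simp
    ultimately show False by linarith
  qed
  then show "norm (cstar \<xi> * x * \<eta>) \<le> 9 * e" by (simp add: h_def)
qed

lemma fourier_in_A: "a \<in> A \<Longrightarrow> fourier L l a \<in> A"
  unfolding fourier_def cscale_of_real[symmetric]
  by (intro A_cscale cstar_subalgebra_sum[OF A_subalgebra] inv_omega) auto

lemma approximation:
  assumes "e > 0"
  obtains D g where "\<And>d. \<exists>p q. g d \<in> E p q \<and> int p - int q = d"
    "norm (a - (\<Sum>d\<in>{- int D..int D}. g d)) < e"
proof -
  have one: "cstar 1 * 1 = (1::'a)" "1 * cstar 1 = (1::'a)" by simp_all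
  obtain x y where xy: "(x, y) \<in> (\<Union>D. poly_graph 1 D)" "norm (a - x) < e"
    using star_graph_dense[OF star_graph_poly[OF one] generators_poly_graph[OF one] generates assms] .
  then obtain D where "(x, y) \<in> poly_graph 1 D" by auto
  then obtain g h where "\<And>d. (g d, h d) \<in> hom_graph 1 d" "x = (\<Sum>d\<in>{- int D..int D}. g d)"
    using poly_graph_decompose[OF one] by metis
  then show ?thesis using that[of g D] xy(2) by (auto simp: hom_graph_def) blast
qed

lemma fourier_approximation:
  assumes g: "\<And>d. \<exists>p q. g d \<in> E p q \<and> int p - int q = d"
    and a: "norm (a - (\<Sum>d\<in>{- int D..int D}. g d)) \<le> e" and "\<bar>l\<bar> + int D < int L"
  shows "norm (fourier L l a - (if \<bar>l\<bar> \<le> int D then g l else 0)) \<le> e"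
proof -
  have "homogeneous d (g d)" for d using g[of d] homogeneous_E by blast
  then have "fourier L l (\<Sum>d\<in>{- int D..int D}. g d) = (if \<bar>l\<bar> \<le> int D then g l else 0)"
    using assms(3) by (intro fourier_decomposition) auto
  then show ?thesis
    using norm_fourier[of L l "a - (\<Sum>d\<in>{- int D..int D}. g d)"] a by (simp add: fourier_diff)
qed

text \<open>The sampled coefficient depends on L; once L > |l| + D it is close to a homogeneous
  element, which \<open>near_homogeneous_small\<close> bounds. Negative degrees reduce to positive
  ones by taking adjoints.\<close>

lemma fourier_vanishes:
  assumes a: "a \<in> A" and l: "l \<noteq> 0" and "e > 0"
  shows "\<forall>\<^sub>F L in sequentially. norm (fourier L l a) \<le> e"
proof -
  define k where "k = nat \<bar>l\<bar>"
  \<comment> \<open>Chosen so that the bound 9 n^k e' on the homogeneous element and the distance e'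
    to it add up to e.\<close>
  define e' where "e' = e / (real (n ^ k) * 9 + 1)"
  have K: "real (n ^ k) * 9 + 1 > 0" by (intro add_nonneg_pos) auto
  then have e': "e' > 0" using \<open>e > 0\<close> unfolding e'_def by (rule divide_pos_pos[rotated])
  have "(real (n ^ k) * 9 + 1) * e' = e" using K unfolding e'_def by simp
  then have e'_eq: "real (n ^ k) * (9 * e') + e' = e" by (simp only: distrib_right mult_1 mult.assoc)
  obtain D g where g: "\<And>d. \<exists>p q. g d \<in> E p q \<and> int p - int q = d"
    "norm (a - (\<Sum>d\<in>{- int D..int D}. g d)) < e'"
    using approximation[OF e'] by blast
  have "norm (fourier L l a) \<le> e" if L: "nat \<bar>l\<bar> + D < L" for L
  proof -
    define b where "b = fourier L l a"
    define x where "x = (if \<bar>l\<bar> \<le> int D then g l else 0)"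
    have b: "b \<in> A" unfolding b_def by (rule fourier_in_A[OF a])
    have bx: "norm (b - x) \<le> e'"
      unfolding b_def x_def by (rule fourier_approximation[OF g(1)]) (use g(2) L in auto)
    obtain p q where "g l \<in> E p q" and pq: "int p - int q = l" using g(1) by blast
    then have x: "x \<in> E p q" using csubspace_0[OF csubspace_E] by (auto simp: x_def)
    have k1: "k \<ge> 1" using l by (simp add: k_def)
    have "norm x \<le> real (n ^ k) * (9 * e')"
    proof (cases "l > 0")
      case True
      then have "p = q + k" using pq by (simp add: k_def)
      then show ?thesis using near_homogeneous_small[OF b _ k1 bx, of q] x by simp
    next
      case False
      then have "q = p + k" using pq l by (simp add: k_def)
      moreover have "norm (cstar b - cstar x) \<le> e'" using bx by (simp flip: cstar_diff)
      ultimately show ?thesis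
        using near_homogeneous_small[OF A_cstar[OF b] _ k1, of "cstar x" p e'] E_cstar[OF x] by simp
    qed
    then show ?thesis using norm_triangle_ineq[of "b - x" x] bx e'_eq by (simp add: b_def)
  qed
  then show ?thesis by (intro eventually_sequentiallyI[of "nat \<bar>l\<bar> + D + 1"]) auto
qed

text \<open>The UHF algebra of type n^infinity, which is the fixed point algebra of the gauge
  action.\<close>

definition core :: "'a set" where "core = closure (\<Union>m. E m m)"

text \<open>a is linked to g 0 through x, \<open>fejer N L x\<close>, \<open>fejer N L a\<close> and
  \<open>fourier L 0 a\<close>. Fejer means are contractive for every N, so the error a - x is not
  magnified when N grows; D is fixed first, then N, and L last.\<close>

lemma A_subset_core: "A \<subseteq> core"
proof
  fix a assume a: "a \<in> A"
  show "a \<in> core"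
    unfolding core_def closure_approachable
  proof safe
    fix e :: real assume "e > 0"
    \<comment> \<open>Five links of at most e1 each leave room for a strict inequality.\<close>
    define e1 where "e1 = e / 6"
    have e1: "e1 > 0" using \<open>e > 0\<close> by (simp add: e1_def)
    obtain D g where g: "\<And>d. \<exists>p q. g d \<in> E p q \<and> int p - int q = d"
      and ax: "norm (a - (\<Sum>d\<in>{- int D..int D}. g d)) < e1"
      using approximation[OF e1] by blast
    define x where "x = (\<Sum>d\<in>{- int D..int D}. g d)"
    have hg: "homogeneous d (g d)" for d using g[of d] homogeneous_E by blast
    define M where "M = real D * (\<Sum>d\<in>{- int D..int D}. norm (g d))"
    obtain N :: nat where N: "M / e1 \<le> real N" using real_arch_simple by blast
    \<comment> \<open>The Fejer mean has (N + 1)^2 terms over the divisor N + 1, which leaves one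
      factor N + 1 to compensate.\<close>
    define e2 where "e2 = e1 / (real N + 1)"
    have e2: "e2 > 0" using e1 by (simp add: e2_def)
    have "\<forall>\<^sub>F L in sequentially. \<forall>l\<in>{- int N..int N} - {0}. norm (fourier L l a) \<le> e2"
      using fourier_vanishes[OF a _ e2] by (intro eventually_ball_finite) auto
    then have "\<forall>\<^sub>F L in sequentially. D + N < L \<and> (\<forall>l\<in>{- int N..int N} - {0}. norm (fourier L l a) \<le> e2)"
      by (intro eventually_conj eventually_gt_at_top)
    then obtain L where L: "D + N < L"
      and small': "\<And>l. l \<in> {- int N..int N} - {0} \<Longrightarrow> norm (fourier L l a) \<le> e2"
      by (auto dest!: eventually_happens)
    have small: "\<And>l. \<bar>l\<bar> \<le> int N \<Longrightarrow> l \<noteq> 0 \<Longrightarrow> norm (fourier L l a) \<le> e2"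
      by (rule small') auto
    have "norm (x - fejer N L x) \<le> e1"
    proof -
      have "x - fejer N L x = (\<Sum>d\<in>{- int D..int D}. g d - fejer N L (g d))"
        by (simp add: x_def fejer_sum sum_subtractf)
      also have "norm \<dots> \<le> (\<Sum>d\<in>{- int D..int D}. real D * norm (g d) / (real N + 1))"
      proof (rule sum_norm_le)
        fix d assume d: "d \<in> {- int D..int D}"
        have "norm (g d - fejer N L (g d)) \<le> real_of_int \<bar>d\<bar> * norm (g d) / (real N + 1)"
          by (rule fejer_homogeneous[OF hg]) (use d L in auto)
        also have "\<dots> \<le> real D * norm (g d) / (real N + 1)"
          using d by (intro divide_right_mono mult_right_mono) auto
        finally show "norm (g d - fejer N L (g d)) \<le> real D * norm (g d) / (real N + 1)" .
      qed
      also have "\<dots> = M / (real N + 1)"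
        by (simp add: M_def sum_distrib_left flip: sum_divide_distrib)
      also have "\<dots> \<le> e1" using N e1 by (simp add: field_simps)
      finally show ?thesis .
    qed
    moreover have "norm (fejer N L x - fejer N L a) \<le> e1"
      using norm_fejer[of N L "x - a"] L ax by (simp add: fejer_diff x_def norm_minus_commute)
    moreover have "norm (fejer N L a - fourier L 0 a) \<le> e1"
    proof -
      have "(\<Sum>p\<le>N. \<Sum>q\<le>N. if q = p then fourier L 0 a else 0) = (real N + 1) *\<^sub>R fourier L 0 a"
        by (simp add: scaleR_conv_of_real algebra_simps)
      then have "fejer N L a - fourier L 0 a = (1 / (real N + 1)) *\<^sub>R
          (\<Sum>p\<le>N. \<Sum>q\<le>N. fourier L (int q - int p) a - (if q = p then fourier L 0 a else 0))"
        by (simp add: fejer_def sum_subtractf scaleR_diff_right add_pos_nonneg)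
      also have "norm \<dots> = (1 / (real N + 1)) * norm (\<Sum>p\<le>N. \<Sum>q\<le>N. fourier L (int q - int p) a - (if q = p then fourier L 0 a else 0))"
        by simp
      also have "\<dots> \<le> (1 / (real N + 1)) * (\<Sum>p\<le>N. \<Sum>q\<le>N. e2)"
      proof (intro mult_left_mono sum_norm_le)
        fix p q assume "p \<in> {..N}" "q \<in> {..N}"
        then show "norm (fourier L (int q - int p) a - (if q = p then fourier L 0 a else 0)) \<le> e2"
          using small[of "int q - int p"] e2 by auto
      qed simp
      also have "\<dots> = e1" 
      proof -
        have N1: "real N + 1 \<noteq> 0" by linarith
        have "(\<Sum>p\<le>N. \<Sum>q\<le>N. e2) = (real N + 1) * ((real N + 1) * e2)" by (simp add: add.commute)
        also have "(real N + 1) * e2 = e1" using N1 by (simp add: e2_def)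
        finally show ?thesis using N1 by simp
      qed
      finally show ?thesis .
    qed
    moreover have "norm (fourier L 0 a - g 0) \<le> e1"
      using fourier_approximation[OF g, of a D e1 0 L] ax L by simp
    moreover have "norm (g 0 - a) \<le> norm (a - x) + norm (x - fejer N L x) + norm (fejer N L x - fejer N L a)
        + norm (fejer N L a - fourier L 0 a) + norm (fourier L 0 a - g 0)"
    proof -
      have "a - g 0 = (a - x) + (x - fejer N L x) + (fejer N L x - fejer N L a)
        + (fejer N L a - fourier L 0 a) + (fourier L 0 a - g 0)" by simp
      then show ?thesis
        by (simp only: norm_minus_commute[of "g 0" a])
          (intro norm_triangle_le add_mono order_refl)
    qed
    ultimately have "norm (g 0 - a) < e" using ax e1 unfolding x_def[symmetric] e1_def by linarith
    moreover have "g 0 \<in> (\<Union>m. E m m)" using g[of 0] by auto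
    ultimately show "\<exists>y\<in>\<Union>m. E m m. dist y a < e" by (auto simp: dist_norm)
  qed
qed

end

subsection \<open>Common eigenvectors in the space of generators\<close>

definition coef :: "'a::cstar_algebra \<Rightarrow> complex" where
  "coef z = (THE c. z = cscale c 1)"

lemma cscale_one_inject: "cscale c (1::'a::cstar_algebra) = cscale d 1 \<longleftrightarrow> c = d"
proof
  assume "cscale c (1::'a) = cscale d 1"
  then have "norm (cscale (c - d) (1::'a)) = 0" by (simp add: cscale_diff_left)
  then show "c = d" by (simp add: norm_cscale)
qed simp

lemma coef_cscale [simp]: "coef (cscale c (1::'a::cstar_algebra)) = c"
  by (simp add: coef_def cscale_one_inject)

lemma bounded_linear_cscale_left: "bounded_linear (\<lambda>c. cscale c (x::'a::cstar_algebra))"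
proof (rule bounded_linear_intro[where K="norm x"])
  show "cscale (r *\<^sub>R c) x = r *\<^sub>R cscale c x" for r c
    by (simp add: cscale_cscale scaleR_conv_of_real[of r c] flip: cscale_of_real)
qed (auto simp: cscale_add_left norm_cscale)

text \<open>Each index contributes a disc, and the set is a continuous image of a disc times the set
  with one index fewer. This yields compact unit spheres in \<open>H 1\<close>.\<close>

lemma compact_unit_combinations:
  fixes v :: "'i \<Rightarrow> 'a::cstar_algebra"
  assumes "finite I"
  shows "compact {\<Sum>i\<in>I. cscale (c i) (v i) | c. \<forall>i\<in>I. norm (c i) \<le> 1}"
  using assms
proof induction
  case (insert j I)
  let ?K = "{\<Sum>i\<in>I. cscale (c i) (v i) | c. \<forall>i\<in>I. norm (c i) \<le> 1}"
  have "{\<Sum>i\<in>insert j I. cscale (c i) (v i) | c. \<forall>i\<in>insert j I. norm (c i) \<le> 1}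
      = (\<lambda>z. cscale (fst z) (v j) + snd z) ` (cball 0 1 \<times> ?K)" (is "?L = ?R")
  proof
    show "?L \<subseteq> ?R" using insert by (force simp: image_iff)
    show "?R \<subseteq> ?L"
    proof safe
      fix a :: complex and c :: "'i \<Rightarrow> complex" assume "a \<in> cball 0 (1::real)" "\<forall>i\<in>I. norm (c i) \<le> 1"
      moreover have "(\<Sum>i\<in>insert j I. cscale ((c(j := a)) i) (v i)) = cscale a (v j) + (\<Sum>i\<in>I. cscale (c i) (v i))"
        using insert by (auto intro!: sum.cong)
      ultimately show "\<exists>c'. cscale (fst (a, \<Sum>i\<in>I. cscale (c i) (v i))) (v j) + snd (a, \<Sum>i\<in>I. cscale (c i) (v i)) =
          (\<Sum>i\<in>insert j I. cscale (c' i) (v i)) \<and> (\<forall>i\<in>insert j I. norm (c' i) \<le> 1)"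
        by (intro exI[of _ "c(j := a)"]) auto
    qed
  qed
  moreover have "compact ?R"
    by (intro compact_continuous_image compact_Times compact_cball insert.IH continuous_on_add
        bounded_linear.continuous_on[OF bounded_linear_cscale_left] continuous_on_fst continuous_on_snd continuous_on_id)
  ultimately show ?case by simp
qed simp

context cuntz_family
begin

lemma closed_H_0: "closed (H 0)"
  unfolding closed_sequential_limits
proof (intro allI impI, elim conjE)
  fix f z assume f: "\<forall>k. f k \<in> H 0" "f \<longlonglongrightarrow> z"
  then have "\<forall>k. \<exists>c. f k = cscale c 1" by (simp add: H_0)
  then obtain c where c: "\<And>k. f k = cscale (c k) 1" by metis
  have "dist (c i) (c j) = dist (f i) (f j)" for i j
    by (simp add: c dist_norm norm_cscale flip: cscale_diff_left)
  then have "Cauchy c" using LIMSEQ_imp_Cauchy[OF f(2)] by (simp add: Cauchy_def)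
  then obtain c0 where "c \<longlonglongrightarrow> c0" using Cauchy_convergent_iff convergent_def by blast
  then have "f \<longlonglongrightarrow> cscale c0 1"
    unfolding c[abs_def] by (rule bounded_linear.tendsto[OF bounded_linear_cscale_left])
  then show "z \<in> H 0" using LIMSEQ_unique[OF f(2)] by (auto simp: H_0)
qed

lemma expand_s: "x = (\<Sum>i=1..n. s i * (cstar (s i) * x))"
  by (metis (no_types, lifting) mult.assoc mult_1 range_sum sum.cong sum_distrib_right)

lemma H_1_iff: "h \<in> H 1 \<longleftrightarrow> (\<forall>i\<in>{1..n}. cstar (s i) * h \<in> H 0)"
proof
  assume *: "\<forall>i\<in>{1..n}. cstar (s i) * h \<in> H 0"
  have "(\<Sum>i=1..n. s i * (cstar (s i) * h)) \<in> H 1"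
    using H_mult[OF s_in_H, of _ _ 0] * by (intro csubspace_sum) auto
  then show "h \<in> H 1" using expand_s[of h] by simp
qed (use cstar_H_mult[OF s_in_H, of _ _ 0] in auto)

lemma closed_H_1: "closed (H 1)"
proof -
  have "H 1 = (\<Inter>i\<in>{1..n}. (\<lambda>h. cstar (s i) * h) -` H 0)" using H_1_iff by auto
  then show ?thesis
    by (auto intro!: closed_INT continuous_closed_vimage closed_H_0 continuous_intros)
qed

lemma compact_H_1_sphere:
  assumes "closed V" "V \<subseteq> H 1"
  shows "compact {h \<in> V. norm h = 1}"
proof -
  let ?K = "{\<Sum>i\<in>{1..n}. cscale (c i) (s i) | c. \<forall>i\<in>{1..n}. norm (c i) \<le> 1}"
  have "{h \<in> V. norm h = 1} \<subseteq> ?K"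
  proof safe
    fix h assume h: "h \<in> V" "norm h = 1"
    then have "\<forall>i\<in>{1..n}. \<exists>c. cstar (s i) * h = cscale c 1" using assms(2) H_1_iff H_0 by blast
    then obtain c where c: "\<forall>i\<in>{1..n}. cstar (s i) * h = cscale (c i) 1" by metis
    have "norm (c i) \<le> 1" if "i \<in> {1..n}" for i
      using norm_mult_le[of "cstar (s i)" 1 h 1] norm_s[OF that] h(2) c that by (simp add: norm_cscale)
    moreover have "h = (\<Sum>i\<in>{1..n}. cscale (c i) (s i))"
      by (subst expand_s) (use c in \<open>auto simp: cscale_right_mult intro!: sum.cong\<close>)
    ultimately show "\<exists>c. h = (\<Sum>i\<in>{1..n}. cscale (c i) (s i)) \<and> (\<forall>i\<in>{1..n}. norm (c i) \<le> 1)" by blast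
  qed
  then have "{h \<in> V. norm h = 1} = ?K \<inter> (V \<inter> {h. norm h = 1})" by auto
  moreover have "closed (V \<inter> {h. norm h = 1})"
    by (intro closed_Int assms(1) closed_Collect_eq continuous_intros)
  ultimately show ?thesis
    using compact_Int_closed[OF compact_unit_combinations[of "{1..n}" s]] by simp
qed

lemma continuous_on_coef: "continuous_on (H 0) coef"
proof -
  have "dist (coef x) (coef y) = dist x y" if "x \<in> H 0" "y \<in> H 0" for x y
    using that by (auto simp: H_0 dist_norm norm_cscale simp flip: cscale_diff_left)
  then show ?thesis unfolding continuous_on_iff by metis
qed

lemma coef_add: "x \<in> H 0 \<Longrightarrow> y \<in> H 0 \<Longrightarrow> coef (x + y) = coef x + coef y"
  by (auto simp: H_0 simp flip: cscale_add_left)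

lemma coef_scale: "x \<in> H 0 \<Longrightarrow> coef (cscale c x) = c * coef x"
  by (auto simp: H_0 cscale_cscale)

lemma coef_H_norm: "h \<in> H m \<Longrightarrow> coef (cstar h * h) = of_real ((norm h)\<^sup>2)"
  using H_norm[of h m] by simp

text \<open>A maximizer of the Rayleigh quotient is an eigenvector.\<close>
lemma selfadj_eigenvector:
  assumes V: "csubspace V" "closed V" "V \<subseteq> H 1" "V \<noteq> {0}"
    and b: "cstar b = b" "\<And>v. v \<in> V \<Longrightarrow> b * v \<in> V"
  obtains h lam where "h \<in> V" "norm h = 1" "b * h = cscale lam h"
proof -
  let ?S = "{h \<in> V. norm h = 1}"
  define f where "f v = Re (coef (cstar v * (b * v)))" for v
  have inner: "cstar v * w \<in> H 0" if "v \<in> V" "w \<in> V" for v w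
    using cstar_H_mult[of v 1 w 0] that V(3) by auto
  have normalize: "cscale (of_real (1 / norm v)) v \<in> ?S" if "v \<in> V" "v \<noteq> 0" for v
    using that csubspace_cscale[OF V(1)] by (auto simp: norm_cscale norm_divide)
  obtain v0 where "v0 \<in> V" "v0 \<noteq> 0" using V(1,4) csubspace_0 by blast
  then have "?S \<noteq> {}" using normalize by blast
  moreover have "continuous_on ?S f"
    unfolding f_def using inner b(2)
    by (intro continuous_on_Re continuous_on_compose2[OF continuous_on_coef]) (auto intro!: continuous_intros)
  ultimately have "\<exists>h\<in>?S. \<forall>v\<in>?S. f v \<le> f h"
    by (rule continuous_attains_sup[OF compact_H_1_sphere[OF V(2,3)]])
  then obtain h where h: "h \<in> ?S" "\<And>v. v \<in> ?S \<Longrightarrow> f v \<le> f h" by blast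
  define lam where "lam = f h"
  define w where "w = cscale (of_real lam) h - b * h"
  define w' where "w' = cscale (of_real lam) w - b * w"
  have hV: "h \<in> V" and w: "w \<in> V" and w': "w' \<in> V"
    using h(1) unfolding w'_def w_def
    by (auto intro!: csubspace_diff[OF V(1)] csubspace_cscale[OF V(1)] b(2))
  have q: "Re (coef (cstar v * (cscale (of_real lam) v - b * v))) = lam * (norm v)\<^sup>2 - f v" if v: "v \<in> V" for v
  proof -
    have "cstar v * (cscale (of_real lam) v - b * v) + cstar v * (b * v) = cscale (of_real lam) (cstar v * v)"
      by (simp add: algebra_simps cscale_right_mult)
    then have "coef (cstar v * (cscale (of_real lam) v - b * v)) + coef (cstar v * (b * v)) = of_real lam * of_real ((norm v)\<^sup>2)"
      using inner[OF v] v b(2)[OF v] csubspace_diff[OF V(1) csubspace_cscale[OF V(1) v] b(2)[OF v]] V(3)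
      by (metis coef_add coef_scale coef_H_norm subsetD)
    from arg_cong[OF this, of Re] show ?thesis by (simp add: f_def)
  qed
  have f_le: "f v \<le> lam * (norm v)\<^sup>2" if v: "v \<in> V" for v
  proof (cases "v = 0")
    case False
    let ?r = "complex_of_real (1 / norm v)"
    have "cstar (cscale ?r v) * (b * cscale ?r v) = cscale (?r * ?r) (cstar v * (b * v))"
      by (simp add: cstar_cscale cscale_left_mult cscale_right_mult cscale_cscale)
    then have "f (cscale ?r v) = (1 / norm v)\<^sup>2 * f v"
      using coef_scale[OF inner[OF v b(2)[OF v]], of "?r * ?r"]
      by (simp add: f_def power2_eq_square flip: of_real_mult)
    moreover have "f (cscale ?r v) \<le> lam" unfolding lam_def by (rule h(2)[OF normalize[OF v False]])
    ultimately have "(norm v)\<^sup>2 * ((1 / norm v)\<^sup>2 * f v) \<le> (norm v)\<^sup>2 * lam"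
      by (intro mult_left_mono) auto
    then show ?thesis using False by (simp add: power_divide mult.commute)
  qed (simp add: f_def coef_cscale[of 0, simplified])
  \<comment> \<open>The form of lam - b is nonnegative on V and vanishes at h. It is evaluated at h
    + \<theta> w, where w is the residual of the eigenvalue equation; the linear term is 2 |w|^2
    because lam - b is self-adjoint.\<close>
  have "0 \<le> 2 * \<theta> * (norm w)\<^sup>2 + \<theta>\<^sup>2 * Re (coef (cstar w * w'))" for \<theta> :: real
  proof -
    define v where "v = h + cscale (of_real \<theta>) w"
    have v: "v \<in> V" unfolding v_def by (intro csubspace_add[OF V(1)] csubspace_cscale[OF V(1)] hV w)
    have hw': "cstar h * w' = cstar w * w"
      by (simp add: w'_def w_def cstar_diff cstar_mult cstar_cscale b(1) algebra_simps cscale_left_mult cscale_right_mult)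
    have vw: "cscale (of_real lam) v - b * v = w + cscale (of_real \<theta>) w'"
      by (simp add: v_def w'_def w_def cscale_add_right cscale_diff_right cscale_cscale algebra_simps cscale_right_mult)
    have expand: "cstar v * (cscale (of_real lam) v - b * v) =
        cstar h * w + (cscale (of_real (2 * \<theta>)) (cstar w * w) + cscale (of_real (\<theta>\<^sup>2)) (cstar w * w'))"
    proof -
      have "cstar v = cstar h + cscale (of_real \<theta>) (cstar w)"
        by (simp add: v_def cstar_add cstar_cscale)
      then have "cstar v * (w + cscale (of_real \<theta>) w') = cstar h * w +
          (cscale (of_real \<theta>) (cstar h * w') + cscale (of_real \<theta>) (cstar w * w) +
           cscale (of_real \<theta>) (cscale (of_real \<theta>) (cstar w * w')))"
        by (simp only: distrib_left distrib_right cscale_left_mult cscale_right_mult cscale_add_right add_ac)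
      also have "cscale (of_real \<theta>) (cstar h * w') + cscale (of_real \<theta>) (cstar w * w) =
          cscale (of_real (2 * \<theta>)) (cstar w * w)"
        by (simp only: hw' mult_2 of_real_add cscale_add_left)
      also have "cscale (of_real \<theta>) (cscale (of_real \<theta>) (cstar w * w')) = cscale (of_real (\<theta>\<^sup>2)) (cstar w * w')"
        by (simp only: cscale_cscale power2_eq_square of_real_mult)
      finally show ?thesis unfolding vw .
    qed
    have "coef (cstar v * (cscale (of_real lam) v - b * v)) = coef (cstar h * w) +
        (of_real (2 * \<theta>) * of_real ((norm w)\<^sup>2) + of_real (\<theta>\<^sup>2) * coef (cstar w * w'))"
    proof -
      have 1: "cscale (of_real (2 * \<theta>)) (cstar w * w) \<in> H 0" "cscale (of_real (\<theta>\<^sup>2)) (cstar w * w') \<in> H 0"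
        by (intro csubspace_cscale[OF csubspace_H] inner w w')+
      have "coef (cstar w * w) = of_real ((norm w)\<^sup>2)" using coef_H_norm[of w 1] w V(3) by blast
      then show ?thesis
        unfolding expand by (simp only: coef_add[OF inner[OF hV w] csubspace_add[OF csubspace_H 1]] coef_add[OF 1]
            coef_scale[OF inner[OF w w]] coef_scale[OF inner[OF w w']])
    qed
    then have "Re (coef (cstar v * (cscale (of_real lam) v - b * v))) =
        Re (coef (cstar h * w)) + (2 * \<theta> * (norm w)\<^sup>2 + \<theta>\<^sup>2 * Re (coef (cstar w * w')))"
      by (simp only: plus_complex.simps times_complex.simps Re_complex_of_real Im_complex_of_real)
    moreover have "Re (coef (cstar h * w)) = 0"
      using q[OF hV] h(1) by (simp add: w_def lam_def)
    ultimately show ?thesis using q[OF v] f_le[OF v] by simp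
  qed
  note ineq = this
  define a \<kappa> where "a = (norm w)\<^sup>2" and "\<kappa> = Re (coef (cstar w * w'))"
  \<comment> \<open>So small that at -\<theta> the negative linear term outweighs the quadratic one;
    the 1 guards against \<kappa> = 0.\<close>
  define \<theta> where "\<theta> = a / (\<bar>\<kappa>\<bar> + 1)"
  have a: "a \<ge> 0" by (simp add: a_def)
  have \<theta>: "\<theta> \<ge> 0" "\<theta> * (\<bar>\<kappa>\<bar> + 1) = a" using a by (auto simp: \<theta>_def)
  have "a = 0"
  proof (rule ccontr)
    assume "a \<noteq> 0"
    then have "\<theta> > 0" using a by (simp add: \<theta>_def)
    have "\<theta> * (2 * a) \<le> \<theta> * (\<theta> * \<kappa>)"
      using ineq[of "- \<theta>"] by (simp add: a_def \<kappa>_def power2_eq_square mult_ac)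
    then have "2 * a \<le> \<theta> * \<kappa>" using \<open>\<theta> > 0\<close> by simp
    also have "\<dots> \<le> \<theta> * (\<bar>\<kappa>\<bar> + 1)" using \<theta>(1) by (intro mult_left_mono) auto
    finally show False using \<theta>(2) a \<open>a \<noteq> 0\<close> by simp
  qed
  then have "b * h = cscale (of_real lam) h" by (simp add: a_def w_def)
  then show ?thesis using that h(1) by blast
qed

context
  fixes B :: "'a set"
  assumes selfadj: "\<And>b. b \<in> B \<Longrightarrow> cstar b = b"
    and commuting: "\<And>b b'. b \<in> B \<Longrightarrow> b' \<in> B \<Longrightarrow> b * b' = b' * b"
begin

text \<open>Commutativity makes an eigenspace of one operator invariant under all of B, so V can be
  cut down once for each member of F and stays nonzero.\<close>

lemma common_eigenspace:
  assumes "csubspace V" "closed V" "V \<subseteq> H 1" "V \<noteq> {0}" "\<And>b v. b \<in> B \<Longrightarrow> v \<in> V \<Longrightarrow> b * v \<in> V"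
    and "finite F" "F \<subseteq> B"
  shows "\<exists>V'\<subseteq>V. csubspace V' \<and> closed V' \<and> V' \<noteq> {0} \<and> (\<forall>b\<in>B. \<forall>v\<in>V'. b * v \<in> V') \<and>
     (\<forall>b\<in>F. \<exists>lam. \<forall>v\<in>V'. b * v = cscale lam v)"
  using assms(6,7)
proof induction
  case (insert c F)
  then obtain W where W: "W \<subseteq> V" "csubspace W" "closed W" "W \<noteq> {0}" "\<forall>b\<in>B. \<forall>v\<in>W. b * v \<in> W"
    "\<forall>b\<in>F. \<exists>lam. \<forall>v\<in>W. b * v = cscale lam v" by auto
  have c: "c \<in> B" using insert by simp
  obtain h lam where h: "h \<in> W" "norm h = 1" "c * h = cscale lam h"
    using selfadj_eigenvector[OF W(2,3) _ W(4) selfadj[OF c]] W(1,5) assms(3) c by blast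
  let ?W = "W \<inter> {v. c * v = cscale lam v}"
  have "csubspace ?W"
    using W(2) by (auto simp: csubspace_def distrib_left cscale_add_right cscale_right_mult cscale_cscale mult.commute)
  moreover have "closed ?W"
    by (intro closed_Int W(3) closed_Collect_eq continuous_intros)
  moreover have "h \<in> ?W" "h \<noteq> 0" using h by fastforce+
  then have "?W \<noteq> {0}" by blast
  moreover have "b * v \<in> ?W" if "b \<in> B" "v \<in> ?W" for b v
  proof -
    have "c * (b * v) = b * (c * v)" using commuting[OF that(1) c] by (metis mult.assoc)
    then show ?thesis using that W(5) by (auto simp: cscale_right_mult)
  qed
  moreover have "\<exists>\<kappa>. \<forall>v\<in>?W. b * v = cscale \<kappa> v" if "b \<in> insert c F" for b
  proof (cases "b = c")
    case False
    then show ?thesis using that W(6) by (metis IntD1 insertE)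
  qed auto
  moreover have "?W \<subseteq> V" using W(1) by auto
  ultimately show ?case by (intro exI[of _ ?W] conjI ballI)
qed (use assms in auto)

text \<open>Compactness of the unit sphere passes from finitely many operators to all of \<open>B\<close>.\<close>
lemma common_eigenvector:
  assumes V: "csubspace V" "closed V" "V \<subseteq> H 1" "V \<noteq> {0}" "\<And>b v. b \<in> B \<Longrightarrow> v \<in> V \<Longrightarrow> b * v \<in> V"
  obtains h where "h \<in> V" "norm h = 1" "\<And>b. b \<in> B \<Longrightarrow> \<exists>lam. b * h = cscale lam h"
proof -
  \<comment> \<open>Writing the eigenvalue as h^* b h removes the quantifier over eigenvalues and
    makes the condition on h visibly closed.\<close>
  let ?S = "{h \<in> V. norm h = 1}" and ?C = "\<lambda>b. {h. b * h = h * (cstar h * (b * h))}"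
  have "?S \<inter> (\<Inter>b\<in>B. ?C b) \<noteq> {}"
  proof (rule compact_imp_fip_image[OF compact_H_1_sphere[OF V(2,3)]])
    show "closed (?C b)" for b by (intro closed_Collect_eq continuous_intros)
    fix F assume F: "finite F" "F \<subseteq> B"
    obtain W where W: "W \<subseteq> V" "csubspace W" "W \<noteq> {0}" "\<forall>b\<in>F. \<exists>lam. \<forall>v\<in>W. b * v = cscale lam v"
      using common_eigenspace[OF V F] by blast
    obtain w where w: "w \<in> W" "w \<noteq> 0" using W(2,3) csubspace_0 by blast
    define h where "h = cscale (of_real (1 / norm w)) w"
    have h: "h \<in> W" "norm h = 1"
      using w csubspace_cscale[OF W(2)] by (auto simp: h_def norm_cscale norm_divide)
    then have "h \<in> H 1" using W(1) V(3) by auto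
    then have hh: "cstar h * h = 1" using H_norm[of h 1] h(2) by simp
    have "h \<in> ?C b" if b: "b \<in> F" for b
      using W(4) b h(1) by (auto simp: cscale_right_mult hh)
    then show "?S \<inter> (\<Inter>b\<in>F. ?C b) \<noteq> {}" using h W(1) by blast
  qed
  then obtain h where h: "h \<in> V" "norm h = 1" "\<And>b. b \<in> B \<Longrightarrow> b * h = h * (cstar h * (b * h))" by auto
  have "\<exists>lam. b * h = cscale lam h" if b: "b \<in> B" for b
  proof -
    have "cstar h * (b * h) \<in> H 0"
      using cstar_H_mult[of h 1 "b * h" 0] V(3) h(1) V(5)[OF b h(1)] by auto
    then show ?thesis using h(3)[OF b] by (metis H_0 cscale_right_mult mult_1_right)
  qed
  then show ?thesis using that h by blast
qed

text \<open>A maximal orthonormal system of common eigenvectors is complete; evaluating the trace of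
  the projection \<open>P\<close> shows that it has \<open>n\<close> members.\<close>
lemma eigenbasis:
  assumes BE: "B \<subseteq> E 1 1"
  obtains t where "cuntz_family n t" "\<And>i. i \<in> {1..n} \<Longrightarrow> t i \<in> H 1"
    "\<And>i b. i \<in> {1..n} \<Longrightarrow> b \<in> B \<Longrightarrow> \<exists>lam. b * t i = cscale lam (t i)"
proof -
  define good where "good k t \<longleftrightarrow> (\<forall>i\<in>{1..k}. t i \<in> H 1) \<and>
    (\<forall>i\<in>{1..k}. \<forall>j\<in>{1..k}. cstar (t i) * t j = (if i = j then 1 else 0)) \<and>
    (\<forall>i\<in>{1..k}. \<forall>b\<in>B. \<exists>lam. b * t i = cscale lam (t i))" for k :: nat and t
  define P where "P k t = (\<Sum>i=1..k. t i * cstar (t i))" for k :: nat and t :: "nat \<Rightarrow> 'a"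
  have P_t: "cstar (t j) * P k t = cstar (t j)" if "good k t" "j \<in> {1..k}" for k t j
  proof -
    have "cstar (t j) * P k t = (\<Sum>i=1..k. (cstar (t j) * t i) * cstar (t i))"
      by (simp add: P_def sum_distrib_left mult.assoc)
    also have "\<dots> = (\<Sum>i=1..k. if j = i then cstar (t i) else 0)"
      by (rule sum.cong) (use that in \<open>auto simp: good_def\<close>)
    finally show ?thesis using that by simp
  qed
  have P_norm: "norm (P k t) \<le> 1" if "good k t" for k t
  proof -
    have "P k t * P k t = P k t"
      unfolding P_def[of k t] sum_distrib_right mult.assoc
      using P_t[OF that, unfolded P_def] by simp
    moreover have "cstar (P k t) = P k t" by (simp add: P_def cstar_sum cstar_mult cstar_cstar)
    ultimately have "norm (P k t) * norm (P k t) = norm (P k t)"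
      using cstar_identity[of "P k t"] by (simp add: power2_eq_square)
    then show ?thesis by auto
  qed
  have trace: "(\<Sum>j=1..n. cstar (s j) * P k t * s j) = of_nat k" if g: "good k t" for k t
  proof -
    have "(\<Sum>j=1..n. cstar (s j) * P k t * s j) = (\<Sum>j=1..n. \<Sum>i=1..k. (cstar (s j) * t i) * (cstar (t i) * s j))"
      by (simp add: P_def sum_distrib_left sum_distrib_right mult.assoc)
    also have "\<dots> = (\<Sum>j=1..n. \<Sum>i=1..k. (cstar (t i) * s j) * (cstar (s j) * t i))"
    proof (intro sum.cong refl)
      fix i j assume "j \<in> {1..n}" "i \<in> {1..k}"
      then obtain c where c: "cstar (s j) * t i = cscale c 1"
        using H_inner[OF s_in_H, of j "t i"] g unfolding good_def by blast
      show "(cstar (s j) * t i) * (cstar (t i) * s j) = (cstar (t i) * s j) * (cstar (s j) * t i)"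
        by (simp add: c cscale_left_mult cscale_right_mult)
    qed
    also have "\<dots> = (\<Sum>i=1..k. cstar (t i) * (\<Sum>j=1..n. s j * (cstar (s j) * t i)))"
      by (subst sum.swap) (simp add: sum_distrib_left mult.assoc)
    also have "\<dots> = (\<Sum>i=1..k. 1)"
      by (rule sum.cong) (use g in \<open>auto simp only: expand_s[symmetric] good_def simp_thms if_True\<close>)
    finally show ?thesis by simp
  qed
  \<comment> \<open>The trace of P is a sum of n compressions of norm at most 1. The bound
    guarantees a system of greatest length.\<close>
  have bound: "k \<le> n" if g: "good k t" for k t
  proof -
    have "norm (of_nat k :: 'a) \<le> (\<Sum>j=1..n. norm (P k t))"
      unfolding trace[OF g, symmetric] by (intro sum_norm_le norm_contract2) (auto simp: norm_s)
    also have "\<dots> \<le> real n" using sum_bounded_above[of "{1..n}" "\<lambda>_. norm (P k t)" 1] P_norm[OF g] by simp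
    finally show ?thesis by simp
  qed
  have "\<exists>t. good 0 t" by (auto simp: good_def)
  then obtain k where k: "\<exists>t. good k t" "\<And>k'. \<exists>t. good k' t \<Longrightarrow> k' \<le> k"
    using ex_has_greatest_nat[of "\<lambda>k. \<exists>t. good k t" 0 "\<lambda>k. k" "Suc n"] bound by (metis le_imp_less_Suc)
  then obtain t where t: "good k t" by blast
  \<comment> \<open>The orthogonal complement of the eigenvectors found so far. It is invariant
    because B is self-adjoint, so if nonzero it would contribute one more.\<close>
  define V where "V = H 1 \<inter> {h. \<forall>i\<in>{1..k}. cstar (t i) * h = 0}"
  have "V = {0}"
  proof (rule ccontr)
    assume "V \<noteq> {0}"
    moreover have "csubspace V"
      unfolding V_def using csubspace_H[of 1] by (auto simp: csubspace_def distrib_left cscale_right_mult)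
    moreover have "closed V"
    proof -
      have "V = H 1 \<inter> (\<Inter>i\<in>{1..k}. {h. cstar (t i) * h = 0})" by (auto simp: V_def)
      then show ?thesis
        by (simp only:) (intro closed_Int closed_H_1 closed_INT ballI closed_Collect_eq continuous_intros)
    qed
    moreover have "b * v \<in> V" if "b \<in> B" "v \<in> V" for b v
    proof -
      have "cstar (t i) * (b * v) = 0" if i: "i \<in> {1..k}" for i
      proof -
        obtain lam where "b * t i = cscale lam (t i)" using t i \<open>b \<in> B\<close> unfolding good_def by blast
        then have "cstar (t i) * b = cscale (cnj lam) (cstar (t i))"
          by (metis cstar_cscale cstar_mult selfadj[OF \<open>b \<in> B\<close>])
        then show ?thesis using \<open>v \<in> V\<close> i by (simp add: V_def cscale_left_mult flip: mult.assoc)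
      qed
      then show ?thesis using E_H0[of b 1 1 v] BE that by (auto simp: V_def)
    qed
    moreover have "V \<subseteq> H 1" by (auto simp: V_def)
    ultimately obtain h where h: "h \<in> V" "norm h = 1" "\<And>b. b \<in> B \<Longrightarrow> \<exists>lam. b * h = cscale lam h"
      using common_eigenvector[of V] by blast
    have hH: "h \<in> H 1" and ht: "\<And>i. i \<in> {1..k} \<Longrightarrow> cstar (t i) * h = 0" using h(1) by (auto simp: V_def)
    have th: "cstar h * t i = 0" if "i \<in> {1..k}" for i
      using arg_cong[OF ht[OF that], of cstar] by (simp add: cstar_mult cstar_cstar)
    have hh: "cstar h * h = 1" using H_norm[OF hH] h(2) by simp
    have "good (Suc k) (t(Suc k := h))"
      using t hH ht th hh h(3) by (auto simp: good_def le_Suc_eq)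
    then show False using k(2)[of "Suc k"] by auto
  qed
  have "P k t * s j = s j" if j: "j \<in> {1..n}" for j
  proof -
    have "P k t * s j \<in> H 1"
    proof -
      have "t i * cstar (t i) * s j \<in> H 1" if "i \<in> {1..k}" for i
        using E_H0[OF H_cstar_H s_in_H[OF j], of "t i" 1 "t i"] t that by (auto simp: good_def)
      then show ?thesis unfolding P_def sum_distrib_right by (intro csubspace_sum csubspace_H)
    qed
    then have "s j - P k t * s j \<in> H 1" by (intro csubspace_diff[OF csubspace_H] s_in_H[OF j])
    moreover have "cstar (t i) * (s j - P k t * s j) = 0" if "i \<in> {1..k}" for i
      using P_t[OF t that] by (simp add: right_diff_distrib flip: mult.assoc)
    ultimately have "s j - P k t * s j \<in> V" unfolding V_def by blast
    then show ?thesis using \<open>V = {0}\<close> by simp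
  qed
  then have P1: "P k t = 1" using sum_s_ext[of "P k t" 1] by simp
  have "of_nat k = (\<Sum>j=1..n. cstar (s j) * s j)" using trace[OF t] by (simp add: P1)
  also have "\<dots> = (\<Sum>j=1..n. 1)" by (rule sum.cong) (auto simp: isometry)
  finally have "(of_nat k :: 'a) = of_nat n" by simp
  then have kn: "k = n" by simp
  have "cuntz_family n t"
    using t P1 by unfold_locales (auto simp: good_def P_def kn)
  then show ?thesis using that t by (auto simp: good_def kn)
qed

end

end

subsection \<open>Identification with the diagonal subalgebra\<close>

lemma star_hom_word:
  assumes "star_hom f" "\<And>i. i \<in> {1..n} \<Longrightarrow> f (v i) = v' i" "\<mu> \<in> lists {1..n}"
  shows "f (word_op v \<mu>) = word_op v' \<mu>"
  using assms(3)
  by (induction \<mu>) (auto simp: word_op_Cons star_hom_simps[OF assms(1)] assms(2))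

lemma star_hom_diag:
  assumes f: "star_hom f" "\<And>i. i \<in> {1..n} \<Longrightarrow> f (v i) = v' i"
  shows "f ` diag_alg n v \<subseteq> diag_alg n v'"
proof -
  let ?P = "\<lambda>v. {word_op v \<mu> * cstar (word_op v \<mu>) | \<mu>. \<mu> \<in> lists {1..n}}"
  have "f ` ?P v = ?P v'"
    unfolding Setcompr_eq_image image_image
    by (rule image_cong) (simp_all only: star_hom_simps[OF f(1)] star_hom_word[OF f])
  then show ?thesis using star_hom_image_generated[OF f(1), of "?P v"] unfolding diag_alg_def by (simp only:)
qed

context cuntz_family
begin

text \<open>Products, adjoints and powers are formed blockwise, so the crude count of n^m summands
  applies to all powers and \<open>norm_le_by_powers\<close> removes it. It makes taking diagonal
  parts contractive.\<close>

lemma norm_block_diagonal: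
  assumes "\<And>\<mu>. \<mu> \<in> words n m \<Longrightarrow> norm (y \<mu>) \<le> c" "c \<ge> 0"
  shows "norm (\<Sum>\<mu>\<in>words n m. S \<mu> * y \<mu> * cstar (S \<mu>)) \<le> c"
proof -
  define D where "D y = (\<Sum>\<mu>\<in>words n m. S \<mu> * y \<mu> * cstar (S \<mu>))" for y
  have D_mult: "D x * D y = D (\<lambda>\<mu>. x \<mu> * y \<mu>)" for x y
  proof -
    have "D x * D y = (\<Sum>\<mu>\<in>words n m. \<Sum>\<nu>\<in>words n m. S \<mu> * x \<mu> * (cstar (S \<mu>) * S \<nu>) * y \<nu> * cstar (S \<nu>))"
      unfolding D_def sum_product by (simp only: mult.assoc)
    also have "\<dots> = (\<Sum>\<mu>\<in>words n m. \<Sum>\<nu>\<in>words n m. if \<mu> = \<nu> then S \<mu> * x \<mu> * y \<mu> * cstar (S \<mu>) else 0)"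
      by (intro sum.cong refl) (auto simp: word_orthonormal)
    finally show ?thesis by (simp add: D_def mult.assoc)
  qed
  have D_cstar: "cstar (D y) = D (\<lambda>\<mu>. cstar (y \<mu>))" for y
    by (simp add: D_def cstar_sum cstar_mult cstar_cstar mult.assoc)
  have D_power: "D y ^ k = D (\<lambda>\<mu>. y \<mu> ^ k)" for y k
  proof (induction k)
    case 0
    show ?case using word_range_sum[of m] by (simp add: D_def)
  qed (simp add: D_mult)
  have "norm (D y) \<le> c"
  proof (rule norm_le_by_powers[where K="real (n ^ m)", OF assms(2)])
    fix r :: nat
    let ?k = "2 ^ r :: nat"
    have "norm ((cstar (D y) * D y) ^ ?k) = norm (D (\<lambda>\<mu>. (cstar (y \<mu>) * y \<mu>) ^ ?k))"
      by (simp add: D_cstar D_mult D_power)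
    also have "\<dots> \<le> (\<Sum>\<mu>\<in>words n m. (c\<^sup>2) ^ ?k)"
      unfolding D_def
    proof (rule sum_norm_le)
      fix \<mu> assume \<mu>: "\<mu> \<in> words n m"
      have "norm (S \<mu> * (cstar (y \<mu>) * y \<mu>) ^ ?k * cstar (S \<mu>)) \<le> norm ((cstar (y \<mu>) * y \<mu>) ^ ?k)"
        by (rule norm_contract2) (auto simp: norm_S[OF \<mu>])
      also have "\<dots> \<le> norm (cstar (y \<mu>) * y \<mu>) ^ ?k" by (rule norm_power_ineq)
      also have "\<dots> \<le> (c\<^sup>2) ^ ?k"
        unfolding cstar_identity using assms(1)[OF \<mu>] by (intro power_mono) auto
      finally show "norm (S \<mu> * (cstar (y \<mu>) * y \<mu>) ^ ?k * cstar (S \<mu>)) \<le> (c\<^sup>2) ^ ?k" .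
    qed
    also have "\<dots> = real (n ^ m) * (c\<^sup>2) ^ ?k" by (simp add: card_words)
    also have "\<dots> \<le> real (n ^ m) * (2 ^ r + 1) * (c\<^sup>2) ^ ?k"
      by (intro mult_right_mono) (auto simp: mult_le_cancel_left1)
    finally show "norm ((cstar (D y) * D y) ^ ?k) \<le> real (n ^ m) * (2 ^ r + 1) * (c\<^sup>2) ^ ?k" .
  qed
  then show ?thesis by (simp add: D_def)
qed

text \<open>The product is 0 or the projection of the longer word, hence self-adjoint, and taking
  its adjoint reverses the factors.\<close>

lemma range_projections_commute_le:
  assumes "\<mu> \<in> words n p" "\<nu> \<in> words n (p + q)"
  shows "(S \<mu> * cstar (S \<mu>)) * (S \<nu> * cstar (S \<nu>)) = (S \<nu> * cstar (S \<nu>)) * (S \<mu> * cstar (S \<mu>))"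
proof -
  obtain \<nu>1 \<nu>2 where \<nu>: "\<nu>1 \<in> words n p" "\<nu>2 \<in> words n q" "\<nu> = \<nu>1 @ \<nu>2"
    using words_split[OF assms(2)] .
  have "(S \<mu> * cstar (S \<mu>)) * (S \<nu> * cstar (S \<nu>)) = S \<mu> * (cstar (S \<mu>) * S \<nu>1) * S \<nu>2 * cstar (S \<nu>)"
    by (simp add: \<nu> word_op_append mult.assoc)
  also have "\<dots> = (if \<mu> = \<nu>1 then S \<nu> * cstar (S \<nu>) else 0)"
    by (simp add: word_orthonormal[OF assms(1) \<nu>(1)]) (simp add: \<nu> word_op_append)
  finally have eq: "(S \<mu> * cstar (S \<mu>)) * (S \<nu> * cstar (S \<nu>)) = (if \<mu> = \<nu>1 then S \<nu> * cstar (S \<nu>) else 0)" .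
  have "(S \<nu> * cstar (S \<nu>)) * (S \<mu> * cstar (S \<mu>)) = cstar ((S \<mu> * cstar (S \<mu>)) * (S \<nu> * cstar (S \<nu>)))"
    by (simp add: cstar_mult cstar_cstar mult.assoc)
  also have "\<dots> = (S \<mu> * cstar (S \<mu>)) * (S \<nu> * cstar (S \<nu>))"
    unfolding eq by (simp add: cstar_mult cstar_cstar)
  finally show ?thesis by simp
qed

lemma diag_alg_abelian: "abelian_set (diag_alg n s)"
  unfolding diag_alg_def
proof (rule abelian_generated)
  let ?P = "{S \<mu> * cstar (S \<mu>) | \<mu>. \<mu> \<in> lists {1..n}}"
  show "cstar ` ?P \<subseteq> ?P" by (auto simp: cstar_mult cstar_cstar)
  have "(S \<mu> * cstar (S \<mu>)) * (S \<nu> * cstar (S \<nu>)) = (S \<nu> * cstar (S \<nu>)) * (S \<mu> * cstar (S \<mu>))"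
    if "\<mu> \<in> lists {1..n}" "\<nu> \<in> lists {1..n}" for \<mu> \<nu>
  proof (cases "length \<mu> \<le> length \<nu>")
    case True
    then show ?thesis
      using range_projections_commute_le[of \<mu> "length \<mu>" \<nu> "length \<nu> - length \<mu>"] that by (simp add: words_def)
  next
    case False
    then show ?thesis
      using range_projections_commute_le[of \<nu> "length \<nu>" \<mu> "length \<mu> - length \<nu>"] that by (simp add: words_def)
  qed
  then show "abelian_set ?P" unfolding abelian_set_def by blast
qed

end

section \<open>Vanishing of the off-diagonal entries of A\<close>

context shift_invariant_masa
begin

lemma s1_power: "s 1 ^ r \<in> H r" "norm (s 1 ^ r) = 1" "cstar (s 1 ^ r) * s 1 ^ r = 1"
proof -
  have 1: "1 \<in> {1..n}" using n2 by auto
  show H: "s 1 ^ r \<in> H r"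
  proof (induction r)
    case (Suc r)
    then show ?case using H_mult[OF s_in_H[OF 1] Suc] by simp
  qed (auto simp: H_0 intro: exI[of _ 1])
  show iso: "cstar (s 1 ^ r) * s 1 ^ r = 1"
  proof (induction r)
    case (Suc r)
    have "cstar (s 1 ^ Suc r) * s 1 ^ Suc r = cstar (s 1 ^ r) * (cstar (s 1) * s 1) * s 1 ^ r"
      by (simp add: cstar_mult mult.assoc)
    then show ?case using Suc isometry[OF 1] by simp
  qed simp
  show "norm (s 1 ^ r) = 1" by (rule isometry_norm[OF iso])
qed

text \<open>This limit is the value at \<open>z\<close> of a pure state of the core.\<close>
lemma core_limit:
  assumes z: "z \<in> core"
  obtains c where "(\<lambda>r. cstar (s 1 ^ r) * z * s 1 ^ r) \<longlonglongrightarrow> cscale c 1"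
proof -
  define f where "f r = cstar (s 1 ^ r) * z * s 1 ^ r" for r
  have approx: "\<exists>c m. \<forall>r\<ge>m. norm (f r - cscale c 1) < e" if "e > 0" for e
  proof -
    obtain x m where x: "x \<in> E m m" "norm (x - z) < e"
      using z \<open>e > 0\<close> unfolding core_def closure_approachable dist_norm by blast
    obtain c where c: "cstar (s 1 ^ m) * x * s 1 ^ m = cscale c 1"
      using inner_E_H[of _ m x 0, OF s1_power(1) _ s1_power(1)] x(1) by (auto simp: H_0)
    have "norm (f r - cscale c 1) < e" if "m \<le> r" for r
    proof -
      obtain j where r: "r = m + j" using \<open>m \<le> r\<close> le_Suc_ex by blast
      have "cstar (s 1 ^ r) * x * s 1 ^ r = cstar (s 1 ^ j) * (cstar (s 1 ^ m) * x * s 1 ^ m) * s 1 ^ j"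
        by (simp add: r power_add cstar_mult mult.assoc)
      also have "\<dots> = cscale c 1"
        unfolding c by (simp add: cscale_left_mult cscale_right_mult s1_power del: One_nat_def)
      finally have "f r - cscale c 1 = cstar (s 1 ^ r) * (z - x) * s 1 ^ r"
        by (simp add: f_def algebra_simps)
      also have "norm \<dots> \<le> norm (z - x)" by (rule norm_contract2) (auto simp: s1_power simp del: One_nat_def)
      finally show ?thesis using x(2) by (simp add: norm_minus_commute)
    qed
    then show ?thesis by blast
  qed
  have "Cauchy f"
    unfolding Cauchy_def
  proof (intro allI impI)
    fix e :: real assume "e > 0"
    then obtain c m where m: "\<forall>r\<ge>m. norm (f r - cscale c 1) < e / 2" using approx[of "e / 2"] by auto
    then have "dist (f i) (f j) < e" if "i \<ge> m" "j \<ge> m" for i j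
      using that dist_triangle_half_l[of "f i" "cscale c 1" e "f j"] by (simp add: dist_norm)
    then show "\<exists>M. \<forall>i\<ge>M. \<forall>j\<ge>M. dist (f i) (f j) < e" by blast
  qed
  then obtain y where y: "f \<longlonglongrightarrow> y" using Cauchy_convergent_iff convergent_def by blast
  have "y \<in> closure (H 0)"
    unfolding closure_approachable
  proof (intro allI impI)
    fix e :: real assume "e > 0"
    then obtain c m where m: "\<forall>r\<ge>m. norm (f r - cscale c 1) < e / 2" using approx[of "e / 2"] by auto
    have "norm (y - cscale c 1) \<le> e / 2"
      using m by (intro LIMSEQ_le_const2[OF tendsto_norm[OF tendsto_diff[OF y tendsto_const]]])
        (auto intro!: exI[of _ m] less_imp_le)
    then show "\<exists>w\<in>H 0. dist w y < e"
      using \<open>e > 0\<close> by (intro bexI[of _ "cscale c 1"]) (auto simp: H_0 dist_norm norm_minus_commute)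
  qed
  then have "y \<in> H 0" using closed_H_0 by simp
  then show ?thesis using that y unfolding f_def by (auto simp: H_0)
qed

text \<open>\<open>eigenbasis\<close> speaks of self-adjoint operators. The elements b + b^* and i
  (b - b^* ) are such and stay in A and in \<open>E 1 1\<close>, so the eigenvector property extends
  to all b.\<close>

lemma level_one_eigenvector:
  assumes eig: "\<And>b. b \<in> A \<inter> E 1 1 \<Longrightarrow> cstar b = b \<Longrightarrow> \<exists>c. b * h = cscale c h"
    and b: "b \<in> A \<inter> E 1 1"
  obtains c where "b * h = cscale c h"
proof -
  note sub = csubspace_E[of 1 1] cstar_subalgebra_imp_csubspace[OF A_subalgebra]
  have bs: "cstar b \<in> A" "cstar b \<in> E 1 1" using b A_cstar E_cstar by auto
  have "\<exists>c. (b + cstar b) * h = cscale c h"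
    using b bs by (intro eig) (auto simp: cstar_add cstar_cstar add.commute intro: csubspace_add sub)
  moreover have "\<exists>c. cscale \<i> (b - cstar b) * h = cscale c h"
  proof (rule eig)
    show "cscale \<i> (b - cstar b) \<in> A \<inter> E 1 1"
      using b bs by (intro IntI csubspace_cscale csubspace_diff sub) auto
  qed (simp add: cstar_cscale cstar_diff cstar_cstar cscale_minus_left cscale_diff_right)
  ultimately obtain c d where cd: "(b + cstar b) * h = cscale c h" "cscale \<i> (b - cstar b) * h = cscale d h"
    by blast
  have "b = cscale (1/2) ((b + cstar b) + cscale (-\<i>) (cscale \<i> (b - cstar b)))"
    by (simp add: cscale_cscale) (simp add: cscale_cscale flip: cscale_add_left[of 1 1, simplified])
  then have "b * h = cscale (1/2) (cscale c h + cscale (-\<i>) (cscale d h))"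
    by (metis cd cscale_left_mult distrib_right)
  then show ?thesis using that by (simp only: cscale_cscale cscale_add_left[symmetric])
qed

end

locale diagonalized_masa = shift_invariant_masa n s omega A + t: cuntz_family n t
  for n and s :: "nat \<Rightarrow> 'a::cstar_algebra" and omega A and t :: "nat \<Rightarrow> 'a" +
  assumes t_H: "i \<in> {1..n} \<Longrightarrow> t i \<in> H 1"
    and t_eigen: "i \<in> {1..n} \<Longrightarrow> b \<in> A \<inter> E 1 1 \<Longrightarrow> \<exists>c. b * t i = cscale c (t i)"
begin

lemma level_one_offdiagonal:
  assumes "b \<in> A \<inter> E 1 1" "i \<in> {1..n}" "j \<in> {1..n}" "i \<noteq> j"
  shows "cstar (t i) * b * t j = 0"
proof -
  obtain c where "b * t j = cscale c (t j)" using t_eigen assms by blast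
  then show ?thesis using t.orthonormal[OF assms(2,3)] assms(4) by (simp add: mult.assoc cscale_right_mult)
qed

text \<open>Compressing \<open>y\<close> by \<open>\<sigma>(\<xi> s\<^sub>1\<^sup>r)\<close> and \<open>\<sigma>(\<eta> s\<^sub>1\<^sup>r)\<close> stays inside \<open>A\<close> and, as \<open>r\<close> grows, slices the tail
  of the tensor factorization of the core off, leaving an element of \<open>A \<inter> E 1 1\<close>.\<close>
lemma slice_offdiagonal:
  assumes y: "y \<in> A" and ij: "i \<in> {1..n}" "j \<in> {1..n}" "i \<noteq> j" and \<xi>: "\<xi> \<in> H m" "\<eta> \<in> H m"
  shows "(\<lambda>r. cstar (s 1 ^ r) * (cstar \<xi> * (cstar (t i) * y * t j) * \<eta>) * s 1 ^ r) \<longlonglongrightarrow> 0"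
proof -
  define w where "w k l r = cstar (s 1 ^ r) * (cstar \<xi> * (cstar (t k) * y * t l) * \<eta>) * s 1 ^ r" for k l r
  have "\<forall>k\<in>{1..n}. \<forall>l\<in>{1..n}. \<exists>c. w k l \<longlonglongrightarrow> cscale c 1"
  proof (intro ballI)
    fix k l assume "k \<in> {1..n}" "l \<in> {1..n}"
    then have "cstar \<xi> * (cstar (t k) * y * t l) * \<eta> \<in> core"
      using A_subset_core compression_in_A[OF compression_in_A[OF y t_H t_H] \<xi>] by blast
    then show "\<exists>c. w k l \<longlonglongrightarrow> cscale c 1" unfolding w_def by (rule core_limit) blast
  qed
  then obtain c where c: "\<And>k l. k \<in> {1..n} \<Longrightarrow> l \<in> {1..n} \<Longrightarrow> w k l \<longlonglongrightarrow> cscale (c k l) 1" by metis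
  \<comment> \<open>An element of A whose entries in the basis t are the w k l r: since
    \<open>\<sigma> x * t l = t l * x\<close>, the vectors t move inside, next to y. The limit Z has
    scalar entries and so lies in \<open>E 1 1\<close>.\<close>
  define z where "z r = cstar (\<sigma> (\<xi> * s 1 ^ r)) * y * \<sigma> (\<eta> * s 1 ^ r)" for r
  have zA: "z r \<in> A" for r
    unfolding z_def by (rule shifted_compression_in_A[OF y, of _ "m + r"]) (intro H_mult \<xi> s1_power)+
  have tz: "cstar (t k) * z r * t l = w k l r" if "k \<in> {1..n}" "l \<in> {1..n}" for k l r
  proof -
    have 1: "\<sigma> x * t l = t l * x" if "l \<in> {1..n}" for x l using \<sigma>_pow_H[OF t_H[OF that]] by simp
    have 2: "cstar (t k) * cstar (\<sigma> x) = cstar x * cstar (t k)" for x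
      using arg_cong[OF 1[OF that(1), of x], of cstar] by (simp add: cstar_mult)
    have "cstar (t k) * z r * t l = (cstar (t k) * cstar (\<sigma> (\<xi> * s 1 ^ r))) * y * (\<sigma> (\<eta> * s 1 ^ r) * t l)"
      by (simp add: z_def mult.assoc)
    also have "\<dots> = cstar (\<xi> * s 1 ^ r) * cstar (t k) * y * (t l * (\<eta> * s 1 ^ r))"
      by (simp only: 1[OF that(2)] 2)
    finally show ?thesis by (simp add: w_def cstar_mult mult.assoc)
  qed
  define Z where "Z = (\<Sum>k=1..n. \<Sum>l=1..n. t k * cscale (c k l) 1 * cstar (t l))"
  have "z r = (\<Sum>k=1..n. \<Sum>l=1..n. t k * w k l r * cstar (t l))" for r
  proof -
    have "z r = (\<Sum>k=1..n. t k * cstar (t k)) * z r * (\<Sum>l=1..n. t l * cstar (t l))"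
      by (simp only: t.range_sum mult_1 mult_1_right)
    also have "\<dots> = (\<Sum>k=1..n. \<Sum>l=1..n. t k * (cstar (t k) * z r * t l) * cstar (t l))"
      unfolding sum_distrib_right by (simp only: sum_distrib_left mult.assoc)
    also have "\<dots> = (\<Sum>k=1..n. \<Sum>l=1..n. t k * w k l r * cstar (t l))"
      by (intro sum.cong refl) (simp only: tz)
    finally show ?thesis .
  qed
  moreover have "(\<lambda>r. \<Sum>k=1..n. \<Sum>l=1..n. t k * w k l r * cstar (t l)) \<longlonglongrightarrow> Z"
    unfolding Z_def by (intro tendsto_sum tendsto_mult tendsto_const c)
  ultimately have zZ: "z \<longlonglongrightarrow> Z" by presburger
  then have "Z \<in> A" using A_closed zA by (meson closed_sequential_limits)
  moreover have "Z \<in> E 1 1"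
    unfolding Z_def
  proof (intro csubspace_sum csubspace_E)
    fix k l assume kl: "k \<in> {1..n}" "l \<in> {1..n}"
    have "t k * cscale (c k l) 1 * cstar (t l) = cscale (c k l) (t k * cstar (t l))"
      by (simp add: cscale_left_mult cscale_right_mult)
    then show "t k * cscale (c k l) 1 * cstar (t l) \<in> E 1 1"
      using csubspace_cscale[OF csubspace_E H_cstar_H[OF t_H[OF kl(1)] t_H[OF kl(2)]]] by (simp only:)
  qed
  ultimately have "cstar (t i) * Z * t j = 0" by (intro level_one_offdiagonal ij) auto
  moreover have "(\<lambda>r. cstar (t i) * z r * t j) \<longlonglongrightarrow> cstar (t i) * Z * t j"
    by (intro tendsto_mult tendsto_const zZ)
  ultimately show ?thesis using tz[OF ij(1,2)] by (simp add: w_def)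
qed

text \<open>Let x in \<open>E m m\<close> approximate the entry. Each compression of x is a scalar
  within e/2 of the slices of the entry, which tend to 0 by \<open>slice_offdiagonal\<close>. So all
  compressions of x are small, and \<open>norm_E_le\<close> makes x small.\<close>

lemma offdiagonal:
  assumes y: "y \<in> A" and ij: "i \<in> {1..n}" "j \<in> {1..n}" "i \<noteq> j"
  shows "cstar (t i) * y * t j = 0"
proof -
  let ?y = "cstar (t i) * y * t j"
  have "?y \<in> core" using A_subset_core compression_in_A[OF y t_H t_H] ij by blast
  have "norm ?y \<le> e" if "e > 0" for e
  proof -
    have "e / 2 > 0" using that by simp
    then obtain x m where x: "x \<in> E m m" "norm (x - ?y) < e / 2"
      using \<open>?y \<in> core\<close> unfolding core_def closure_approachable dist_norm by blast
    have "norm x \<le> e / 2"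
    proof (rule norm_E_le[OF x(1)])
      fix \<xi> \<eta> assume *: "\<xi> \<in> H m" "\<eta> \<in> H m" "norm \<xi> = 1" "norm \<eta> = 1"
      obtain c where c: "cstar \<xi> * x * \<eta> = cscale c 1"
        using inner_E_H[of \<xi> m x 0 \<eta>] * x(1) by (auto simp: H_0)
      have le: "norm (cstar (s 1 ^ r) * (cstar \<xi> * ?y * \<eta>) * s 1 ^ r - cscale c 1) \<le> e / 2" for r
      proof -
        have "cscale c 1 = cstar (s 1 ^ r) * (cstar \<xi> * x * \<eta>) * s 1 ^ r"
          by (simp add: c cscale_left_mult cscale_right_mult s1_power del: One_nat_def)
        then have "cstar (s 1 ^ r) * (cstar \<xi> * ?y * \<eta>) * s 1 ^ r - cscale c 1
            = cstar (s 1 ^ r) * (cstar \<xi> * (?y - x) * \<eta>) * s 1 ^ r"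
          by (simp only: left_diff_distrib right_diff_distrib)
        also have "norm \<dots> \<le> norm (cstar \<xi> * (?y - x) * \<eta>)" by (rule norm_contract2) (auto simp: s1_power simp del: One_nat_def)
        also have "\<dots> \<le> norm (?y - x)" by (rule norm_contract2) (auto simp: *)
        finally show ?thesis using x(2) by (simp add: norm_minus_commute)
      qed
      have "norm (0 - cscale c (1::'a)) \<le> e / 2"
        by (rule LIMSEQ_le_const2[OF tendsto_norm[OF tendsto_diff[OF slice_offdiagonal[OF y ij *(1,2)] tendsto_const]]])
          (use le in auto)
      then show "norm (cstar \<xi> * x * \<eta>) \<le> e / 2" by (simp add: c)
    qed (use that in simp)
    then show ?thesis using norm_triangle_ineq4[of x "x - ?y"] x(2) by simp
  qed
  then have "norm ?y \<le> 0" by (rule field_le_epsilon) simp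
  then show ?thesis by simp
qed

text \<open>Distinct first letters give 0 by \<open>offdiagonal\<close>; equal ones replace b by
  t_i^* b t_i, which is again in A, and the remaining words are shorter.\<close>

lemma word_offdiagonal:
  assumes "b \<in> A" "\<mu> \<in> words n m" "\<nu> \<in> words n m" "\<mu> \<noteq> \<nu>"
  shows "cstar (t.S \<mu>) * b * t.S \<nu> = 0"
  using assms
proof (induction m arbitrary: b \<mu> \<nu>)
  case (Suc m)
  from Suc.prems(2,3) obtain i \<mu>' j \<nu>' where *: "\<mu> = i # \<mu>'" "\<nu> = j # \<nu>'"
    "i \<in> {1..n}" "j \<in> {1..n}" "\<mu>' \<in> words n m" "\<nu>' \<in> words n m" by (auto simp: words_Suc)
  have eq: "cstar (t.S \<mu>) * b * t.S \<nu> = cstar (t.S \<mu>') * (cstar (t i) * b * t j) * t.S \<nu>'"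
    by (simp add: * word_op_Cons cstar_mult mult.assoc)
  show ?case
  proof (cases "i = j")
    case True
    then show ?thesis
      using Suc.IH[OF compression_in_A[OF Suc.prems(1) t_H t_H] *(5,6), of i i] * Suc.prems(4) eq by auto
  qed (simp add: eq offdiagonal[OF Suc.prems(1) *(3,4)])
qed auto

lemma t_word_H: "\<mu> \<in> words n m \<Longrightarrow> t.S \<mu> \<in> H m"
proof (induction m arbitrary: \<mu>)
  case 0
  then show ?case by (auto simp: H_0 intro: exI[of _ 1])
next
  case (Suc m)
  then obtain i \<nu> where *: "\<mu> = i # \<nu>" "i \<in> {1..n}" "\<nu> \<in> words n m" by (auto simp: words_Suc)
  show ?case using H_mult[OF t_H[OF *(2)] Suc.IH[OF *(3)]] by (simp add: * word_op_Cons)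
qed

text \<open>b equals its own diagonal part with respect to words in t of any length m. The diagonal
  part of an approximant x in \<open>E m m\<close> has scalar entries, so it lies in the diagonal
  algebra, and it is as close to b as x is.\<close>

lemma A_subset_diag: "A \<subseteq> diag_alg n t"
proof
  fix b assume b: "b \<in> A"
  have D: "cstar_subalgebra (diag_alg n t)" unfolding diag_alg_def by (rule cstar_subalgebra_generated)
  have "b \<in> closure (diag_alg n t)"
    unfolding closure_approachable
  proof (intro allI impI)
    fix e :: real assume "e > 0"
    obtain x m where x: "x \<in> E m m" "norm (x - b) < e"
      using subsetD[OF A_subset_core b] \<open>e > 0\<close> unfolding core_def closure_approachable dist_norm by blast
    define d where "d = (\<Sum>\<mu>\<in>words n m. t.S \<mu> * (cstar (t.S \<mu>) * x * t.S \<mu>) * cstar (t.S \<mu>))"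
    have "d \<in> diag_alg n t"
      unfolding d_def
    proof (rule cstar_subalgebra_sum[OF D])
      fix \<mu> assume \<mu>: "\<mu> \<in> words n m"
      obtain c where c: "cstar (t.S \<mu>) * x * t.S \<mu> = cscale c 1"
        using inner_E_H[of _ m x 0, OF t_word_H[OF \<mu>] _ t_word_H[OF \<mu>]] x(1) by (auto simp: H_0)
      have "t.S \<mu> * cstar (t.S \<mu>) \<in> diag_alg n t"
        unfolding diag_alg_def using \<mu> by (intro subsetD[OF cstar_generated_superset]) (auto simp: words_def)
      then show "t.S \<mu> * (cstar (t.S \<mu>) * x * t.S \<mu>) * cstar (t.S \<mu>) \<in> diag_alg n t"
        using D by (simp add: c cscale_left_mult cscale_right_mult cstar_subalgebra_def)
    qed
    moreover have "b = (\<Sum>\<mu>\<in>words n m. t.S \<mu> * (cstar (t.S \<mu>) * b * t.S \<mu>) * cstar (t.S \<mu>))"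
    proof -
      have "b = (\<Sum>\<mu>\<in>words n m. t.S \<mu> * cstar (t.S \<mu>)) * b * (\<Sum>\<nu>\<in>words n m. t.S \<nu> * cstar (t.S \<nu>))"
        by (simp add: t.word_range_sum)
      also have "\<dots> = (\<Sum>\<mu>\<in>words n m. \<Sum>\<nu>\<in>words n m. t.S \<mu> * (cstar (t.S \<mu>) * b * t.S \<nu>) * cstar (t.S \<nu>))"
        unfolding sum_distrib_right by (simp only: sum_distrib_left mult.assoc)
      also have "\<dots> = (\<Sum>\<mu>\<in>words n m. \<Sum>\<nu>\<in>words n m.
          if \<mu> = \<nu> then t.S \<mu> * (cstar (t.S \<mu>) * b * t.S \<mu>) * cstar (t.S \<mu>) else 0)"
        by (intro sum.cong refl) (auto simp: word_offdiagonal[OF b])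
      finally show ?thesis by simp
    qed
    then have "b - d = (\<Sum>\<mu>\<in>words n m. t.S \<mu> * (cstar (t.S \<mu>) * (b - x) * t.S \<mu>) * cstar (t.S \<mu>))"
      by (simp add: d_def algebra_simps sum_subtractf)
    then have "norm (b - d) \<le> norm (b - x)"
      using t.norm_S by (auto intro!: t.norm_block_diagonal norm_contract2)
    ultimately show "\<exists>d\<in>diag_alg n t. dist d b < e"
      using x(2) by (intro bexI[of _ d]) (auto simp: dist_norm norm_minus_commute)
  qed
  then show "b \<in> diag_alg n t" using D by (simp add: cstar_subalgebra_def)
qed

lemma A_eq_diag: "A = diag_alg n t"
proof -
  have "cstar_subalgebra (diag_alg n t)" unfolding diag_alg_def by (rule cstar_subalgebra_generated)
  then show ?thesis
    using A_subset_diag t.diag_alg_abelian masa unfolding maximal_abelian_def by blast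
qed

end

lemma (in shift_invariant_masa) diagonalization:
  obtains t where "diagonalized_masa n s omega A t"
proof -
  let ?B = "{b \<in> A \<inter> E 1 1. cstar b = b}"
  obtain t where t: "cuntz_family n t" "\<And>i. i \<in> {1..n} \<Longrightarrow> t i \<in> H 1"
    "\<And>i b. i \<in> {1..n} \<Longrightarrow> b \<in> ?B \<Longrightarrow> \<exists>c. b * t i = cscale c (t i)"
    using eigenbasis[of ?B] A_commute by blast
  interpret t: cuntz_family n t by fact
  have "diagonalized_masa n s omega A t"
  proof unfold_locales
    show "\<exists>c. b * t i = cscale c (t i)" if "i \<in> {1..n}" "b \<in> A \<inter> E 1 1" for i b
      using level_one_eigenvector[of "t i" b] t(3)[OF that(1)] that(2) by blast
  qed (use t(2) in auto)
  then show ?thesis using that by blast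
qed

section \<open>The diagonalizing unitary and its automorphism\<close>

context diagonalized_masa
begin

text \<open>As t_i^* is the sum over j of (t_i^* s_j) s_j^*, these are the coefficients of the sum
  of all s_i t_i^* in terms of the s_i s_j^*.\<close>

definition coordinate :: "nat \<Rightarrow> nat \<Rightarrow> complex" where
  "coordinate i j = coef (cstar (t i) * s j)"

lemma coordinate: "i \<in> {1..n} \<Longrightarrow> j \<in> {1..n} \<Longrightarrow> cscale (coordinate i j) 1 = cstar (t i) * s j"
  using H_inner[OF t_H s_in_H, of i j] unfolding coordinate_def by fastforce

lemma coordinate_cnj: "i \<in> {1..n} \<Longrightarrow> j \<in> {1..n} \<Longrightarrow> cscale (cnj (coordinate i j)) 1 = cstar (s j) * t i"
  using arg_cong[OF coordinate, of i j cstar] by (simp add: cstar_cscale cstar_mult cstar_cstar)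

lemma unitary_coordinate: "unitary_mat n coordinate"
  unfolding unitary_mat_def
proof (intro conjI ballI)
  fix i j assume ij: "i \<in> {1..n}" "j \<in> {1..n}"
  have "cscale (\<Sum>k=1..n. coordinate i k * cnj (coordinate j k)) (1::'a) =
      (\<Sum>k=1..n. cscale (coordinate i k) 1 * cscale (cnj (coordinate j k)) 1)"
    by (simp add: cscale_sum_left cscale_left_mult cscale_cscale)
  also have "\<dots> = (\<Sum>k=1..n. cstar (t i) * s k * (cstar (s k) * t j))"
    by (intro sum.cong refl) (simp only: coordinate coordinate_cnj ij)
  also have "\<dots> = cstar (t i) * (\<Sum>k=1..n. s k * cstar (s k)) * t j"
    by (simp add: sum_distrib_left sum_distrib_right mult.assoc)
  also have "\<dots> = cscale (if i = j then 1 else 0) 1"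
    using t.orthonormal[OF ij] by (simp only: range_sum mult_1_right) simp
  finally show "(\<Sum>k=1..n. coordinate i k * cnj (coordinate j k)) = (if i = j then 1 else 0)"
    by (simp only: cscale_one_inject)
  have "cscale (\<Sum>k=1..n. cnj (coordinate k i) * coordinate k j) (1::'a) =
      (\<Sum>k=1..n. cscale (cnj (coordinate k i)) 1 * cscale (coordinate k j) 1)"
    by (simp add: cscale_sum_left cscale_left_mult cscale_cscale)
  also have "\<dots> = (\<Sum>k=1..n. cstar (s i) * t k * (cstar (t k) * s j))"
    by (intro sum.cong refl) (simp only: coordinate coordinate_cnj ij)
  also have "\<dots> = cstar (s i) * (\<Sum>k=1..n. t k * cstar (t k)) * s j"
    by (simp add: sum_distrib_left sum_distrib_right mult.assoc)
  also have "\<dots> = cscale (if i = j then 1 else 0) 1"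
    using orthonormal[OF ij] by (simp only: t.range_sum mult_1_right) simp
  finally show "(\<Sum>k=1..n. cnj (coordinate k i) * coordinate k j) = (if i = j then 1 else 0)"
    by (simp only: cscale_one_inject)
qed

definition U :: 'a where "U = (\<Sum>i=1..n. s i * cstar (t i))"

lemma U_t: "i \<in> {1..n} \<Longrightarrow> U * t i = s i"
proof -
  assume i: "i \<in> {1..n}"
  have "U * t i = (\<Sum>k=1..n. s k * (cstar (t k) * t i))" by (simp add: U_def sum_distrib_right mult.assoc)
  also have "\<dots> = (\<Sum>k=1..n. if i = k then s k else 0)" by (rule sum.cong) (use i t.orthonormal in auto)
  finally show ?thesis using i by simp
qed

lemma U_mat: "mat_unitary_elem n s coordinate = U"
proof -
  have "mat_unitary_elem n s coordinate = (\<Sum>i=1..n. \<Sum>j=1..n. s i * (cscale (coordinate i j) 1 * cstar (s j)))"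
    by (simp add: mat_unitary_elem_def cscale_left_mult cscale_right_mult)
  also have "\<dots> = (\<Sum>i=1..n. \<Sum>j=1..n. s i * (cstar (t i) * s j * cstar (s j)))"
    by (intro sum.cong refl) (simp only: coordinate)
  also have "\<dots> = (\<Sum>i=1..n. s i * cstar (t i)) * (\<Sum>j=1..n. s j * cstar (s j))"
    by (simp add: sum_product mult.assoc)
  finally show ?thesis by (simp only: range_sum mult_1_right U_def)
qed

lemma U_unitary: "cstar U * U = 1" "U * cstar U = 1" and U_E: "U \<in> E 1 1"
proof -
  have cU: "cstar U = (\<Sum>i=1..n. t i * cstar (s i))" by (simp add: U_def cstar_sum cstar_mult cstar_cstar)
  have "U * cstar U = (\<Sum>i=1..n. (U * t i) * cstar (s i))"
    by (simp add: cU sum_distrib_left mult.assoc)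
  also have "\<dots> = (\<Sum>i=1..n. s i * cstar (s i))" by (intro sum.cong refl) (simp only: U_t)
  finally show "U * cstar U = 1" by (simp only: range_sum)
  have "cstar U * s k = t k" if k: "k \<in> {1..n}" for k
  proof -
    have "cstar U * s k = (\<Sum>i=1..n. t i * (cstar (s i) * s k))" by (simp add: cU sum_distrib_right mult.assoc)
    also have "\<dots> = (\<Sum>i=1..n. if k = i then t i else 0)" by (rule sum.cong) (use k orthonormal in auto)
    finally show ?thesis using k by simp
  qed
  then have "cstar U * U = (\<Sum>i=1..n. t i * cstar (t i))"
    unfolding U_def[of] sum_distrib_left by (intro sum.cong refl) (simp flip: mult.assoc U_def)
  then show "cstar U * U = 1" by (simp only: t.range_sum)
  show "U \<in> E 1 1" unfolding U_def by (intro csubspace_sum csubspace_E H_cstar_H s_in_H t_H)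
qed

lemma quasi_free_t:
  assumes \<alpha>: "star_hom \<alpha>" "\<And>i. i \<in> {1..n} \<Longrightarrow> \<alpha> (s i) = U * s i" and i: "i \<in> {1..n}"
  shows "\<alpha> (t i) = s i"
proof -
  have "H 1 \<subseteq> {x. \<alpha> x = U * x}"
    unfolding H_def by (rule cspan_minimal) (auto simp: csubspace_def star_hom_simps[OF \<alpha>(1)]
      linear_0[OF star_hom_linear[OF \<alpha>(1)]] distrib_left cscale_right_mult words_Suc word_op_Cons \<alpha>(2))
  then show ?thesis using t_H[OF i] U_t[OF i] by auto
qed

context
  fixes \<alpha>
  assumes \<alpha>: "star_hom \<alpha>" and \<alpha>_s: "\<And>i. i \<in> {1..n} \<Longrightarrow> \<alpha> (s i) = U * s i"
begin

text \<open>U has degree 0 and is therefore fixed by the gauge action, so both compositions agree on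
  the generators.\<close>

lemma quasi_free_omega:
  assumes z: "norm z = 1"
  shows "\<alpha> \<circ> omega z = omega z \<circ> \<alpha>"
proof (rule star_homs_eq_on_generators[OF _ _ generates])
  note \<omega> = star_hom_omega[OF z]
  show "star_hom (\<alpha> \<circ> omega z)" "star_hom (omega z \<circ> \<alpha>)" by (intro star_hom_compose \<alpha> \<omega>)+
  have "z \<noteq> 0" using z by auto
  then have "cis (Arg z) = z" using z cis_Arg[of z] by (simp add: sgn_div_norm)
  then have "omega z U = U" using homogeneous_E[OF U_E] by (auto simp: homogeneous_def dest!: spec[of _ "Arg z"])
  then show "(\<alpha> \<circ> omega z) x = (omega z \<circ> \<alpha>) x" if "x \<in> s ` {1..n}" for x
    using that by (auto simp: omega_s[OF z] \<alpha>_s star_hom_simps[OF \<alpha>] star_hom_simps[OF \<omega>] cscale_right_mult)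
qed

text \<open>Applying \<alpha> to the sum conjugates \<open>\<sigma> (\<alpha> x)\<close> by U, which
  lies in \<open>E 1 1\<close> and so commutes with the range of \<open>\<sigma>\<close>.\<close>

lemma quasi_free_\<sigma>: "\<alpha> \<circ> \<sigma> = \<sigma> \<circ> \<alpha>"
proof
  fix x
  have "\<alpha> (\<sigma> x) = (\<Sum>i=1..n. U * s i * \<alpha> x * cstar (U * s i))"
    by (simp add: canon_endo_def star_hom_simps[OF \<alpha>] \<alpha>_s)
  also have "\<dots> = U * \<sigma> (\<alpha> x) * cstar U"
    by (simp add: canon_endo_def sum_distrib_left sum_distrib_right cstar_mult mult.assoc)
  also have "\<dots> = \<sigma> (\<alpha> x) * (U * cstar U)" by (simp add: mult.assoc flip: \<sigma>_E_commute[OF U_E])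
  finally show "(\<alpha> \<circ> \<sigma>) x = (\<sigma> \<circ> \<alpha>) x" by (simp add: U_unitary)
qed

text \<open>The same computation for the family \<open>\<sigma> (s k)\<close>: by
  \<open>quasi_free_\<sigma>\<close> its members are multiplied by \<open>\<sigma> U\<close>, which
  commutes with the range of \<open>\<tau>\<close>.\<close>

lemma quasi_free_\<tau>: "\<alpha> \<circ> \<tau> = \<tau> \<circ> \<alpha>"
proof
  fix x
  have \<alpha>\<sigma>: "\<alpha> (\<sigma> (s k)) = \<sigma> U * \<sigma> (s k)" if "k \<in> {1..n}" for k
    using fun_cong[OF quasi_free_\<sigma>, of "s k"] \<alpha>_s[OF that] by (simp add: star_hom_mult[OF star_hom_\<sigma>])
  have "\<alpha> (\<tau> x) = (\<Sum>k=1..n. \<sigma> U * \<sigma> (s k) * \<alpha> x * cstar (\<sigma> U * \<sigma> (s k)))"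
    by (simp add: \<tau>_eq star_hom_simps[OF \<alpha>] \<alpha>\<sigma>)
  also have "\<dots> = \<sigma> U * \<tau> (\<alpha> x) * cstar (\<sigma> U)"
    by (simp add: \<tau>_eq sum_distrib_left sum_distrib_right cstar_mult mult.assoc)
  also have "\<dots> = \<tau> (\<alpha> x) * (\<sigma> U * cstar (\<sigma> U))"
    by (simp add: mult.assoc flip: \<tau>_\<sigma>E_commute[OF U_E])
  also have "\<sigma> U * cstar (\<sigma> U) = 1"
    by (simp only: star_hom_cstar[OF star_hom_\<sigma>, symmetric] star_hom_mult[OF star_hom_\<sigma>, symmetric]
        star_hom_one[OF star_hom_\<sigma>] U_unitary)
  finally show "(\<alpha> \<circ> \<tau>) x = (\<tau> \<circ> \<alpha>) x" by simp
qed

end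

lemma diagonalizing_automorphism:
  "\<exists>\<alpha>. cstar_automorphism \<alpha> \<and> (\<forall>i\<in>{1..n}. \<alpha> (s i) = U * s i) \<and> \<alpha> ` A = diag_alg n s \<and>
     (\<forall>z. norm z = 1 \<longrightarrow> \<alpha> \<circ> omega z = omega z \<circ> \<alpha>) \<and> \<alpha> \<circ> \<sigma> = \<sigma> \<circ> \<alpha> \<and> \<alpha> \<circ> \<tau> = \<tau> \<circ> \<alpha>"
proof -
  obtain \<alpha> \<beta> where \<alpha>: "star_hom \<alpha>" and \<beta>: "star_hom \<beta>" and inv: "\<And>x. \<alpha> (\<beta> x) = x" "\<And>x. \<beta> (\<alpha> x) = x"
    and \<alpha>_s: "\<And>i. i \<in> {1..n} \<Longrightarrow> \<alpha> (s i) = U * s i"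
    using quasi_free_automorphism[OF generates U_unitary U_E] by blast
  have \<alpha>_t: "\<alpha> (t i) = s i" if "i \<in> {1..n}" for i by (rule quasi_free_t[OF \<alpha> \<alpha>_s that])
  have \<beta>_s: "\<beta> (s i) = t i" if "i \<in> {1..n}" for i using inv(2)[of "t i"] \<alpha>_t[OF that] by simp
  have "\<beta> ` diag_alg n s \<subseteq> A" unfolding A_eq_diag by (rule star_hom_diag[OF \<beta> \<beta>_s])
  then have "diag_alg n s \<subseteq> \<alpha> ` A" using inv(1) by (metis image_subset_iff rev_image_eqI subsetI)
  moreover have "\<alpha> ` A \<subseteq> diag_alg n s" unfolding A_eq_diag by (rule star_hom_diag[OF \<alpha> \<alpha>_t])
  ultimately show ?thesis
    using star_homs_imp_cstar_automorphism[OF \<alpha> \<beta> inv] \<alpha>_s quasi_free_omega[OF \<alpha> \<alpha>_s]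
      quasi_free_\<sigma>[OF \<alpha> \<alpha>_s] quasi_free_\<tau>[OF \<alpha> \<alpha>_s]
    by (intro exI[of _ \<alpha>]) auto
qed

end

theorem theorem4p4:
  fixes n :: nat and s :: "nat \<Rightarrow> 'a::cstar_algebra"
    and omega :: "complex \<Rightarrow> 'a \<Rightarrow> 'a" and A :: "'a set"
  assumes n2: "n \<ge> 2"
    and cuntz: "cuntz_generators n s"
    and omega_aut: "\<And>t. norm t = 1 \<Longrightarrow> cstar_automorphism (omega t)"
    and omega_gen: "\<And>t i. norm t = 1 \<Longrightarrow> i \<in> {1..n} \<Longrightarrow> omega t (s i) = cscale t (s i)"
    and masa: "maximal_abelian A"
    and inv_omega: "\<And>t. norm t = 1 \<Longrightarrow> omega t ` A \<subseteq> A"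
    and inv_sigma: "canon_endo n s ` A \<subseteq> A"
    and inv_sigma2: "second_shift n s ` A \<subseteq> A"
  shows "\<exists>u. unitary_mat n u \<and>
           (\<exists>\<alpha>. cstar_automorphism \<alpha> \<and>
              (\<forall>i\<in>{1..n}. \<alpha> (s i) = mat_unitary_elem n s u * s i) \<and>
              \<alpha> ` A = diag_alg n s \<and>
              (\<forall>t. norm t = 1 \<longrightarrow> \<alpha> \<circ> omega t = omega t \<circ> \<alpha>) \<and>
              \<alpha> \<circ> canon_endo n s = canon_endo n s \<circ> \<alpha> \<and>
              \<alpha> \<circ> second_shift n s = second_shift n s \<circ> \<alpha>)"
proof -
  have "omega t x \<in> A" if "norm t = 1" "x \<in> A" for t x using inv_omega[OF that(1)] that(2) by blast
  then interpret shift_invariant_masa n s omega A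
    using assms by unfold_locales (auto simp: cuntz_generators_def intro: cstar_automorphism_imp_star_hom)
  obtain t where "diagonalized_masa n s omega A t" by (rule diagonalization)
  then interpret diagonalized_masa n s omega A t .
  show ?thesis
    using unitary_coordinate diagonalizing_automorphism unfolding U_mat[symmetric] by blast
qed

end
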